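(* Suppose that for each $K\in\mathscr T$ there are nonnegative numbers $\eta_{\mathbf y,K},\eta_{p,K},\eta_{\mathbf w,K},\eta_{q,K}$ such that $$\|\hat{\mathbf y}-\bar{\mathbf y}_{\mathscr T}\|_{\mathbf V,\Omega}^2\le \sum_{K\in\mathscr T}\eta_{\mathbf y,K}^2,\quad \|\hat p-\bar p_{\mathscr T}\|_{Q,\Omega}^2\le\sum_{K\in\mathscr T}\eta_{p,K}^2,\quad\|\hat{\mathbf w}-\bar{\mathbf w}_{\mathscr T}\|_{\mathbf V,\Omega}^2\le \sum_{K\in\mathscr T}\eta_{\mathbf w,K}^2,\quad \|\hat q-\bar q_{\mathscr T}\|_{Q,\Omega}^2\le\sum_{K\in\mathscr T}\eta_{q,K}^2 ,$$ and (computable) numbers $\tilde\eta_{\mathbf y,K},\tilde\eta_{p,K},\tilde\eta_{\mathbf w,K},\tilde\eta_{q,K}$ such that $\eta_{\mathbf y,K}\lesssim\tilde\eta_{\mathbf y,K}$, $\eta_{p,K}\lesssim\tilde\eta_{p,K}$, $\eta_{\mathbf w,K}\lesssim\tilde\eta_{\mathbf w,K}$ and $\eta_{q,K}\lesssim\tilde\eta_{q,K}$ for all $K\in\mathscr T$. Then $$E_\Omega^2\lesssim\tilde\Upsilon^2:=\sum_{K\in\mathscr T}\tilde\Upsilon_K^2,\qquad \tilde\Upsilon_K^2:=\tilde\eta_{\mathbf y,K}^2+\tilde\eta_{p,K}^2+\tilde\eta_{\mathbf w,K}^2+\tilde\eta_{q,K}^2+\eta_{\mathbf u,K}^2 ,$$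 where $E_\Omega$ is the total error and $\eta_{\mathbf u,K}$ the local control indicator.
   Context: Convention: $A\lesssim B$ means $A\le C\,B$ with a constant $C>0$ that does not depend on $A$, $B$ or the size of the mesh elements; it may depend on the fixed data $d,\Omega,\varepsilon,\kappa,\mathbf c,\vartheta,\varrho$, on $\beta$ and the shape-regularity of the mesh family and, in a conclusion, on the constants in the assumed $\lesssim$ relations. Setting. $d\in\{2,3\}$; $\Omega\subset\mathbb R^d$ is an open bounded polytopal domain with Lipschitz boundary; $\mathbf f,\mathbf y_\Omega\in L^2(\Omega)^d$; $\varepsilon>0$, $\kappa\ge0$, $\vartheta>0$, $\varrho\ge 0$ are real; $\mathbf c\in W^{1,\infty}(\Omega)^d$ with $\nabla\cdot\mathbf c=0$; $\mathbf a,\mathbf b\in\mathbb R^d$ with $\mathbf a<\mathbf b$ (vector inequalities are componentwise). $\mathbf V=H^1_0(\Omega)^d$, $Q=L^2_0(\Omega)$ (zero-mean $L^2$ functions), $\mathbf U_{ad}=\{\mathbf v\in L^2(\Omega)^d:\mathbf a\le\mathbf v\le\mathbf b\text{ a.e. in }\Omega\}$. $\mathscr T$ is a conforming partition of $\bar\Omega$ into simplices $K$, a member of a shape-regular family. Norms: $\|\boldsymbol\xi\|_{\mathbf V,K}^2=\varepsilon\|\nabla\boldsymbol\xi\|_{L^2(K)}^2+\kappa\|\boldsymbol\xi\|_{L^2(K)}^2$, $\|\phi\|_{Q,K}=\|\phi\|_{L^2(K)}$, and $\|\cdot\|^2_{\mathbf V,\Omega}=\sum_{K\in\mathscr T}\|\cdot\|^2_{\mathbf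 V,K}$, $\|\cdot\|^2_{Q,\Omega}=\sum_{K\in\mathscr T}\|\cdot\|_{Q,K}^2$. Forms: $\mathcal A(\boldsymbol\xi,\boldsymbol\zeta)=\varepsilon(\nabla\boldsymbol\xi,\nabla\boldsymbol\zeta)_\Omega+(\kappa\boldsymbol\xi+(\mathbf c\cdot\nabla)\boldsymbol\xi,\boldsymbol\zeta)_\Omega$, $\mathcal B(\boldsymbol\zeta,\phi)=(\phi,\nabla\cdot\boldsymbol\zeta)_\Omega$, $\mathcal C(\boldsymbol\xi,\boldsymbol\zeta)=\varepsilon(\nabla\boldsymbol\xi,\nabla\boldsymbol\zeta)_\Omega+(\kappa\boldsymbol\xi-(\mathbf c\cdot\nabla)\boldsymbol\xi,\boldsymbol\zeta)_\Omega$, with $(\cdot,\cdot)_\Omega$ the $L^2(\Omega)$ inner product. $\beta>0$ is a constant with $\beta\|\phi\|_{L^2(\Omega)}\le\sup_{\boldsymbol\xi\in\mathbf V\setminus\{0\}}\mathcal B(\boldsymbol\xi,\phi)/\|\nabla\boldsymbol\xi\|_{L^2(\Omega)}$ for all $\phi\in Q$ (inf-sup condition). Continuous optimality system: $(\bar{\mathbf y},\bar p,\bar{\mathbf w},\bar q,\bar{\mathbf u})\in\mathbf V\times Q\times\mathbf V\times Q\times\mathbf U_{ad}$ is the unique solution of: $\mathcal A(\bar{\mathbf y},\boldsymbol\xi)-\mathcal B(\boldsymbol\xi,\bar p)=(\mathbf f+\bar{\mathbf u},\boldsymbol\xi)_\Omega$, $\mathcal B(\bar{\mathbf y},\phi)=0$,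 $\mathcal C(\bar{\mathbf w},\boldsymbol\zeta)+\mathcal B(\boldsymbol\zeta,\bar q)=(\bar{\mathbf y}-\mathbf y_\Omega,\boldsymbol\zeta)_\Omega$, $\mathcal B(\bar{\mathbf w},\psi)=0$, $(\bar{\mathbf w}+\vartheta\bar{\mathbf u},\mathbf u-\bar{\mathbf u})_\Omega\ge0$ for all $\boldsymbol\xi,\boldsymbol\zeta\in\mathbf V$, $\phi,\psi\in Q$, $\mathbf u\in\mathbf U_{ad}$. Discrete system: $\mathbf V(\mathscr T)\subset\mathbf V$ and $Q(\mathscr T)\subset Q$ are (discrete) subspaces and $\mathbf U_{ad}(\mathscr T)\subset\mathbf U_{ad}$ is a (discrete) subset. $\mathcal S,\mathcal H,\mathcal Q,\mathcal K$ are real-valued stabilization terms (possibly zero, with no relation between them assumed). $(\bar{\mathbf y}_{\mathscr T},\bar p_{\mathscr T},\bar{\mathbf w}_{\mathscr T},\bar q_{\mathscr T},\bar{\mathbf u}_{\mathscr T})\in\mathbf V(\mathscr T)\times Q(\mathscr T)\times\mathbf V(\mathscr T)\times Q(\mathscr T)\times\mathbf U_{ad}(\mathscr T)$ is a solution (at least one is assumed to exist) of: $\mathcal A(\bar{\mathbf y}_{\mathscr T},\boldsymbol\xi)-\mathcal B(\boldsymbol\xi,\bar p_{\mathscr T})+\mathcal S(\bar{\mathbf y}_{\mathscr T},\bar p_{\mathscr T},\mathbf f+\bar{\mathbf u}_{\mathscr T};\boldsymbol\xi)=(\mathbf f+\bar{\mathbf u}_{\mathscr T},\boldsymbol\xi)_\Omega$,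 $\mathcal B(\bar{\mathbf y}_{\mathscr T},\phi)+\mathcal H(\bar{\mathbf y}_{\mathscr T},\bar p_{\mathscr T},\mathbf f+\bar{\mathbf u}_{\mathscr T};\phi)=0$, $\mathcal C(\bar{\mathbf w}_{\mathscr T},\boldsymbol\zeta)+\mathcal B(\boldsymbol\zeta,\bar q_{\mathscr T})+\mathcal Q(\bar{\mathbf w}_{\mathscr T},\bar q_{\mathscr T},\bar{\mathbf y}_{\mathscr T}-\mathbf y_\Omega;\boldsymbol\zeta)=(\bar{\mathbf y}_{\mathscr T}-\mathbf y_\Omega,\boldsymbol\zeta)_\Omega$, $\mathcal B(\bar{\mathbf w}_{\mathscr T},\psi)+\mathcal K(\bar{\mathbf w}_{\mathscr T},\bar q_{\mathscr T},\bar{\mathbf y}_{\mathscr T}-\mathbf y_\Omega;\psi)=0$, $(\bar{\mathbf w}_{\mathscr T}+\vartheta\bar{\mathbf u}_{\mathscr T},\mathbf u-\bar{\mathbf u}_{\mathscr T})_\Omega\ge0$ for all $\boldsymbol\xi,\boldsymbol\zeta\in\mathbf V(\mathscr T)$, $\phi,\psi\in Q(\mathscr T)$, $\mathbf u\in\mathbf U_{ad}(\mathscr T)$. Auxiliary solutions: $(\hat{\mathbf y},\hat p)\in\mathbf V\times Q$ solves $\mathcal A(\hat{\mathbf y},\boldsymbol\xi)-\mathcal B(\boldsymbol\xi,\hat p)=(\mathbf f+\bar{\mathbf u}_{\mathscr T},\boldsymbol\xi)_\Omega$, $\mathcal B(\hat{\mathbf y},\phi)=0$ for all $(\boldsymbol\xi,\phi)\in\mathbf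 V\times Q$; $(\hat{\mathbf w},\hat q)\in\mathbf V\times Q$ solves $\mathcal C(\hat{\mathbf w},\boldsymbol\zeta)+\mathcal B(\boldsymbol\zeta,\hat q)=(\bar{\mathbf y}_{\mathscr T}-\mathbf y_\Omega,\boldsymbol\zeta)_\Omega$, $\mathcal B(\hat{\mathbf w},\psi)=0$ for all $(\boldsymbol\zeta,\psi)\in\mathbf V\times Q$. Control indicator: $\tilde{\mathbf u}=\Pi_{[\mathbf a,\mathbf b]}(-\frac1\vartheta\bar{\mathbf w}_{\mathscr T})$ with $\Pi_{[\mathbf a,\mathbf b]}(\boldsymbol\zeta)(x)=\min\{\mathbf b,\max\{\mathbf a,\boldsymbol\zeta(x)\}\}$ componentwise; $\eta_{\mathbf u,K}=\|\tilde{\mathbf u}-\bar{\mathbf u}_{\mathscr T}\|_{L^2(K)}$. Errors: $\mathbf e_{\mathbf y}=\bar{\mathbf y}-\bar{\mathbf y}_{\mathscr T}$, $e_p=\bar p-\bar p_{\mathscr T}$, $\mathbf e_{\mathbf w}=\bar{\mathbf w}-\bar{\mathbf w}_{\mathscr T}$, $e_q=\bar q-\bar q_{\mathscr T}$, $\mathbf e_{\mathbf u}=\bar{\mathbf u}-\bar{\mathbf u}_{\mathscr T}$; $E_K^2=\|\mathbf e_{\mathbf y}\|_{\mathbf V,K}^2+\varrho\|e_p\|_{Q,K}^2+\|\mathbf e_{\mathbf w}\|_{\mathbf V,K}^2+\varrho\|e_q\|_{Q,K}^2+\|\mathbf e_{\mathbf u}\|_{L^2(K)}^2$ and $E_\Omega^2=\sum_{K\in\mathscr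 T}E_K^2$. *)

theory Defs
  imports "HOL-Analysis.Analysis"
begin

text \<open>
  \<open>has_lipschitz_boundary\<close>: near every boundary point \<open>\<Omega>\<close> is, in a direction \<open>\<nu>\<close>, the strict
  epigraph of a Lipschitz function \<open>\<gamma>\<close> on the hyperplane orthogonal to \<open>\<nu>\<close>.
\<close>

definition has_lipschitz_boundary :: "(real^'n) set \<Rightarrow> bool" where
  "has_lipschitz_boundary \<Omega> \<longleftrightarrow>
     (\<forall>x\<in>frontier \<Omega>. \<exists>r>0. \<exists>\<nu>. \<exists>\<gamma> :: real^'n \<Rightarrow> real. \<exists>L.
        norm \<nu> = 1 \<and> L-lipschitz_on {z. z \<bullet> \<nu> = 0} \<gamma> \<and>
        \<Omega> \<inter> ball x r = {y \<in> ball x r. \<gamma> (y - (y \<bullet> \<nu>) *\<^sub>R \<nu>) < y \<bullet> \<nu>})"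

definition polytopal_lipschitz_domain :: "(real^'n) set \<Rightarrow> bool" where
  "polytopal_lipschitz_domain \<Omega> \<longleftrightarrow>
     open \<Omega> \<and> bounded \<Omega> \<and> connected \<Omega> \<and> \<Omega> \<noteq> {} \<and>
     (\<exists>P. finite P \<and> (\<forall>p\<in>P. polytope p) \<and> closure \<Omega> = \<Union>P) \<and>
     has_lipschitz_boundary \<Omega>"

text \<open>The library's \<open>triangulation\<close> contains finiteness and the conformity condition that any two
  elements intersect in a common (possibly empty) face.\<close>

definition conforming_mesh :: "(real^'n) set \<Rightarrow> (real^'n) set set \<Rightarrow> bool" where
  "conforming_mesh \<Omega> \<T> \<longleftrightarrow>
     triangulation \<T> \<and> (\<forall>K\<in>\<T>. int CARD('n) simplex K) \<and> \<Union>\<T> = closure \<Omega>"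

definition inball_diameter :: "(real^'n) set \<Rightarrow> real" where
  "inball_diameter K = Sup {2 * r | r. 0 \<le> r \<and> (\<exists>x. cball x r \<subseteq> K)}"

definition shape_regular_family ::
  "(real^'n) set \<Rightarrow> real \<Rightarrow> (real^'n) set set set \<Rightarrow> bool" where
  "shape_regular_family \<Omega> \<sigma> \<F> \<longleftrightarrow>
     (\<forall>\<T>\<in>\<F>. conforming_mesh \<Omega> \<T> \<and> (\<forall>K\<in>\<T>. diameter K \<le> \<sigma> * inball_diameter K))"

text \<open>
  Elements of function spaces are represented by functions on the whole space; only their values
  almost everywhere in \<open>\<Omega>\<close> matter. The completed measure is used because the closed mesh elements
  may meet \<open>frontier \<Omega>\<close>, a null set on which a representative can take any values.
\<close>

definition L2_space :: "(real^'n) set \<Rightarrow> (real^'n \<Rightarrow> 'b::euclidean_space) set" where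
  "L2_space S = {f. f \<in> borel_measurable (lebesgue_on S) \<and>
                    integrable (lebesgue_on S) (\<lambda>x. (norm (f x))\<^sup>2)}"

definition L2_inner ::
  "(real^'n) set \<Rightarrow> (real^'n \<Rightarrow> 'b::euclidean_space) \<Rightarrow> (real^'n \<Rightarrow> 'b) \<Rightarrow> real" where
  "L2_inner S f g = (\<integral>x. f x \<bullet> g x \<partial>lebesgue_on S)"

definition L2_norm :: "(real^'n) set \<Rightarrow> (real^'n \<Rightarrow> 'b::euclidean_space) \<Rightarrow> real" where
  "L2_norm S f = sqrt (\<integral>x. (norm (f x))\<^sup>2 \<partial>lebesgue_on S)"

definition Linf_space :: "(real^'n) set \<Rightarrow> (real^'n \<Rightarrow> 'b::euclidean_space) set" where
  "Linf_space S = {f. f \<in> borel_measurable (lebesgue_on S) \<and>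
                      (\<exists>M. AE x in lebesgue_on S. norm (f x) \<le> M)}"

definition L2_zero_mean :: "(real^'n) set \<Rightarrow> (real^'n \<Rightarrow> real) set" where
  "L2_zero_mean \<Omega> = {\<phi> \<in> L2_space \<Omega>. (\<integral>x. \<phi> x \<partial>lebesgue_on \<Omega>) = 0}"

definition partial :: "'n \<Rightarrow> (real^'n \<Rightarrow> real) \<Rightarrow> real^'n \<Rightarrow> real" where
  "partial i f x = frechet_derivative f (at x) (axis i 1)"

primrec C_k :: "nat \<Rightarrow> (real^'n \<Rightarrow> real) \<Rightarrow> bool" where
  "C_k 0 f \<longleftrightarrow> continuous_on UNIV f"
| "C_k (Suc k) f \<longleftrightarrow> f differentiable_on UNIV \<and> (\<forall>i. C_k k (partial i f))"

definition test_functions :: "(real^'n) set \<Rightarrow> (real^'n \<Rightarrow> real) set" where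
  "test_functions \<Omega> = {\<phi>. (\<forall>k. C_k k \<phi>) \<and>
     compact (closure {x. \<phi> x \<noteq> 0}) \<and> closure {x. \<phi> x \<noteq> 0} \<subseteq> \<Omega>}"

definition locally_integrable :: "(real^'n) set \<Rightarrow> (real^'n \<Rightarrow> real) \<Rightarrow> bool" where
  "locally_integrable \<Omega> f \<longleftrightarrow> (\<forall>D. compact D \<and> D \<subseteq> \<Omega> \<longrightarrow> integrable (lebesgue_on D) f)"

definition has_weak_partial ::
  "(real^'n) set \<Rightarrow> 'n \<Rightarrow> (real^'n \<Rightarrow> real) \<Rightarrow> (real^'n \<Rightarrow> real) \<Rightarrow> bool" where
  "has_weak_partial \<Omega> i f g \<longleftrightarrow>
     locally_integrable \<Omega> f \<and> locally_integrable \<Omega> g \<and>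
     (\<forall>\<phi>\<in>test_functions \<Omega>.
        (\<integral>x. f x * partial i \<phi> x \<partial>lebesgue_on \<Omega>) = - (\<integral>x. g x * \<phi> x \<partial>lebesgue_on \<Omega>))"

text \<open>Weak derivatives are determined only up to null sets, so one representative is chosen;
  the value is meaningful only if a weak derivative exists.\<close>

definition weak_partial :: "(real^'n) set \<Rightarrow> 'n \<Rightarrow> (real^'n \<Rightarrow> real) \<Rightarrow> real^'n \<Rightarrow> real" where
  "weak_partial \<Omega> i f = (SOME g. has_weak_partial \<Omega> i f g)"

definition H1_space :: "(real^'n) set \<Rightarrow> (real^'n \<Rightarrow> real) set" where
  "H1_space \<Omega> = {f \<in> L2_space \<Omega>. \<forall>i. \<exists>g\<in>L2_space \<Omega>. has_weak_partial \<Omega> i f g}"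

definition H1_norm :: "(real^'n) set \<Rightarrow> (real^'n \<Rightarrow> real) \<Rightarrow> real" where
  "H1_norm \<Omega> f = sqrt ((L2_norm \<Omega> f)\<^sup>2 + (\<Sum>i\<in>UNIV. (L2_norm \<Omega> (weak_partial \<Omega> i f))\<^sup>2))"

definition H10_space :: "(real^'n) set \<Rightarrow> (real^'n \<Rightarrow> real) set" where
  "H10_space \<Omega> = {f \<in> H1_space \<Omega>. \<exists>\<phi>. (\<forall>n. \<phi> n \<in> test_functions \<Omega>) \<and>
     (\<lambda>n::nat. H1_norm \<Omega> (\<lambda>x. \<phi> n x - f x)) \<longlonglongrightarrow> 0}"

definition H10_vec :: "(real^'n) set \<Rightarrow> (real^'n \<Rightarrow> real^'n) set" where
  "H10_vec \<Omega> = {\<xi>. \<forall>i. (\<lambda>x. \<xi> x $ i) \<in> H10_space \<Omega>}"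

definition W1inf_vec :: "(real^'n) set \<Rightarrow> (real^'n \<Rightarrow> real^'n) set" where
  "W1inf_vec \<Omega> = {\<xi>. \<forall>i. (\<lambda>x. \<xi> x $ i) \<in> Linf_space \<Omega> \<and>
     (\<forall>j. \<exists>g\<in>Linf_space \<Omega>. has_weak_partial \<Omega> j (\<lambda>x. \<xi> x $ i) g)}"

text \<open>The entry in row \<open>i\<close> and column \<open>j\<close> of the gradient is \<open>\<partial>\<^sub>j \<xi>\<^sub>i\<close>, so that \<open>(c \<cdot> \<nabla>) \<xi>\<close> is the
  gradient applied to \<open>c\<close>; norm and inner product on matrices are those of Frobenius.\<close>

definition weak_grad :: "(real^'n) set \<Rightarrow> (real^'n \<Rightarrow> real^'n) \<Rightarrow> real^'n \<Rightarrow> real^'n^'n" where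
  "weak_grad \<Omega> \<xi> x = (\<chi> i j. weak_partial \<Omega> j (\<lambda>z. \<xi> z $ i) x)"

definition weak_div :: "(real^'n) set \<Rightarrow> (real^'n \<Rightarrow> real^'n) \<Rightarrow> real^'n \<Rightarrow> real" where
  "weak_div \<Omega> \<xi> x = (\<Sum>i\<in>UNIV. weak_partial \<Omega> i (\<lambda>z. \<xi> z $ i) x)"

definition convect ::
  "(real^'n) set \<Rightarrow> (real^'n \<Rightarrow> real^'n) \<Rightarrow> (real^'n \<Rightarrow> real^'n) \<Rightarrow> real^'n \<Rightarrow> real^'n" where
  "convect \<Omega> c \<xi> x = weak_grad \<Omega> \<xi> x *v c x"

text \<open>Local norms use the gradient of \<open>\<xi>\<close> on all of \<open>\<Omega>\<close>, restricted to the element \<open>K\<close>.\<close>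

definition V_norm ::
  "(real^'n) set \<Rightarrow> real \<Rightarrow> real \<Rightarrow> (real^'n) set \<Rightarrow> (real^'n \<Rightarrow> real^'n) \<Rightarrow> real" where
  "V_norm \<Omega> \<epsilon> \<kappa> K \<xi> = sqrt (\<epsilon> * (L2_norm K (weak_grad \<Omega> \<xi>))\<^sup>2 + \<kappa> * (L2_norm K \<xi>)\<^sup>2)"

definition V_norm_mesh ::
  "(real^'n) set \<Rightarrow> real \<Rightarrow> real \<Rightarrow> (real^'n) set set \<Rightarrow> (real^'n \<Rightarrow> real^'n) \<Rightarrow> real" where
  "V_norm_mesh \<Omega> \<epsilon> \<kappa> \<T> \<xi> = sqrt (\<Sum>K\<in>\<T>. (V_norm \<Omega> \<epsilon> \<kappa> K \<xi>)\<^sup>2)"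

definition Q_norm_mesh :: "(real^'n) set set \<Rightarrow> (real^'n \<Rightarrow> real) \<Rightarrow> real" where
  "Q_norm_mesh \<T> \<phi> = sqrt (\<Sum>K\<in>\<T>. (L2_norm K \<phi>)\<^sup>2)"

definition form_A ::
  "(real^'n) set \<Rightarrow> real \<Rightarrow> real \<Rightarrow> (real^'n \<Rightarrow> real^'n) \<Rightarrow>
   (real^'n \<Rightarrow> real^'n) \<Rightarrow> (real^'n \<Rightarrow> real^'n) \<Rightarrow> real" where
  "form_A \<Omega> \<epsilon> \<kappa> c \<xi> \<zeta> =
     \<epsilon> * L2_inner \<Omega> (weak_grad \<Omega> \<xi>) (weak_grad \<Omega> \<zeta>)
     + L2_inner \<Omega> (\<lambda>x. \<kappa> *\<^sub>R \<xi> x + convect \<Omega> c \<xi> x) \<zeta>"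

definition form_B ::
  "(real^'n) set \<Rightarrow> (real^'n \<Rightarrow> real^'n) \<Rightarrow> (real^'n \<Rightarrow> real) \<Rightarrow> real" where
  "form_B \<Omega> \<zeta> \<phi> = L2_inner \<Omega> \<phi> (weak_div \<Omega> \<zeta>)"

definition form_C ::
  "(real^'n) set \<Rightarrow> real \<Rightarrow> real \<Rightarrow> (real^'n \<Rightarrow> real^'n) \<Rightarrow>
   (real^'n \<Rightarrow> real^'n) \<Rightarrow> (real^'n \<Rightarrow> real^'n) \<Rightarrow> real" where
  "form_C \<Omega> \<epsilon> \<kappa> c \<xi> \<zeta> =
     \<epsilon> * L2_inner \<Omega> (weak_grad \<Omega> \<xi>) (weak_grad \<Omega> \<zeta>)
     + L2_inner \<Omega> (\<lambda>x. \<kappa> *\<^sub>R \<xi> x - convect \<Omega> c \<xi> x) \<zeta>"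

text \<open>The supremum is taken in the extended reals, where it needs no boundedness proviso;
  \<open>\<xi> \<noteq> 0\<close> means that \<open>\<xi>\<close> is not zero almost everywhere.\<close>

definition inf_sup_condition :: "(real^'n) set \<Rightarrow> real \<Rightarrow> bool" where
  "inf_sup_condition \<Omega> \<beta> \<longleftrightarrow>
     (\<forall>\<phi>\<in>L2_zero_mean \<Omega>.
        ereal (\<beta> * L2_norm \<Omega> \<phi>) \<le>
        (SUP \<xi>\<in>{\<xi> \<in> H10_vec \<Omega>. \<not> (AE x in lebesgue_on \<Omega>. \<xi> x = 0)}.
           ereal (form_B \<Omega> \<xi> \<phi> / L2_norm \<Omega> (weak_grad \<Omega> \<xi>))))"

definition U_ad :: "(real^'n) set \<Rightarrow> real^'n \<Rightarrow> real^'n \<Rightarrow> (real^'n \<Rightarrow> real^'n) set" where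
  "U_ad \<Omega> a b = {v \<in> L2_space \<Omega>. AE x in lebesgue_on \<Omega>. a \<le> v x \<and> v x \<le> b}"

definition state_solution ::
  "(real^'n) set \<Rightarrow> real \<Rightarrow> real \<Rightarrow> (real^'n \<Rightarrow> real^'n) \<Rightarrow> (real^'n \<Rightarrow> real^'n) \<Rightarrow>
   (real^'n \<Rightarrow> real^'n) \<Rightarrow> (real^'n \<Rightarrow> real) \<Rightarrow> bool" where
  "state_solution \<Omega> \<epsilon> \<kappa> c g y p \<longleftrightarrow>
     y \<in> H10_vec \<Omega> \<and> p \<in> L2_zero_mean \<Omega> \<and>
     (\<forall>\<xi>\<in>H10_vec \<Omega>. form_A \<Omega> \<epsilon> \<kappa> c y \<xi> - form_B \<Omega> \<xi> p = L2_inner \<Omega> g \<xi>) \<and>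
     (\<forall>\<phi>\<in>L2_zero_mean \<Omega>. form_B \<Omega> y \<phi> = 0)"

definition adjoint_solution ::
  "(real^'n) set \<Rightarrow> real \<Rightarrow> real \<Rightarrow> (real^'n \<Rightarrow> real^'n) \<Rightarrow> (real^'n \<Rightarrow> real^'n) \<Rightarrow>
   (real^'n \<Rightarrow> real^'n) \<Rightarrow> (real^'n \<Rightarrow> real) \<Rightarrow> bool" where
  "adjoint_solution \<Omega> \<epsilon> \<kappa> c g w q \<longleftrightarrow>
     w \<in> H10_vec \<Omega> \<and> q \<in> L2_zero_mean \<Omega> \<and>
     (\<forall>\<zeta>\<in>H10_vec \<Omega>. form_C \<Omega> \<epsilon> \<kappa> c w \<zeta> + form_B \<Omega> \<zeta> q = L2_inner \<Omega> g \<zeta>) \<and>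
     (\<forall>\<psi>\<in>L2_zero_mean \<Omega>. form_B \<Omega> w \<psi> = 0)"

definition optimality_system ::
  "(real^'n) set \<Rightarrow> real \<Rightarrow> real \<Rightarrow> (real^'n \<Rightarrow> real^'n) \<Rightarrow> real \<Rightarrow>
   (real^'n \<Rightarrow> real^'n) \<Rightarrow> (real^'n \<Rightarrow> real^'n) \<Rightarrow> real^'n \<Rightarrow> real^'n \<Rightarrow>
   (real^'n \<Rightarrow> real^'n) \<Rightarrow> (real^'n \<Rightarrow> real) \<Rightarrow> (real^'n \<Rightarrow> real^'n) \<Rightarrow> (real^'n \<Rightarrow> real) \<Rightarrow>
   (real^'n \<Rightarrow> real^'n) \<Rightarrow> bool" where
  "optimality_system \<Omega> \<epsilon> \<kappa> c \<theta> f y\<^sub>\<Omega> a b y p w q u \<longleftrightarrow>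
     state_solution \<Omega> \<epsilon> \<kappa> c (\<lambda>x. f x + u x) y p \<and>
     adjoint_solution \<Omega> \<epsilon> \<kappa> c (\<lambda>x. y x - y\<^sub>\<Omega> x) w q \<and>
     u \<in> U_ad \<Omega> a b \<and>
     (\<forall>v\<in>U_ad \<Omega> a b. L2_inner \<Omega> (\<lambda>x. w x + \<theta> *\<^sub>R u x) (\<lambda>x. v x - u x) \<ge> 0)"

text \<open>For sets of representatives, this describes exactly the linear subspaces of equivalence
  classes; such a set need not be closed under changes on null sets.\<close>

definition function_subspace :: "('a \<Rightarrow> 'b::real_vector) set \<Rightarrow> bool" where
  "function_subspace W \<longleftrightarrow>
     (\<lambda>x. 0) \<in> W \<and> (\<forall>v\<in>W. \<forall>w\<in>W. (\<lambda>x. v x + w x) \<in> W) \<and> (\<forall>r. \<forall>v\<in>W. (\<lambda>x. r *\<^sub>R v x) \<in> W)"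

text \<open>The stabilization terms \<open>\<S>\<close>, \<open>\<H>\<close>, \<open>\<Q>\<close>, \<open>\<K>\<close> are arbitrary real-valued maps; in particular, no
  linearity or consistency is required.\<close>

definition discrete_optimality_system ::
  "(real^'n) set \<Rightarrow> real \<Rightarrow> real \<Rightarrow> (real^'n \<Rightarrow> real^'n) \<Rightarrow> real \<Rightarrow>
   (real^'n \<Rightarrow> real^'n) \<Rightarrow> (real^'n \<Rightarrow> real^'n) \<Rightarrow>
   (real^'n \<Rightarrow> real^'n) set \<Rightarrow> (real^'n \<Rightarrow> real) set \<Rightarrow> (real^'n \<Rightarrow> real^'n) set \<Rightarrow>
   ((real^'n \<Rightarrow> real^'n) \<Rightarrow> (real^'n \<Rightarrow> real) \<Rightarrow> (real^'n \<Rightarrow> real^'n) \<Rightarrow> (real^'n \<Rightarrow> real^'n) \<Rightarrow> real) \<Rightarrow>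
   ((real^'n \<Rightarrow> real^'n) \<Rightarrow> (real^'n \<Rightarrow> real) \<Rightarrow> (real^'n \<Rightarrow> real^'n) \<Rightarrow> (real^'n \<Rightarrow> real) \<Rightarrow> real) \<Rightarrow>
   ((real^'n \<Rightarrow> real^'n) \<Rightarrow> (real^'n \<Rightarrow> real) \<Rightarrow> (real^'n \<Rightarrow> real^'n) \<Rightarrow> (real^'n \<Rightarrow> real^'n) \<Rightarrow> real) \<Rightarrow>
   ((real^'n \<Rightarrow> real^'n) \<Rightarrow> (real^'n \<Rightarrow> real) \<Rightarrow> (real^'n \<Rightarrow> real^'n) \<Rightarrow> (real^'n \<Rightarrow> real) \<Rightarrow> real) \<Rightarrow>
   (real^'n \<Rightarrow> real^'n) \<Rightarrow> (real^'n \<Rightarrow> real) \<Rightarrow> (real^'n \<Rightarrow> real^'n) \<Rightarrow> (real^'n \<Rightarrow> real) \<Rightarrow>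
   (real^'n \<Rightarrow> real^'n) \<Rightarrow> bool" where
  "discrete_optimality_system \<Omega> \<epsilon> \<kappa> c \<theta> f y\<^sub>\<Omega> V\<^sub>T Q\<^sub>T U\<^sub>T \<S> \<H> \<Q> \<K> y p w q u \<longleftrightarrow>
     y \<in> V\<^sub>T \<and> p \<in> Q\<^sub>T \<and> w \<in> V\<^sub>T \<and> q \<in> Q\<^sub>T \<and> u \<in> U\<^sub>T \<and>
     (\<forall>\<xi>\<in>V\<^sub>T. form_A \<Omega> \<epsilon> \<kappa> c y \<xi> - form_B \<Omega> \<xi> p + \<S> y p (\<lambda>x. f x + u x) \<xi>
               = L2_inner \<Omega> (\<lambda>x. f x + u x) \<xi>) \<and>
     (\<forall>\<phi>\<in>Q\<^sub>T. form_B \<Omega> y \<phi> + \<H> y p (\<lambda>x. f x + u x) \<phi> = 0) \<and>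
     (\<forall>\<zeta>\<in>V\<^sub>T. form_C \<Omega> \<epsilon> \<kappa> c w \<zeta> + form_B \<Omega> \<zeta> q + \<Q> w q (\<lambda>x. y x - y\<^sub>\<Omega> x) \<zeta>
               = L2_inner \<Omega> (\<lambda>x. y x - y\<^sub>\<Omega> x) \<zeta>) \<and>
     (\<forall>\<psi>\<in>Q\<^sub>T. form_B \<Omega> w \<psi> + \<K> w q (\<lambda>x. y x - y\<^sub>\<Omega> x) \<psi> = 0) \<and>
     (\<forall>v\<in>U\<^sub>T. L2_inner \<Omega> (\<lambda>x. w x + \<theta> *\<^sub>R u x) (\<lambda>x. v x - u x) \<ge> 0)"

definition box_projection ::
  "real^'n \<Rightarrow> real^'n \<Rightarrow> (real^'n \<Rightarrow> real^'n) \<Rightarrow> real^'n \<Rightarrow> real^'n" where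
  "box_projection a b \<zeta> x = (\<chi> i. min (b $ i) (max (a $ i) (\<zeta> x $ i)))"

definition control_indicator ::
  "real \<Rightarrow> real^'n \<Rightarrow> real^'n \<Rightarrow> (real^'n \<Rightarrow> real^'n) \<Rightarrow> (real^'n \<Rightarrow> real^'n) \<Rightarrow>
   (real^'n) set \<Rightarrow> real" where
  "control_indicator \<theta> a b w u K =
     L2_norm K (\<lambda>x. box_projection a b (\<lambda>z. - (1 / \<theta>) *\<^sub>R w z) x - u x)"

definition local_error ::
  "(real^'n) set \<Rightarrow> real \<Rightarrow> real \<Rightarrow> real \<Rightarrow>
   (real^'n \<Rightarrow> real^'n) \<Rightarrow> (real^'n \<Rightarrow> real) \<Rightarrow> (real^'n \<Rightarrow> real^'n) \<Rightarrow> (real^'n \<Rightarrow> real) \<Rightarrow>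
   (real^'n \<Rightarrow> real^'n) \<Rightarrow> (real^'n) set \<Rightarrow> real" where
  "local_error \<Omega> \<epsilon> \<kappa> \<rho> e\<^sub>y e\<^sub>p e\<^sub>w e\<^sub>q e\<^sub>u K =
     sqrt ((V_norm \<Omega> \<epsilon> \<kappa> K e\<^sub>y)\<^sup>2 + \<rho> * (L2_norm K e\<^sub>p)\<^sup>2
           + (V_norm \<Omega> \<epsilon> \<kappa> K e\<^sub>w)\<^sup>2 + \<rho> * (L2_norm K e\<^sub>q)\<^sup>2 + (L2_norm K e\<^sub>u)\<^sup>2)"

definition total_error ::
  "(real^'n) set \<Rightarrow> real \<Rightarrow> real \<Rightarrow> real \<Rightarrow>
   (real^'n \<Rightarrow> real^'n) \<Rightarrow> (real^'n \<Rightarrow> real) \<Rightarrow> (real^'n \<Rightarrow> real^'n) \<Rightarrow> (real^'n \<Rightarrow> real) \<Rightarrow>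
   (real^'n \<Rightarrow> real^'n) \<Rightarrow> (real^'n) set set \<Rightarrow> real" where
  "total_error \<Omega> \<epsilon> \<kappa> \<rho> e\<^sub>y e\<^sub>p e\<^sub>w e\<^sub>q e\<^sub>u \<T> =
     sqrt (\<Sum>K\<in>\<T>. (local_error \<Omega> \<epsilon> \<kappa> \<rho> e\<^sub>y e\<^sub>p e\<^sub>w e\<^sub>q e\<^sub>u K)\<^sup>2)"

end

theory Submission
  imports Defs
begin

text \<open>
  Let \<open>v\<close> be the projection of \<open>- w\<^sub>T / \<theta>\<close> onto the box, which solves the variational inequality with
  adjoint \<open>w\<^sub>T\<close>, and put \<open>D = y - yh\<close>. Adding the inequalities of \<open>u\<close> and \<open>v\<close> gives
  \<open>\<theta> \<parallel>u - v\<parallel>\<^sup>2 \<le> (w - w\<^sub>T, v - u)\<close>, and the right-hand side is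
  \<open>(w - wh, v - u\<^sub>T) + (w - wh, u\<^sub>T - u) + (wh - w\<^sub>T, v - u)\<close>. Since the form of the adjoint equation is
  the transpose of that of the state equation (\<open>c\<close> is solenoidal), the middle term equals \<open>- (y - y\<^sub>T, D)\<close>,
  which supplies \<open>- \<parallel>D\<parallel>\<^sup>2\<close>; hence \<open>D\<close> can be absorbed and \<open>u - v\<close> is bounded by the
  estimators. No auxiliary problem has to be solved beyond the given ones. All other errors follow from
  the stability of the state and adjoint equations, where the inf-sup condition controls the pressures.
\<close>

section \<open>Square integrable functions\<close>

text \<open>The discrete control satisfies its variational inequality only against discrete
  controls, so \<open>u\<close> cannot be inserted there; \<open>v\<close> satisfies one against
  every admissible control. Bounding \<open>(w - w\<^sub>T, v - u)\<close> by stability alone would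
  leave a multiple of \<open>\<parallel>u - v\<parallel>\<^sup>2\<close> on the right, harmless only
  for large \<theta>; the sign of the middle term avoids such a restriction. What remains is linear
  in \<open>\<parallel>D\<parallel>\<close>, because \<open>w - wh\<close> is driven by
  \<open>y - y\<^sub>T\<close>, that is, by \<open>D\<close> and \<open>yh - y\<^sub>T\<close>. The
  transposition also needs the pressures to drop out, which they do since \<open>y - yh\<close> and
  \<open>w - wh\<close> are divergence-free. The function spaces pose obstacles of their own.
  \<open>weak_partial\<close> is an arbitrary choice, so even additivity of the gradient holds only
  almost everywhere and rests on uniqueness of weak derivatives, hence on a supply of test
  functions. The closed elements cover the closure of the domain, so adding up local norms requires
  a negligible frontier. The constants of the estimate on \<Omega> come only from \<epsilon>,
  \<kappa>, \<theta>, \<beta>, a bound for \<open>c\<close> and the Poincare constant.\<close>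

lemma L2_spaceD:
  assumes "f \<in> L2_space S"
  shows "f \<in> borel_measurable (lebesgue_on S)" "integrable (lebesgue_on S) (\<lambda>x. (norm (f x))\<^sup>2)"
  using assms by (auto simp: L2_space_def)

lemma L2_space_dominated:
  assumes g: "integrable (lebesgue_on S) g" and f: "f \<in> borel_measurable (lebesgue_on S)"
    and le: "AE x in lebesgue_on S. (norm (f x))\<^sup>2 \<le> g x"
  shows "f \<in> L2_space S"
  unfolding L2_space_def
proof (intro CollectI conjI f)
  show "integrable (lebesgue_on S) (\<lambda>x. (norm (f x))\<^sup>2)"
    by (rule Bochner_Integration.integrable_bound[OF g]) (use f le in auto)
qed

lemma L2_inner_integrable:
  assumes "f \<in> L2_space S" "g \<in> L2_space S"
  shows "integrable (lebesgue_on S) (\<lambda>x. f x \<bullet> g x)"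
proof (rule Bochner_Integration.integrable_bound)
  show "integrable (lebesgue_on S) (\<lambda>x. (norm (f x))\<^sup>2 + (norm (g x))\<^sup>2)"
    using assms by (auto simp: L2_space_def)
  show "(\<lambda>x. f x \<bullet> g x) \<in> borel_measurable (lebesgue_on S)"
    using assms by (auto simp: L2_space_def)
  have "\<bar>u \<bullet> v\<bar> \<le> (norm u)\<^sup>2 + (norm v)\<^sup>2" for u v :: 'b
  proof -
    have "\<bar>u \<bullet> v\<bar> \<le> norm u * norm v" by (rule Cauchy_Schwarz_ineq2)
    also have "\<dots> \<le> (norm u)\<^sup>2 + (norm v)\<^sup>2"
      using sum_squares_bound[of "norm u" "norm v"] zero_le_power2[of "norm u"] zero_le_power2[of "norm v"]
        mult_nonneg_nonneg[OF norm_ge_zero[of u] norm_ge_zero[of v]] by linarith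
    finally show ?thesis .
  qed
  then show "AE x in lebesgue_on S. norm (f x \<bullet> g x) \<le> norm ((norm (f x))\<^sup>2 + (norm (g x))\<^sup>2)"
    by auto
qed

lemma L2_space_add:
  assumes "f \<in> L2_space S" "g \<in> L2_space S"
  shows "(\<lambda>x. f x + g x) \<in> L2_space S"
proof (rule L2_space_dominated)
  show "integrable (lebesgue_on S) (\<lambda>x. 2 * (norm (f x))\<^sup>2 + 2 * (norm (g x))\<^sup>2)"
    using assms by (auto simp: L2_space_def)
  show "(\<lambda>x. f x + g x) \<in> borel_measurable (lebesgue_on S)"
    using assms by (auto simp: L2_space_def)
  have "(norm (u + v))\<^sup>2 \<le> 2 * (norm u)\<^sup>2 + 2 * (norm v)\<^sup>2" for u v :: 'b
    using inner_ge_zero[of "u - v"]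
    by (simp add: power2_norm_eq_inner inner_diff inner_add inner_commute)
  then show "AE x in lebesgue_on S. (norm (f x + g x))\<^sup>2 \<le> 2 * (norm (f x))\<^sup>2 + 2 * (norm (g x))\<^sup>2"
    by auto
qed

lemma L2_space_scaleR:
  assumes "f \<in> L2_space S"
  shows "(\<lambda>x. r *\<^sub>R f x) \<in> L2_space S"
  using assms by (auto simp: L2_space_def power_mult_distrib)

lemma L2_space_diff:
  assumes "f \<in> L2_space S" "g \<in> L2_space S"
  shows "(\<lambda>x. f x - g x) \<in> L2_space S"
  using L2_space_add[OF assms(1) L2_space_scaleR[OF assms(2), of "-1"]] by simp

text \<open>A change on a null set preserves measurability because Lebesgue measure is complete.
  Both functions are extended by zero to the whole space to use this, which is where measurability
  of \<open>S\<close> enters.\<close>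

lemma L2_space_cong_AE:
  assumes f: "f \<in> L2_space S" and S: "S \<in> sets lebesgue" and ae: "AE x in lebesgue_on S. f x = g x"
  shows "g \<in> L2_space S"
proof -
  have "g \<in> borel_measurable (lebesgue_on S)"
  proof -
    have ae': "AE x in lebesgue. (if x \<in> S then f x else 0) = (if x \<in> S then g x else 0)"
      using ae S by (simp add: AE_restrict_space_iff)
    show ?thesis
      by (rule borel_measurable_if_D, rule borel_measurable_AE[OF borel_measurable_if_I[OF L2_spaceD(1)[OF f] S] ae'])
  qed
  then show ?thesis
    by (rule L2_space_dominated[OF L2_spaceD(2)[OF f]]) (use ae in auto)
qed

lemma L2_norm_cong_AE:
  assumes f: "f \<in> L2_space S" and g: "g \<in> L2_space S" and ae: "AE x in lebesgue_on S. f x = g x"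
  shows "L2_norm S f = L2_norm S g"
  unfolding L2_norm_def
  by (intro arg_cong[where f=sqrt] integral_cong_AE) (use assms in \<open>auto simp: L2_space_def\<close>)

lemma L2_inner_cong_AE:
  assumes "f \<in> L2_space S" "g \<in> L2_space S" "AE x in lebesgue_on S. f x = g x"
    and "f' \<in> L2_space S" "g' \<in> L2_space S" "AE x in lebesgue_on S. f' x = g' x"
  shows "L2_inner S f f' = L2_inner S g g'"
  unfolding L2_inner_def
  by (intro integral_cong_AE) (use assms in \<open>auto simp: L2_space_def\<close>)

lemma L2_norm_nonneg [simp]: "L2_norm S f \<ge> 0"
  by (simp add: L2_norm_def)

lemma L2_norm_square: "(L2_norm S f)\<^sup>2 = L2_inner S f f"
  by (simp add: L2_norm_def L2_inner_def power2_norm_eq_inner)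

lemma L2_inner_commute: "L2_inner S f g = L2_inner S g f"
  by (simp add: L2_inner_def inner_commute)

lemma L2_inner_add_left:
  assumes "f \<in> L2_space S" "g \<in> L2_space S" "h \<in> L2_space S"
  shows "L2_inner S (\<lambda>x. f x + g x) h = L2_inner S f h + L2_inner S g h"
  unfolding L2_inner_def inner_add_left
  by (intro Bochner_Integration.integral_add L2_inner_integrable assms)

lemma L2_inner_diff_left:
  assumes "f \<in> L2_space S" "g \<in> L2_space S" "h \<in> L2_space S"
  shows "L2_inner S (\<lambda>x. f x - g x) h = L2_inner S f h - L2_inner S g h"
  unfolding L2_inner_def inner_diff_left
  by (intro Bochner_Integration.integral_diff L2_inner_integrable assms)

lemma L2_inner_scaleR_left: "L2_inner S (\<lambda>x. r *\<^sub>R f x) h = r * L2_inner S f h"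
  by (simp add: L2_inner_def)

lemma L2_inner_diff_right:
  assumes "f \<in> L2_space S" "g \<in> L2_space S" "h \<in> L2_space S"
  shows "L2_inner S h (\<lambda>x. f x - g x) = L2_inner S h f - L2_inner S h g"
  using L2_inner_diff_left[OF assms] by (simp add: L2_inner_commute)

lemma L2_inner_add_right:
  assumes "f \<in> L2_space S" "g \<in> L2_space S" "h \<in> L2_space S"
  shows "L2_inner S h (\<lambda>x. f x + g x) = L2_inner S h f + L2_inner S h g"
  using L2_inner_add_left[OF assms] by (simp add: L2_inner_commute)

lemma L2_norm_scaleR: "L2_norm S (\<lambda>x. r *\<^sub>R f x) = \<bar>r\<bar> * L2_norm S f"
  by (simp add: L2_norm_def power_mult_distrib real_sqrt_mult)

lemma L2_norm_minus_commute: "L2_norm S (\<lambda>x. f x - g x) = L2_norm S (\<lambda>x. g x - f x)"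
  by (simp add: L2_norm_def norm_minus_commute)

lemma L2_norm_eq_0_AE:
  assumes "f \<in> L2_space S" "L2_norm S f = 0"
  shows "AE x in lebesgue_on S. f x = 0"
proof -
  have "(\<integral>x. (norm (f x))\<^sup>2 \<partial>lebesgue_on S) = 0"
    using assms(2) by (simp add: L2_norm_def)
  then have "AE x in lebesgue_on S. (norm (f x))\<^sup>2 = 0"
    using integral_nonneg_eq_0_iff_AE[OF L2_spaceD(2)[OF assms(1)]] by auto
  then show ?thesis by auto
qed

text \<open>The square of the norm of
  \<open>\<parallel>v\<parallel> u - \<parallel>u\<parallel> v\<close> equals \<open>2
  \<parallel>u\<parallel> \<parallel>v\<parallel> (\<parallel>u\<parallel> \<parallel>v\<parallel> -
  (u, v))\<close>, which gives the claim unless a norm is zero; then the integrand of the inner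
  product vanishes almost everywhere.\<close>

lemma L2_Cauchy_Schwarz:
  assumes f: "f \<in> L2_space S" and g: "g \<in> L2_space S"
  shows "\<bar>L2_inner S f g\<bar> \<le> L2_norm S f * L2_norm S g"
proof -
  have zero: "L2_inner S u v = 0" if "u \<in> L2_space S" "L2_norm S u = 0" for u v :: "real^'a \<Rightarrow> 'b"
  proof -
    have "L2_inner S u v = (\<integral>x. 0 \<partial>lebesgue_on S)"
      unfolding L2_inner_def
      by (rule integral_eq_zero_AE[THEN trans]) (use L2_norm_eq_0_AE[OF that] in auto)
    then show ?thesis by simp
  qed
  have key: "L2_inner S u v \<le> L2_norm S u * L2_norm S v"
    if u: "u \<in> L2_space S" and v: "v \<in> L2_space S" for u v :: "real^'a \<Rightarrow> 'b"
  proof (cases "L2_norm S u = 0 \<or> L2_norm S v = 0")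
    case True
    then show ?thesis using zero[OF u, of v] zero[OF v, of u] by (auto simp: L2_inner_commute[of S v u])
  next
    case False
    let ?a = "L2_norm S u" and ?b = "L2_norm S v"
    have pos: "?a * ?b > 0" using False by (simp add: less_le)
    have "0 \<le> (L2_norm S (\<lambda>x. ?b *\<^sub>R u x - ?a *\<^sub>R v x))\<^sup>2" by simp
    also have "\<dots> = ?b * ?b * L2_inner S u u - 2 * (?a * ?b) * L2_inner S u v + ?a * ?a * L2_inner S v v"
      using u v L2_space_diff[OF L2_space_scaleR[OF u] L2_space_scaleR[OF v]]
      by (simp add: L2_norm_square L2_inner_diff_left L2_inner_diff_right L2_space_scaleR
          L2_inner_scaleR_left L2_inner_commute[of S _ "\<lambda>x. _ *\<^sub>R _ x"] L2_inner_commute[of S v u] algebra_simps)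
    also have "\<dots> = 2 * (?a * ?b) * (?a * ?b - L2_inner S u v)"
      by (simp add: L2_norm_square[symmetric] power2_eq_square algebra_simps)
    finally show ?thesis using pos by (simp add: zero_le_mult_iff)
  qed
  \<comment> \<open>The one-sided bound for \<open>f\<close> and for \<open>- f\<close> gives the
    absolute value.\<close>
  show ?thesis
    using key[OF f g] key[OF L2_space_scaleR[OF f, of "-1"] g]
    by (simp only: L2_inner_scaleR_left L2_norm_scaleR)
qed

lemma L2_norm_triangle:
  assumes f: "f \<in> L2_space S" and g: "g \<in> L2_space S"
  shows "L2_norm S (\<lambda>x. f x + g x) \<le> L2_norm S f + L2_norm S g"
proof (rule power2_le_imp_le)
  have "(L2_norm S (\<lambda>x. f x + g x))\<^sup>2 = (L2_norm S f)\<^sup>2 + 2 * L2_inner S f g + (L2_norm S g)\<^sup>2"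
    using assms L2_space_add[OF assms]
    by (simp add: L2_norm_square L2_inner_add_left L2_inner_add_right L2_inner_commute[of S g f])
  also have "\<dots> \<le> (L2_norm S f + L2_norm S g)\<^sup>2"
    using L2_Cauchy_Schwarz[OF assms] by (simp add: power2_sum abs_le_iff)
  finally show "(L2_norm S (\<lambda>x. f x + g x))\<^sup>2 \<le> (L2_norm S f + L2_norm S g)\<^sup>2" .
qed auto

lemma L2_norm_triangle_diff:
  assumes "f \<in> L2_space S" "g \<in> L2_space S" "h \<in> L2_space S"
  shows "L2_norm S (\<lambda>x. f x - h x) \<le> L2_norm S (\<lambda>x. f x - g x) + L2_norm S (\<lambda>x. g x - h x)"
  using L2_norm_triangle[OF L2_space_diff[OF assms(1,2)] L2_space_diff[OF assms(2,3)]] by simp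

lemma L2_space_zero: "(\<lambda>x. 0) \<in> L2_space S"
  by (simp add: L2_space_def)

lemma L2_norm_zero: "L2_norm S (\<lambda>x. 0) = 0"
  by (simp add: L2_norm_def)

lemma L2_norm_tendsto:
  assumes F: "\<And>n. F n \<in> L2_space S" and f: "f \<in> L2_space S"
    and lim: "(\<lambda>n::nat. L2_norm S (\<lambda>x. F n x - f x)) \<longlonglongrightarrow> 0"
  shows "(\<lambda>n. L2_norm S (F n)) \<longlonglongrightarrow> L2_norm S f"
proof (rule Lim_null[THEN iffD2], rule tendsto_rabs_zero_cancel, rule tendsto_sandwich[OF _ _ tendsto_const lim])
  have "\<bar>L2_norm S (F n) - L2_norm S f\<bar> \<le> L2_norm S (\<lambda>x. F n x - f x)" for n
    using L2_norm_triangle_diff[OF F[of n] f L2_space_zero] L2_norm_triangle_diff[OF f F[of n] L2_space_zero]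
      L2_norm_minus_commute[of S "F n" f] by (simp add: abs_le_iff)
  then show "\<forall>\<^sub>F n in sequentially. \<bar>L2_norm S (F n) - L2_norm S f\<bar> \<le> L2_norm S (\<lambda>x. F n x - f x)"
    by auto
qed auto

lemma L2_inner_tendsto:
  assumes F: "\<And>n. F n \<in> L2_space S" and f: "f \<in> L2_space S"
    and G: "\<And>n. G n \<in> L2_space S" and g: "g \<in> L2_space S"
    and limF: "(\<lambda>n::nat. L2_norm S (\<lambda>x. F n x - f x)) \<longlonglongrightarrow> 0"
    and limG: "(\<lambda>n::nat. L2_norm S (\<lambda>x. G n x - g x)) \<longlonglongrightarrow> 0"
  shows "(\<lambda>n. L2_inner S (F n) (G n)) \<longlonglongrightarrow> L2_inner S f g"
proof (rule Lim_null[THEN iffD2], rule tendsto_rabs_zero_cancel,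
    rule tendsto_sandwich[OF _ _ tendsto_const])
  let ?b = "\<lambda>n. L2_norm S (\<lambda>x. F n x - f x) * L2_norm S (G n) + L2_norm S f * L2_norm S (\<lambda>x. G n x - g x)"
  have "?b \<longlonglongrightarrow> 0 * L2_norm S g + L2_norm S f * 0"
    by (intro tendsto_intros limF limG L2_norm_tendsto G g)
  then show "?b \<longlonglongrightarrow> 0" by simp
  have "\<bar>L2_inner S (F n) (G n) - L2_inner S f g\<bar> \<le> ?b n" for n
  proof -
    have "L2_inner S (F n) (G n) - L2_inner S f g
       = L2_inner S (\<lambda>x. F n x - f x) (G n) + L2_inner S f (\<lambda>x. G n x - g x)"
      by (simp add: L2_inner_diff_left L2_inner_diff_right F G f g)
    then show ?thesis
      using L2_Cauchy_Schwarz[OF L2_space_diff[OF F[of n] f] G[of n]]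
        L2_Cauchy_Schwarz[OF f L2_space_diff[OF G[of n] g]] by linarith
  qed
  then show "\<forall>\<^sub>F n in sequentially. \<bar>L2_inner S (F n) (G n) - L2_inner S f g\<bar> \<le> ?b n" by auto
qed auto

text \<open>Serves two multipliers: a coordinate function in the Poincare inequality, and the
  components of the convection field.\<close>

lemma L2_mult_bounded:
  fixes c f :: "real^'n \<Rightarrow> real"
  assumes c: "c \<in> borel_measurable (lebesgue_on S)" and M: "AE x in lebesgue_on S. \<bar>c x\<bar> \<le> M" "M \<ge> 0"
    and f: "f \<in> L2_space S"
  shows "(\<lambda>x. c x * f x) \<in> L2_space S" "L2_norm S (\<lambda>x. c x * f x) \<le> M * L2_norm S f"
proof -
  have le: "AE x in lebesgue_on S. (norm (c x * f x))\<^sup>2 \<le> M\<^sup>2 * (norm (f x))\<^sup>2"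
    using M(1) by eventually_elim (auto simp: power_mult_distrib intro!: mult_right_mono power2_le_iff_abs_le[THEN iffD2] M)
  have int: "integrable (lebesgue_on S) (\<lambda>x. M\<^sup>2 * (norm (f x))\<^sup>2)"
    using L2_spaceD[OF f] by auto
  show cf: "(\<lambda>x. c x * f x) \<in> L2_space S"
    by (rule L2_space_dominated[OF int _ le]) (use c L2_spaceD[OF f] in auto)
  have "(\<integral>x. (norm (c x * f x))\<^sup>2 \<partial>lebesgue_on S) \<le> (\<integral>x. M\<^sup>2 * (norm (f x))\<^sup>2 \<partial>lebesgue_on S)"
    by (rule integral_mono_AE[OF L2_spaceD(2)[OF cf] int le])
  then have "L2_norm S (\<lambda>x. c x * f x) \<le> sqrt (M\<^sup>2 * (\<integral>x. (norm (f x))\<^sup>2 \<partial>lebesgue_on S))"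
    unfolding L2_norm_def by (simp only: real_sqrt_le_mono integral_mult_right_zero)
  then show "L2_norm S (\<lambda>x. c x * f x) \<le> M * L2_norm S f"
    using M by (simp add: L2_norm_def real_sqrt_mult)
qed

section \<open>Test functions\<close>

lemma partial_eqI: "(f has_derivative f') (at x) \<Longrightarrow> partial i f x = f' (axis i 1)"
  by (simp add: partial_def frechet_derivative_at[symmetric])

lemma partial_add:
  assumes "f differentiable (at x)" "g differentiable (at x)"
  shows "partial i (\<lambda>x. f x + g x) x = partial i f x + partial i g x"
  using partial_eqI[OF has_derivative_add[OF frechet_derivative_works[THEN iffD1, OF assms(1)] frechet_derivative_works[THEN iffD1, OF assms(2)]], of i]
  by (simp add: partial_def)

lemma partial_mult:
  assumes "f differentiable (at x)" "g differentiable (at x)"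
  shows "partial i (\<lambda>x. f x * g x) x = f x * partial i g x + partial i f x * g x"
  using partial_eqI[OF has_derivative_mult[OF frechet_derivative_works[THEN iffD1, OF assms(1)] frechet_derivative_works[THEN iffD1, OF assms(2)]], of i]
  by (simp add: partial_def)

lemma C_k_SucD: "C_k (Suc k) f \<Longrightarrow> C_k k f"
proof (induction k arbitrary: f)
  case 0
  then show ?case by (simp add: differentiable_imp_continuous_on)
qed simp

lemma C_k_const: "C_k k (\<lambda>x. r)"
proof (induction k arbitrary: r)
  case (Suc k)
  have "partial i (\<lambda>x. r) = (\<lambda>x. 0)" for i :: 'a
    by (rule ext) (rule partial_eqI[OF has_derivative_const])
  then show ?case using Suc by simp
qed simp

lemma C_k_Suc_differentiable: "C_k (Suc k) f \<Longrightarrow> f differentiable (at x)"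
  by (simp add: differentiable_on_def)

lemma C_k_add: "C_k k f \<Longrightarrow> C_k k g \<Longrightarrow> C_k k (\<lambda>x. f x + g x)"
proof (induction k arbitrary: f g)
  case (Suc k)
  have "partial i (\<lambda>x. f x + g x) = (\<lambda>x. partial i f x + partial i g x)" for i
    by (rule ext, rule partial_add) (use Suc.prems C_k_Suc_differentiable in blast)+
  with Suc show ?case by (auto intro: differentiable_on_add)
qed (auto intro: continuous_on_add)

lemma C_k_mult: "C_k k f \<Longrightarrow> C_k k g \<Longrightarrow> C_k k (\<lambda>x. f x * g x)"
proof (induction k arbitrary: f g)
  case (Suc k)
  have "partial i (\<lambda>x. f x * g x) = (\<lambda>x. f x * partial i g x + partial i f x * g x)" for i
    by (rule ext, rule partial_mult) (use Suc.prems C_k_Suc_differentiable in blast)+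
  moreover have "C_k k f" "C_k k g" using Suc.prems C_k_SucD by blast+
  ultimately show ?case using Suc by (auto intro!: differentiable_on_mult C_k_add)
qed (auto intro: continuous_on_mult)

lemma C_k_prod: "finite I \<Longrightarrow> (\<And>i. i \<in> I \<Longrightarrow> C_k k (f i)) \<Longrightarrow> C_k k (\<lambda>x. \<Prod>i\<in>I. f i x)"
  by (induction I rule: finite_induct) (auto intro: C_k_const C_k_mult)

text \<open>A smooth function of one variable is given together with the sequence \<open>D\<close> of all its derivatives.\<close>

lemma C_k_affine_coordinate:
  fixes D :: "nat \<Rightarrow> real \<Rightarrow> real"
  assumes D: "\<And>k t. (D k has_field_derivative D (Suc k) t) (at t)"
  shows "C_k m (\<lambda>x::real^'n. D k (r * x $ i + s))"
proof (induction m arbitrary: k)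
  case 0
  have "continuous_on UNIV (D k)"
    using D DERIV_isCont continuous_at_imp_continuous_on by blast
  then show ?case
    by (auto intro!: continuous_intros continuous_on_compose2[of UNIV "D k"])
next
  case (Suc m)
  have d: "((\<lambda>x::real^'n. D k (r * x $ i + s)) has_derivative (\<lambda>h. D (Suc k) (r * x $ i + s) * (r * h $ i))) (at x)" for x
    by (rule has_derivative_compose[OF _ D[unfolded has_field_derivative_def]])
      (auto intro!: derivative_eq_intros bounded_linear_imp_has_derivative bounded_linear_vec_nth)
  have "partial j (\<lambda>x::real^'n. D k (r * x $ i + s)) = (\<lambda>x. (r * (axis j 1 $ i)) * D (Suc k) (r * x $ i + s))" for j
    by (rule ext, subst partial_eqI[OF d]) (simp add: mult.commute)
  moreover have "(\<lambda>x::real^'n. D k (r * x $ i + s)) differentiable_on UNIV"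
    using d by (auto simp: differentiable_on_def differentiable_def)
  ultimately show ?case by (simp add: C_k_mult[OF C_k_const Suc])
qed

text \<open>The identity of one variable, with the derivatives 1, 0, 0, ..., is an instance of the
  preceding scheme. Coordinates are the multipliers in the proof of the Poincare inequality.\<close>

lemma C_k_coordinate: "C_k k (\<lambda>x::real^'n. x $ i)"
proof -
  define D :: "nat \<Rightarrow> real \<Rightarrow> real" where "D k t = (if k = 0 then t else if k = 1 then 1 else 0)" for k t
  have "(D k has_field_derivative D (Suc k) t) (at t)" for k t
    unfolding D_def by (cases k) (auto intro!: derivative_eq_intros)
  from C_k_affine_coordinate[of D k 0 1 i 0, OF this] show ?thesis by (simp add: D_def)
qed

text \<open>The derivatives of \<open>exp (-1/t)\<close> have the form \<open>P (1/t) exp (-1/t)\<close> with polynomials \<open>P\<close>.\<close>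

definition flat_exp :: "real poly \<Rightarrow> real \<Rightarrow> real" where
  "flat_exp P t = (if t \<le> 0 then 0 else poly P (1 / t) * exp (- (1 / t)))"

lemma poly_exp_minus_tendsto_0: "((\<lambda>s::real. poly P s * exp (- s)) \<longlongrightarrow> 0) at_top"
proof -
  have "((\<lambda>s. \<Sum>i\<le>degree P. coeff P i * (s ^ i / exp s)) \<longlongrightarrow> (\<Sum>i\<le>degree P. coeff P i * 0)) at_top"
    by (intro tendsto_intros tendsto_power_div_exp_0)
  then show ?thesis
    by (simp add: poly_altdef exp_minus sum_distrib_right divide_inverse mult.assoc)
qed

text \<open>With \<open>s = 1 / t\<close>, the chain rule turns \<open>P(s) exp (- s)\<close> into
  \<open>s\<^sup>2 (P - P')(s) exp (- s)\<close>, and \<open>[:0, 0, 1:]\<close> is the polynomial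
  \<open>s\<^sup>2\<close>. At the origin both one-sided difference quotients tend to 0.\<close>

lemma flat_exp_has_derivative:
  "(flat_exp P has_field_derivative flat_exp ([:0, 0, 1:] * (P - pderiv P)) t) (at t)"
proof -
  consider "t < 0" | "t > 0" | "t = 0" by linarith
  then show ?thesis
  proof cases
    case 1
    have "((\<lambda>t. 0) has_field_derivative 0) (at t)" by simp
    then have "(flat_exp P has_field_derivative 0) (at t)"
      by (rule has_field_derivative_transform_within_open[where S="{..<0}"]) (use 1 in \<open>auto simp: flat_exp_def\<close>)
    with 1 show ?thesis by (simp add: flat_exp_def)
  next
    case 2
    have "((\<lambda>t. poly P (1 / t) * exp (- (1 / t))) has_field_derivative
        flat_exp ([:0, 0, 1:] * (P - pderiv P)) t) (at t)"
    proof -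
      have inv: "((\<lambda>t. 1 / t) has_field_derivative - (1 / t * (1 / t))) (at t)"
        using 2 by (auto intro!: derivative_eq_intros)
      show ?thesis
        using DERIV_mult[OF DERIV_chain2[OF poly_DERIV inv, of P] DERIV_chain2[OF DERIV_exp DERIV_minus[OF inv]]] 2
        by (simp add: flat_exp_def algebra_simps)
    qed
    then show ?thesis
      by (rule has_field_derivative_transform_within_open[where S="{0<..}"]) (use 2 in \<open>auto simp: flat_exp_def\<close>)
  next
    case 3
    have "((\<lambda>h. (flat_exp P h - flat_exp P 0) / h) \<longlongrightarrow> 0) (at 0)"
    proof (rule filterlim_split_at)
      have "((\<lambda>h::real. 0::real) \<longlongrightarrow> 0) (at_left 0)" by simp
      then show "((\<lambda>h. (flat_exp P h - flat_exp P 0) / h) \<longlongrightarrow> 0) (at_left 0)"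
        by (rule Lim_transform_eventually) (auto simp: eventually_at_filter flat_exp_def)
      \<comment> \<open>For \<open>h > 0\<close> and \<open>s = 1 / h\<close> the difference
        quotient is \<open>s P(s) exp (- s)\<close>, and \<open>pCons 0 P\<close> is the polynomial
        \<open>s P(s)\<close>; the exponential decay wins.\<close>
      have "((\<lambda>h. poly (pCons 0 P) (inverse h) * exp (- inverse h)) \<longlongrightarrow> 0) (at_right 0)"
        by (rule filterlim_compose[OF poly_exp_minus_tendsto_0 filterlim_inverse_at_top_right])
      then show "((\<lambda>h. (flat_exp P h - flat_exp P 0) / h) \<longlongrightarrow> 0) (at_right 0)"
        by (rule Lim_transform_eventually)
          (auto simp: eventually_at_filter flat_exp_def field_simps)
    qed
    with 3 show ?thesis by (simp add: has_field_derivative_iff flat_exp_def)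
  qed
qed

lemma C_k_flat_exp: "C_k m (\<lambda>x::real^'n. flat_exp P (r * x $ i + s))"
proof -
  \<comment> \<open>\<open>Q k\<close> is the polynomial that belongs to the derivative of order
    \<open>k\<close>, so \<open>flat_exp (Q k)\<close> runs through all derivatives of
    \<open>flat_exp P\<close>.\<close>
  define Q where "Q k = ((\<lambda>P. [:0, 0, 1:] * (P - pderiv P)) ^^ k) P" for k
  have "(flat_exp (Q k) has_field_derivative flat_exp (Q (Suc k)) t) (at t)" for k t
    unfolding Q_def using flat_exp_has_derivative by simp
  from C_k_affine_coordinate[of "\<lambda>k. flat_exp (Q k)" m 0 r i s, OF this] show ?thesis by (simp add: Q_def)
qed

text \<open>Since \<open>exp (- 1 / (r t))\<close> tends to 1 as \<open>r\<close> grows for every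
  fixed \<open>t > 0\<close>, these smooth functions approximate the indicator of the open box
  pointwise, with values in [0, 1] and a support that stays in the same closed box for all
  \<open>r > 0\<close>. They are all the test functions that the fundamental lemma uses.\<close>

definition box_bump :: "real \<Rightarrow> real^'n \<Rightarrow> real^'n \<Rightarrow> real^'n \<Rightarrow> real" where
  "box_bump r l u x = (\<Prod>i\<in>UNIV. flat_exp 1 (r * (x $ i - l $ i)) * flat_exp 1 (r * (u $ i - x $ i)))"

lemma C_k_box_bump: "C_k m (box_bump r l u)"
proof -
  have "C_k m (\<lambda>x. \<Prod>i\<in>UNIV. flat_exp 1 (r * x $ i + (- r * l $ i)) * flat_exp 1 ((- r) * x $ i + r * u $ i))"
    by (intro C_k_prod C_k_mult C_k_flat_exp) auto
  moreover have "box_bump r l u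
      = (\<lambda>x. \<Prod>i\<in>UNIV. flat_exp 1 (r * x $ i + (- r * l $ i)) * flat_exp 1 ((- r) * x $ i + r * u $ i))"
    by (simp add: fun_eq_iff box_bump_def right_diff_distrib)
  ultimately show ?thesis by simp
qed

lemma flat_exp_1_bounds: "0 \<le> flat_exp 1 t" "flat_exp 1 t \<le> 1" "flat_exp 1 t \<noteq> 0 \<longleftrightarrow> t > 0"
  by (auto simp: flat_exp_def)

lemma box_bump_bounds: "0 \<le> box_bump r l u x" "box_bump r l u x \<le> 1"
  unfolding box_bump_def
  by (intro prod_nonneg prod_le_1 ballI conjI mult_nonneg_nonneg mult_le_one flat_exp_1_bounds(1,2))+

lemma box_bump_nonzero: "r > 0 \<Longrightarrow> box_bump r l u x \<noteq> 0 \<longleftrightarrow> x \<in> box l u"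
  by (auto simp: box_bump_def mem_box_cart zero_less_mult_iff flat_exp_1_bounds(3))

lemma box_bump_tendsto: "(\<lambda>n. box_bump (real (Suc n)) l u x) \<longlonglongrightarrow> indicator (box l u) x"
proof (cases "x \<in> box l u")
  case True
  have lim: "(\<lambda>n. flat_exp 1 (real (Suc n) * t)) \<longlonglongrightarrow> 1" if "t > 0" for t
  proof -
    have "(\<lambda>n. inverse (real (Suc n)) * inverse t) \<longlonglongrightarrow> 0 * inverse t"
      by (rule tendsto_mult[OF LIMSEQ_inverse_real_of_nat tendsto_const])
    then have "(\<lambda>n. exp (- (inverse (real (Suc n)) * inverse t))) \<longlonglongrightarrow> exp (- (0 * inverse t))"
      by (rule tendsto_exp[OF tendsto_minus])
    moreover have "flat_exp 1 (real (Suc n) * t) = exp (- (inverse (real (Suc n)) * inverse t))" for n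
      using that by (simp add: flat_exp_def mult_le_0_iff divide_inverse del: of_nat_Suc)
    ultimately show ?thesis by simp
  qed
  have "(\<lambda>n. box_bump (real (Suc n)) l u x) \<longlonglongrightarrow> (\<Prod>i\<in>(UNIV::'a set). 1 * 1)"
    unfolding box_bump_def by (intro tendsto_prod tendsto_mult lim) (use True in \<open>auto simp: mem_box_cart\<close>)
  with True show ?thesis by simp
next
  case False
  then have "box_bump (real (Suc n)) l u x = 0" for n
    using box_bump_nonzero[of "real (Suc n)" l u x] by auto
  with False show ?thesis by simp
qed

section \<open>Closure properties and integrals of test functions\<close>

lemma test_functionsI:
  assumes "\<And>k. C_k k \<phi>" "compact D" "D \<subseteq> \<Omega>" "\<And>x. x \<notin> D \<Longrightarrow> \<phi> x = 0"
  shows "\<phi> \<in> test_functions \<Omega>"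
proof -
  have "closure {x. \<phi> x \<noteq> 0} \<subseteq> D"
    using assms by (intro closure_minimal compact_imp_closed) auto
  moreover from this have "compact (closure {x. \<phi> x \<noteq> 0})"
    using assms(2) by (meson closed_closure compact_closure compact_imp_bounded bounded_subset closure_subset subset_trans)
  ultimately show ?thesis using assms by (auto simp: test_functions_def)
qed

lemma test_functionsE:
  assumes "\<phi> \<in> test_functions \<Omega>"
  obtains D where "compact D" "D \<subseteq> \<Omega>" "\<And>x. x \<notin> D \<Longrightarrow> \<phi> x = 0"
proof
  show "compact (closure {x. \<phi> x \<noteq> 0})" "closure {x. \<phi> x \<noteq> 0} \<subseteq> \<Omega>"
    using assms by (auto simp: test_functions_def)
  show "\<phi> x = 0" if "x \<notin> closure {x. \<phi> x \<noteq> 0}" for x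
    using that closure_subset[of "{x. \<phi> x \<noteq> 0}"] by auto
qed

lemma test_functions_C_k: "\<phi> \<in> test_functions \<Omega> \<Longrightarrow> C_k k \<phi>"
  by (simp add: test_functions_def)

lemma test_functions_continuous: "\<phi> \<in> test_functions \<Omega> \<Longrightarrow> continuous_on UNIV \<phi>"
  using test_functions_C_k[of \<phi> \<Omega> 0] by simp

lemma test_functions_differentiable: "\<phi> \<in> test_functions \<Omega> \<Longrightarrow> \<phi> differentiable (at x)"
  using C_k_Suc_differentiable test_functions_C_k by blast

lemma test_functions_mult:
  assumes "\<phi> \<in> test_functions \<Omega>" "\<And>k. C_k k g"
  shows "(\<lambda>x. g x * \<phi> x) \<in> test_functions \<Omega>"
proof -
  obtain D where "compact D" "D \<subseteq> \<Omega>" "\<And>x. x \<notin> D \<Longrightarrow> \<phi> x = 0" by (rule test_functionsE[OF assms(1)]) blast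
  then show ?thesis
    by (intro test_functionsI[where D=D] C_k_mult assms test_functions_C_k[OF assms(1)]) auto
qed

lemma test_functions_add:
  assumes "\<phi> \<in> test_functions \<Omega>" "\<psi> \<in> test_functions \<Omega>"
  shows "(\<lambda>x. \<phi> x + \<psi> x) \<in> test_functions \<Omega>"
proof -
  obtain D where "compact D" "D \<subseteq> \<Omega>" "\<And>x. x \<notin> D \<Longrightarrow> \<phi> x = 0" by (rule test_functionsE[OF assms(1)]) blast
  moreover obtain E where "compact E" "E \<subseteq> \<Omega>" "\<And>x. x \<notin> E \<Longrightarrow> \<psi> x = 0" by (rule test_functionsE[OF assms(2)]) blast
  ultimately show ?thesis
    by (intro test_functionsI[where D="D \<union> E"] C_k_add test_functions_C_k[OF assms(1)] test_functions_C_k[OF assms(2)]) auto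
qed

lemma test_functions_diff:
  assumes "\<phi> \<in> test_functions \<Omega>" "\<psi> \<in> test_functions \<Omega>"
  shows "(\<lambda>x. \<phi> x - \<psi> x) \<in> test_functions \<Omega>"
  using test_functions_add[OF assms(1) test_functions_mult[OF assms(2) C_k_const[of _ "-1"]]] by simp

lemma test_functions_partial:
  assumes "\<phi> \<in> test_functions \<Omega>"
  shows "partial i \<phi> \<in> test_functions \<Omega>"
proof -
  obtain D where D: "compact D" "D \<subseteq> \<Omega>" "\<And>x. x \<notin> D \<Longrightarrow> \<phi> x = 0" by (rule test_functionsE[OF assms]) blast
  have "partial i \<phi> x = 0" if "x \<notin> D" for x
  proof -
    \<comment> \<open>The complement of the compact set \<open>D\<close> is open and the function
      vanishes on it, hence so does its derivative.\<close>
    have "(\<phi> has_derivative (\<lambda>h. 0)) (at x)"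
      by (rule has_derivative_transform_within_open[of "\<lambda>x. 0" _ _ _ "- D"])
        (use that D compact_imp_closed in auto)
    then show ?thesis by (rule partial_eqI)
  qed
  then show ?thesis
    by (intro test_functionsI[OF _ D(1,2)]) (use test_functions_C_k[OF assms, of "Suc _"] in auto)
qed

lemma box_bump_test_function:
  assumes "r > 0" "cbox l u \<subseteq> \<Omega>"
  shows "box_bump r l u \<in> test_functions \<Omega>"
  by (rule test_functionsI[OF C_k_box_bump compact_cbox assms(2)])
    (use box_bump_nonzero[OF assms(1), of l u] box_subset_cbox[of l u] in auto)

lemma test_functions_bounded:
  assumes "\<phi> \<in> test_functions \<Omega>"
  obtains B where "B > 0" "\<And>x. \<bar>\<phi> x\<bar> \<le> B"
proof -
  obtain D where D: "compact D" "D \<subseteq> \<Omega>" "\<And>x. x \<notin> D \<Longrightarrow> \<phi> x = 0" by (rule test_functionsE[OF assms]) blast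
  have "bounded (\<phi> ` D)"
    by (intro compact_imp_bounded compact_continuous_image D continuous_on_subset[OF test_functions_continuous[OF assms]]) auto
  then obtain B where B: "B > 0" "\<And>x. x \<in> D \<Longrightarrow> \<bar>\<phi> x\<bar> \<le> B"
    unfolding bounded_pos by auto
  show ?thesis
    by (rule that[OF B(1)]) (metis B D(3) abs_zero less_imp_le)
qed

lemma test_functions_measurable: "\<phi> \<in> test_functions \<Omega> \<Longrightarrow> \<phi> \<in> borel_measurable borel"
  by (rule borel_measurable_continuous_onI[OF test_functions_continuous])

lemma test_functions_integrable_lborel:
  assumes "\<phi> \<in> test_functions \<Omega>"
  shows "integrable lborel \<phi>"
proof -
  obtain D where D: "compact D" "D \<subseteq> \<Omega>" "\<And>x. x \<notin> D \<Longrightarrow> \<phi> x = 0" by (rule test_functionsE[OF assms]) blast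
  have "integrable lborel (\<lambda>x. indicator D x *\<^sub>R \<phi> x)"
    by (rule borel_integrable_compact[OF D(1)]) (use test_functions_continuous[OF assms] continuous_on_subset in blast)
  moreover have "(\<lambda>x. indicator D x *\<^sub>R \<phi> x) = \<phi>"
    using D(3) by (fastforce simp: indicator_def)
  ultimately show ?thesis by simp
qed

lemma test_functions_restrict:
  assumes "\<phi> \<in> test_functions \<Omega>" "x \<notin> \<Omega>"
  shows "\<phi> x = 0"
  by (rule test_functionsE[OF assms(1)]) (use assms(2) in auto)

text \<open>Test functions vanish outside \<Omega> and are Borel measurable. Their integrals can
  therefore be moved to \<open>lborel\<close> on the whole space, where translation invariance is
  available.\<close>

lemma
  assumes \<phi>: "\<phi> \<in> test_functions \<Omega>" and \<Omega>: "\<Omega> \<in> sets lebesgue"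
  shows test_functions_integrable: "integrable (lebesgue_on \<Omega>) \<phi>"
    and test_functions_integral: "(\<integral>x. \<phi> x \<partial>lebesgue_on \<Omega>) = (\<integral>x. \<phi> x \<partial>lborel)"
proof -
  have eq: "(\<lambda>x. if x \<in> \<Omega> then \<phi> x else 0) = \<phi>"
    using test_functions_restrict[OF \<phi>] by auto
  have "\<phi> \<in> borel_measurable lborel" using test_functions_measurable[OF \<phi>] by simp
  then show "integrable (lebesgue_on \<Omega>) \<phi>" "(\<integral>x. \<phi> x \<partial>lebesgue_on \<Omega>) = (\<integral>x. \<phi> x \<partial>lborel)"
    using Lebesgue_Measure.integrable_restrict_UNIV[OF \<Omega>, of \<phi>] Lebesgue_Measure.integral_restrict_UNIV[OF \<Omega>, of \<phi>]
      test_functions_integrable_lborel[OF \<phi>]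
    by (simp_all add: eq integrable_completion integral_completion)
qed

lemma test_functions_L2:
  assumes \<phi>: "\<phi> \<in> test_functions \<Omega>" and \<Omega>: "\<Omega> \<in> sets lebesgue"
  shows "\<phi> \<in> L2_space \<Omega>"
proof (rule L2_space_dominated)
  show "integrable (lebesgue_on \<Omega>) (\<lambda>x. \<phi> x * \<phi> x)"
    by (intro test_functions_integrable[OF _ \<Omega>] test_functions_mult \<phi> test_functions_C_k[OF \<phi>])
  show "\<phi> \<in> borel_measurable (lebesgue_on \<Omega>)"
    using test_functions_integrable[OF assms] by auto
qed (auto simp: power2_eq_square)

lemma partial_has_field_derivative:
  assumes "f differentiable (at (x + t *\<^sub>R axis i 1))"
  shows "((\<lambda>t. f (x + t *\<^sub>R axis i 1)) has_field_derivative partial i f (x + t *\<^sub>R axis i 1)) (at t)"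
proof -
  let ?f' = "frechet_derivative f (at (x + t *\<^sub>R axis i 1))"
  have f': "(f has_derivative ?f') (at (x + t *\<^sub>R axis i 1))"
    using assms by (simp add: frechet_derivative_works)
  have "((\<lambda>t. f (x + t *\<^sub>R axis i 1)) has_derivative (\<lambda>h. ?f' (h *\<^sub>R axis i 1))) (at t)"
    by (rule has_derivative_compose[where f="\<lambda>t. x + t *\<^sub>R axis i 1", OF _ f']) (auto intro!: derivative_eq_intros)
  moreover have "?f' (h *\<^sub>R axis i 1) = partial i f (x + t *\<^sub>R axis i 1) * h" for h
    using linear_cmul[OF has_derivative_linear[OF f'], of h "axis i 1"] by (simp add: partial_def mult.commute)
  ultimately show ?thesis by (simp add: has_field_derivative_def)
qed

text \<open>The difference quotients have integral zero because Lebesgue measure is translation invariant.\<close>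

lemma integral_partial_lborel:
  fixes \<phi> :: "real^'n \<Rightarrow> real"
  assumes \<phi>: "\<phi> \<in> test_functions \<Omega>"
  shows "(\<integral>x. partial i \<phi> x \<partial>lborel) = 0"
proof -
  let ?e = "axis i 1 :: real^'n"
  let ?q = "\<lambda>n x. (\<phi> (x + inverse (real (Suc n)) *\<^sub>R ?e) - \<phi> x) * real (Suc n)"
  have int0: "(\<integral>x. ?q n x \<partial>lborel) = 0" for n
  proof -
    let ?h = "inverse (real (Suc n)) *\<^sub>R ?e"
    have "integrable (distr lborel borel ((+) ?h)) \<phi>"
      using test_functions_integrable_lborel[OF \<phi>] by (simp add: lborel_distr_plus)
    then have "integrable lborel (\<lambda>x. \<phi> (?h + x))"
      by (subst (asm) integrable_distr_eq) (auto simp: test_functions_measurable[OF \<phi>])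
    moreover have "(\<integral>x. \<phi> x \<partial>lborel) = (\<integral>x. \<phi> (?h + x) \<partial>lborel)"
      by (subst lborel_distr_plus[symmetric, of ?h], subst integral_distr)
        (auto simp: test_functions_measurable[OF \<phi>])
    ultimately show ?thesis
      using test_functions_integrable_lborel[OF \<phi>] by (simp add: add.commute)
  qed
  obtain B where B: "B > 0" "\<And>x. \<bar>partial i \<phi> x\<bar> \<le> B"
    by (rule test_functions_bounded[OF test_functions_partial[OF \<phi>, of i]]) blast
  obtain D where D: "compact D" "D \<subseteq> \<Omega>" "\<And>x. x \<notin> D \<Longrightarrow> \<phi> x = 0" by (rule test_functionsE[OF \<phi>]) blast
  obtain R where R: "\<And>x. x \<in> D \<Longrightarrow> norm x \<le> R" using compact_imp_bounded[OF D(1)] by (auto simp: bounded_iff)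
  \<comment> \<open>The shifts have length at most 1. Outside the ball of radius
    \<open>R + 1\<close>, neither \<open>x\<close> nor the shifted point lies in \<open>D\<close>,
    so the quotient is 0; inside, the mean value theorem bounds it by a value of the partial
    derivative. This dominates all quotients at once.\<close>
  have bound: "norm (?q n x) \<le> B * indicator (cball 0 (R + 1)) x" for n x
  proof (cases "x \<in> cball 0 (R + 1)")
    case True
    have "\<exists>z>0. z < inverse (real (Suc n)) \<and> \<phi> (x + inverse (real (Suc n)) *\<^sub>R ?e) - \<phi> (x + 0 *\<^sub>R ?e)
        = (inverse (real (Suc n)) - 0) * partial i \<phi> (x + z *\<^sub>R ?e)"
      by (rule MVT2) (auto intro!: partial_has_field_derivative test_functions_differentiable[OF \<phi>])
    then obtain z where "\<phi> (x + inverse (real (Suc n)) *\<^sub>R ?e) - \<phi> x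
        = inverse (real (Suc n)) * partial i \<phi> (x + z *\<^sub>R ?e)" by auto
    then have "?q n x = partial i \<phi> (x + z *\<^sub>R ?e)" by (simp add: field_simps)
    with B True show ?thesis by simp
  next
    case False
    then have "x \<notin> D" using R[of x] by auto
    moreover have "norm x \<le> norm (x + inverse (real (Suc n)) *\<^sub>R ?e) + 1"
      using norm_triangle_ineq4[of "x + inverse (real (Suc n)) *\<^sub>R ?e" "inverse (real (Suc n)) *\<^sub>R ?e"]
      by (simp add: norm_axis_1 inverse_le_1_iff) (smt (verit) inverse_le_1_iff of_nat_0_le_iff)
    then have "x + inverse (real (Suc n)) *\<^sub>R ?e \<notin> D"
      using R[of "x + inverse (real (Suc n)) *\<^sub>R ?e"] False by auto
    ultimately show ?thesis using D(3) False by simp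
  qed
  have "(\<lambda>n. \<integral>x. ?q n x \<partial>lborel) \<longlonglongrightarrow> (\<integral>x. partial i \<phi> x \<partial>lborel)"
  proof (rule integral_dominated_convergence)
    show "integrable lborel (\<lambda>x::real^'n. B * indicator (cball 0 (R + 1)) x)"
      by (intro integrable_mult_right integrable_real_indicator) (simp_all only: emeasure_bounded_finite bounded_cball sets_lborel borel_closed closed_cball)
    show "AE x in lborel. norm (?q n x) \<le> B * indicator (cball 0 (R + 1)) x" for n
      using bound by auto
    show "partial i \<phi> \<in> borel_measurable lborel"
      using test_functions_measurable[OF test_functions_partial[OF \<phi>, of i]] by simp
    have "(\<lambda>x. \<phi> (x + v)) \<in> borel_measurable borel" for v
      by (intro borel_measurable_continuous_onI continuous_on_compose2[OF test_functions_continuous[OF \<phi>]]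
          continuous_intros) auto
    then show "?q n \<in> borel_measurable lborel" for n
      using test_functions_measurable[OF \<phi>] by (simp only: measurable_lborel2) (intro borel_measurable_times borel_measurable_diff borel_measurable_const)
    show "AE x in lborel. (\<lambda>n. ?q n x) \<longlonglongrightarrow> partial i \<phi> x"
    proof (rule AE_I2)
      fix x
      have "((\<lambda>h. (\<phi> (x + h *\<^sub>R ?e) - \<phi> x) / h) \<longlongrightarrow> partial i \<phi> x) (at 0)"
        using partial_has_field_derivative[OF test_functions_differentiable[OF \<phi>], where x=x and t=0 and i=i]
        by (simp add: has_field_derivative_iff)
      moreover have "filterlim (\<lambda>n. inverse (real (Suc n))) (at 0) sequentially"
        unfolding filterlim_at using LIMSEQ_inverse_real_of_nat by (simp del: of_nat_Suc)
      ultimately have "(\<lambda>n. (\<phi> (x + inverse (real (Suc n)) *\<^sub>R ?e) - \<phi> x) / inverse (real (Suc n))) \<longlonglongrightarrow> partial i \<phi> x"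
        by (rule filterlim_compose)
      then show "(\<lambda>n. ?q n x) \<longlonglongrightarrow> partial i \<phi> x" by (simp add: divide_inverse)
    qed
  qed
  then have "(\<lambda>n. 0) \<longlonglongrightarrow> (\<integral>x. partial i \<phi> x \<partial>lborel)" by (simp only: int0)
  then show ?thesis by (simp only: LIMSEQ_const_iff)
qed

lemma integral_partial_test_function:
  assumes "\<phi> \<in> test_functions \<Omega>" "\<Omega> \<in> sets lebesgue"
  shows "(\<integral>x. partial i \<phi> x \<partial>lebesgue_on \<Omega>) = 0"
  using test_functions_integral[OF test_functions_partial[OF assms(1)] assms(2)] integral_partial_lborel[OF assms(1)] by simp

section \<open>The fundamental lemma of the calculus of variations\<close>

lemma integrable_lebesgue_on_subset:
  fixes f :: "'a::euclidean_space \<Rightarrow> 'b::euclidean_space"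
  assumes "integrable (lebesgue_on S) f" "T \<subseteq> S" "S \<in> sets lebesgue" "T \<in> sets lebesgue"
  shows "integrable (lebesgue_on T) f"
proof -
  have "set_integrable lebesgue S f"
    using assms by (simp add: set_integrable_def integrable_restrict_space)
  then have "set_integrable lebesgue T f"
    by (rule set_integrable_subset) (use assms in auto)
  then show ?thesis
    using assms by (simp add: set_integrable_def integrable_restrict_space)
qed

text \<open>Open boxes are stable under intersection and generate the Borel sets. The sets over
  which the integral vanishes are closed under complements and countable disjoint unions, hence
  comprise all Borel sets, and uniqueness of densities applies. A Borel representative
  \<open>g\<close> replaces \<open>h\<close> because the argument runs over Borel sets only.\<close>

lemma AE_eq_0_if_box_integrals_eq_0:
  fixes h :: "'a::euclidean_space \<Rightarrow> real"
  assumes h: "integrable lebesgue h"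
    and box: "\<And>l u. (\<integral>x. indicator (box l u) x * h x \<partial>lebesgue) = 0"
  shows "AE x in lebesgue. h x = 0"
proof -
  obtain g where g[measurable]: "g \<in> borel_measurable lborel" and ae: "AE x in lborel. h x = g x"
    using completion_ex_borel_measurable_real[of h lborel] h by auto
  have ae': "AE x in lebesgue. h x = g x" by (rule AE_completion[OF ae])
  have "integrable lebesgue g"
    using h ae' g by (subst integrable_cong_AE[of g _ h]) (auto simp: measurable_completion elim!: eventually_mono)
  then have int: "integrable lborel g" by (simp add: integrable_completion)
  have eq: "(\<integral>x\<in>A. g x \<partial>lborel) = (\<integral>x. indicator A x * h x \<partial>lebesgue)" if "A \<in> sets borel" for A
  proof -
    have m: "(\<lambda>x. indicator A x * g x) \<in> borel_measurable lborel" using that by measurable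
    have "(\<integral>x\<in>A. g x \<partial>lborel) = (\<integral>x. indicator A x * g x \<partial>lebesgue)"
      by (subst integral_completion[OF m]) (simp add: set_lebesgue_integral_def)
    also have "\<dots> = (\<integral>x. indicator A x * h x \<partial>lebesgue)"
    proof (rule integral_cong_AE)
      show "(\<lambda>x. indicator A x * g x) \<in> borel_measurable lebesgue" using m by (rule measurable_completion)
      show "(\<lambda>x. indicator A x * h x) \<in> borel_measurable lebesgue"
        using h that by (intro borel_measurable_times borel_measurable_indicator) auto
    qed (use ae' in auto)
    finally show ?thesis .
  qed
  \<comment> \<open>The complement step needs the integral over the whole space to vanish. The whole
    space is not a box, but an increasing union of boxes.\<close>
  have UN: "UNIV = (\<Union>n. box (- (real n *\<^sub>R One)) (real n *\<^sub>R One :: 'a))"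
    by (simp add: UN_box_eq_UNIV)
  have zero: "(\<integral>x\<in>UNIV. g x \<partial>lborel) = 0"
  proof -
    have "(\<lambda>n. \<integral>x\<in>box (- (real n *\<^sub>R One)) (real n *\<^sub>R One). g x \<partial>lborel) \<longlonglongrightarrow>
        (\<integral>x\<in>(\<Union>n. box (- (real n *\<^sub>R One)) (real n *\<^sub>R One)). g x \<partial>lborel)"
    proof (rule set_integral_cont_up)
      show "incseq (\<lambda>n. box (- (real n *\<^sub>R One)) (real n *\<^sub>R One :: 'a))"
        by (auto simp: incseq_def box_def)
      show "set_integrable lborel (\<Union>n. box (- (real n *\<^sub>R One)) (real n *\<^sub>R One)) g"
        using int by (simp add: UN[symmetric] set_integrable_def)
    qed auto
    then have "(\<lambda>n. 0) \<longlonglongrightarrow> (\<integral>x\<in>UNIV. g x \<partial>lborel)"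
      by (simp only: UN[symmetric] eq[OF borel_open[OF open_box]] box)
    then show ?thesis by (simp only: LIMSEQ_const_iff)
  qed
  have "(\<integral>x\<in>A. g x \<partial>lborel) = 0" if A: "A \<in> sets borel" for A
  proof -
    have stable: "Int_stable (range (\<lambda>(l, u). box l u :: 'a set))"
      by (auto simp: Int_stable_def box_Int_box)
    have sub: "range (\<lambda>(l, u). box l u :: 'a set) \<subseteq> Pow UNIV" by auto
    have in_sig: "A \<in> sigma_sets UNIV (range (\<lambda>(l, u). box l u))"
      using A unfolding borel_eq_box by simp
    have borel: "\<And>B. B \<in> sigma_sets UNIV (range (\<lambda>(l, u). box l u)) \<Longrightarrow> (B::'a set) \<in> sets borel"
      by (simp add: borel_eq_box)
    show ?thesis
      using stable sub in_sig
    proof (induction rule: sigma_sets_induct_disjoint)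
      case (basic B)
      then show ?case using eq box by auto
    next
      case empty
      show ?case by (simp add: set_lebesgue_integral_def)
    next
      case (compl B)
      have "(\<integral>x\<in>B \<union> (UNIV - B). g x \<partial>lborel) = (\<integral>x\<in>B. g x \<partial>lborel) + (\<integral>x\<in>UNIV - B. g x \<partial>lborel)"
        by (rule set_integral_Un) (use int borel[OF compl(1)] in \<open>auto simp: set_integrable_def intro!: integrable_mult_indicator[where 'b=real, simplified]\<close>)
      then show ?case using zero compl(2) by simp
    next
      case (union F)
      have F: "F i \<in> sets borel" for i using union(2) borel by auto
      have "(\<integral>x\<in>(\<Union>i. F i). g x \<partial>lborel) = (\<Sum>i. \<integral>x\<in>F i. g x \<partial>lborel)"
        by (rule lebesgue_integral_countable_add)
          (use union(1) F int in \<open>auto simp: disjoint_family_on_def set_integrable_def intro!: integrable_mult_indicator[where 'b=real, simplified]\<close>)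
      then show ?case using union(3) by simp
    qed
  qed
  then have "AE x in lborel. g x = 0"
    using density_unique_real[OF int, of "\<lambda>x. 0"] by simp
  then have "AE x in lebesgue. g x = 0" by (rule AE_completion)
  with ae' show ?thesis by auto
qed

lemma locally_integrable_diff:
  assumes "locally_integrable \<Omega> f" "locally_integrable \<Omega> g"
  shows "locally_integrable \<Omega> (\<lambda>x. f x - g x)"
  using assms by (auto simp: locally_integrable_def)

lemma compact_lebesgue: "compact D \<Longrightarrow> D \<in> sets lebesgue"
  by (simp add: borel_compact)

lemma locally_integrable_mult_test_function:
  assumes g: "locally_integrable \<Omega> g" and \<phi>: "\<phi> \<in> test_functions \<Omega>" and \<Omega>: "\<Omega> \<in> sets lebesgue"
  shows "integrable (lebesgue_on \<Omega>) (\<lambda>x. g x * \<phi> x)"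
proof -
  obtain D where D: "compact D" "D \<subseteq> \<Omega>" "\<And>x. x \<notin> D \<Longrightarrow> \<phi> x = 0" by (rule test_functionsE[OF \<phi>]) blast
  obtain B where B: "B > 0" "\<And>x. \<bar>\<phi> x\<bar> \<le> B" by (rule test_functions_bounded[OF \<phi>]) blast
  have gD: "integrable (lebesgue_on D) g" using g D by (auto simp: locally_integrable_def)
  have "\<phi> \<in> borel_measurable lebesgue"
    using test_functions_measurable[OF \<phi>] by (simp add: measurable_completion)
  then have "integrable (lebesgue_on D) (\<lambda>x. g x * \<phi> x)"
    by (intro Bochner_Integration.integrable_bound[OF integrable_mult_left[OF gD, of B]] borel_measurable_times)
      (use B gD in \<open>auto simp: abs_mult intro!: mult_left_mono measurable_restrict_space1\<close>)
  then have "integrable lebesgue (\<lambda>x. if x \<in> D then g x * \<phi> x else 0)"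
    by (simp add: Lebesgue_Measure.integrable_restrict_UNIV compact_lebesgue D)
  moreover have "(\<lambda>x. if x \<in> D then g x * \<phi> x else 0) = (\<lambda>x. if x \<in> \<Omega> then g x * \<phi> x else 0)"
    using D by (auto simp: fun_eq_iff)
  ultimately show ?thesis
    by (simp add: Lebesgue_Measure.integrable_restrict_UNIV[OF \<Omega>])
qed

text \<open>On a box whose closure lies in \<Omega>, \<open>g\<close> is integrable and dominates
  its products with the bumps. Dominated convergence replaces the bumps by the indicator of the box,
  so \<open>g\<close> has integral zero over each such box and vanishes almost everywhere in
  it.\<close>

lemma fundamental_lemma_calculus_of_variations:
  fixes g :: "real^'n \<Rightarrow> real"
  assumes \<Omega>: "open \<Omega>" and g: "locally_integrable \<Omega> g"
    and zero: "\<And>\<phi>. \<phi> \<in> test_functions \<Omega> \<Longrightarrow> (\<integral>x. g x * \<phi> x \<partial>lebesgue_on \<Omega>) = 0"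
  shows "AE x in lebesgue_on \<Omega>. g x = 0"
proof -
  have ms: "\<Omega> \<in> sets lebesgue" using \<Omega> by (simp add: borel_open)
  define \<B> where "\<B> = {box l u | l u. cbox l u \<subseteq> \<Omega>}"
  have sub_box: "(\<integral>x. indicator (box l u) x * g x \<partial>lebesgue) = 0" if lu: "cbox l u \<subseteq> \<Omega>" for l u
  proof -
    have gD: "integrable (lebesgue_on (cbox l u)) g" using g lu by (auto simp: locally_integrable_def)
    let ?d = "\<lambda>x. if x \<in> cbox l u then \<bar>g x\<bar> else 0"
    have d: "integrable lebesgue ?d"
      using integrable_abs[OF gD] by (simp add: Lebesgue_Measure.integrable_restrict_UNIV compact_lebesgue)
    have ind: "(\<lambda>x. indicator (box l u) x * g x) \<in> borel_measurable lebesgue"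
    proof -
      have "integrable lebesgue (\<lambda>x. if x \<in> cbox l u then g x else 0)"
        using gD by (simp add: Lebesgue_Measure.integrable_restrict_UNIV compact_lebesgue)
      then have "(\<lambda>x. indicator (box l u) x * (if x \<in> cbox l u then g x else 0)) \<in> borel_measurable lebesgue"
        by (intro borel_measurable_times borel_measurable_indicator) auto
      also have "(\<lambda>x. indicator (box l u) x * (if x \<in> cbox l u then g x else 0)) = (\<lambda>x. indicator (box l u) x * g x)"
        using box_subset_cbox[of l u] by (auto simp: fun_eq_iff indicator_def)
      finally show ?thesis .
    qed
    let ?b = "\<lambda>n x. if x \<in> \<Omega> then g x * box_bump (real (Suc n)) l u x else 0"
    have test: "box_bump (real (Suc n)) l u \<in> test_functions \<Omega>" for n
      by (rule box_bump_test_function[OF _ lu]) auto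
    have b0: "box_bump (real (Suc n)) l u x = 0" if "x \<notin> box l u" for n x
      using box_bump_nonzero[of "real (Suc n)" l u x] that by (auto simp del: of_nat_Suc)
    have "(\<lambda>n. \<integral>x. ?b n x \<partial>lebesgue) \<longlonglongrightarrow> (\<integral>x. indicator (box l u) x * g x \<partial>lebesgue)"
    proof (rule integral_dominated_convergence[OF ind _ d])
      show "?b n \<in> borel_measurable lebesgue" for n
        using locally_integrable_mult_test_function[OF g test ms, of n]
        by (simp only: Lebesgue_Measure.integrable_restrict_UNIV[OF ms, symmetric]) (rule borel_measurable_integrable)
      show "AE x in lebesgue. (\<lambda>n. ?b n x) \<longlonglongrightarrow> indicator (box l u) x * g x"
      proof (rule AE_I2)
        fix x
        have "(\<lambda>n. g x * box_bump (real (Suc n)) l u x) \<longlonglongrightarrow> g x * indicator (box l u) x"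
          by (rule tendsto_mult[OF tendsto_const box_bump_tendsto])
        moreover have "(\<lambda>n. ?b n x) = (\<lambda>n. g x * box_bump (real (Suc n)) l u x)"
          using b0[of x] lu box_subset_cbox[of l u] by (auto simp: fun_eq_iff)
        ultimately show "(\<lambda>n. ?b n x) \<longlonglongrightarrow> indicator (box l u) x * g x" by (simp only: mult.commute)
      qed
      show "AE x in lebesgue. norm (?b n x) \<le> ?d x" for n
      proof (rule AE_I2)
        fix x
        show "norm (?b n x) \<le> ?d x"
        proof (cases "x \<in> box l u")
          case True
          then show ?thesis
            using lu box_subset_cbox[of l u] box_bump_bounds[of "real (Suc n)" l u x]
            by (auto simp: abs_mult mult_left_le simp del: of_nat_Suc)
        next
          case False
          then show ?thesis by (simp add: b0 del: of_nat_Suc)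
        qed
      qed
    qed
    moreover have "(\<integral>x. ?b n x \<partial>lebesgue) = 0" for n
      using zero[OF test] by (simp only: Lebesgue_Measure.integral_restrict_UNIV[OF ms])
    ultimately have "(\<lambda>n. 0) \<longlonglongrightarrow> (\<integral>x. indicator (box l u) x * g x \<partial>lebesgue)" by simp
    then show ?thesis by (simp only: LIMSEQ_const_iff)
  qed
  have on_box: "AE x in lebesgue. x \<in> box l u \<longrightarrow> g x = 0" if lu: "cbox l u \<subseteq> \<Omega>" for l u
  proof -
    have gD: "integrable (lebesgue_on (cbox l u)) g" using g lu by (auto simp: locally_integrable_def)
    have "integrable (lebesgue_on (box l u)) g"
      by (rule integrable_lebesgue_on_subset[OF gD box_subset_cbox]) (auto simp: compact_lebesgue)
    then have int: "integrable lebesgue (\<lambda>x. indicator (box l u) x * g x)"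
      by (simp add: integrable_restrict_space)
    have "AE x in lebesgue. indicator (box l u) x * g x = 0"
    proof (rule AE_eq_0_if_box_integrals_eq_0[OF int])
      fix l' u'
      obtain l'' u'' where eq: "box l' u' \<inter> box l u = box l'' u''" by (auto simp: box_Int_box)
      have "(\<integral>x. indicator (box l' u') x * (indicator (box l u) x * g x) \<partial>lebesgue)
          = (\<integral>x. indicator (box l'' u'') x * g x \<partial>lebesgue)"
        by (simp add: eq[symmetric] indicator_inter_arith mult.assoc)
      also have "\<dots> = 0"
      \<comment> \<open>\<open>cbox\<close> is the closure of \<open>box\<close> only if the latter
        is nonempty; over an empty box the integral is trivially zero.\<close>
      proof (cases "box l'' u'' = {}")
        case False
        have "cbox l'' u'' \<subseteq> cbox l u"
          using eq False by (metis Int_lower2 closure_box closure_mono box_subset_cbox closed_cbox closure_minimal order_trans)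
        then show ?thesis using sub_box lu by blast
      qed simp
      finally show "(\<integral>x. indicator (box l' u') x * (indicator (box l u) x * g x) \<partial>lebesgue) = 0" .
    qed
    then show ?thesis by eventually_elim (auto simp: indicator_def)
  qed
  \<comment> \<open>Each box contributes an exceptional null set. A countable subcover of \<Omega>
    is needed for the union of these sets to be null again.\<close>
  obtain \<B>' where B': "\<B>' \<subseteq> \<B>" "countable \<B>'" "\<Union>\<B>' = \<Union>\<B>"
    by (rule Lindelof[of \<B>]) (auto simp: \<B>_def)
  have cover: "\<Omega> \<subseteq> \<Union>\<B>'"
  proof
    fix x assume "x \<in> \<Omega>"
    then obtain l u where "cbox l u \<subseteq> \<Omega>" "x \<in> box l u" by (rule open_contains_cbox[OF \<Omega>]) blast
    then show "x \<in> \<Union>\<B>'" unfolding B'(3) by (auto simp: \<B>_def)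
  qed
  have "AE x in lebesgue. \<forall>A\<in>\<B>'. x \<in> A \<longrightarrow> g x = 0"
    using B'(1,2) on_box by (subst AE_ball_countable) (auto simp: \<B>_def)
  then have "AE x in lebesgue. x \<in> \<Omega> \<longrightarrow> g x = 0"
    by eventually_elim (use cover in blast)
  then show ?thesis using ms by (simp add: AE_restrict_space_iff)
qed

section \<open>Weak derivatives and the Poincare inequality\<close>

locale bounded_open =
  fixes \<Omega> :: "(real^'n) set"
  assumes open_domain: "open \<Omega>" and bounded_domain: "bounded \<Omega>"
begin

lemma domain_lebesgue [simp]: "\<Omega> \<in> sets lebesgue"
  using open_domain by (simp add: borel_open)

lemma const_integrable: "integrable (lebesgue_on \<Omega>) (\<lambda>x. r :: real)"
proof -
  have "\<Omega> \<in> lmeasurable" using bounded_domain open_domain by (simp add: lmeasurable_open)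
  then have "integrable lebesgue (indicator \<Omega> :: _ \<Rightarrow> real)"
    by (auto simp: fmeasurable_def)
  then have "integrable (lebesgue_on \<Omega>) (\<lambda>x. 1 :: real)"
    by (simp add: integrable_restrict_space)
  from integrable_mult_right[OF this, of r] show ?thesis by simp
qed

lemma AE_bounded_L2:
  fixes f :: "real^'n \<Rightarrow> 'b::euclidean_space"
  assumes "f \<in> borel_measurable (lebesgue_on \<Omega>)" "AE x in lebesgue_on \<Omega>. norm (f x) \<le> M"
  shows "f \<in> L2_space \<Omega>"
  by (rule L2_space_dominated[OF const_integrable[of "M\<^sup>2"] assms(1)])
    (use assms(2) in \<open>auto elim!: eventually_mono intro!: power_mono\<close>)

text \<open>As \<Omega> has finite measure, \<open>1 + \<bar>f\<bar>\<^sup>2\<close> is an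
  integrable majorant of \<open>\<bar>f\<bar>\<close>.\<close>

lemma L2_locally_integrable:
  assumes "f \<in> L2_space \<Omega>"
  shows "locally_integrable \<Omega> f"
proof -
  have "integrable (lebesgue_on \<Omega>) (\<lambda>x. 1 + (norm (f x))\<^sup>2)"
    using L2_spaceD[OF assms] const_integrable by (intro Bochner_Integration.integrable_add) auto
  then have "integrable (lebesgue_on \<Omega>) f"
  proof (rule Bochner_Integration.integrable_bound)
    have "\<bar>t\<bar> \<le> 1 + t\<^sup>2" for t :: real
      using zero_le_power2[of "\<bar>t\<bar> - 1"] by (auto simp: power2_eq_square algebra_simps abs_if split: if_splits)
    then show "AE x in lebesgue_on \<Omega>. norm (f x) \<le> norm (1 + (norm (f x))\<^sup>2)" by auto
  qed (use L2_spaceD[OF assms] in auto)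
  then show ?thesis
    by (auto simp: locally_integrable_def intro: integrable_lebesgue_on_subset compact_lebesgue)
qed

text \<open>The difference of two weak derivatives is orthogonal to all test functions. Through this
  fact the arbitrary choice \<open>weak_partial\<close> may be replaced, almost everywhere, by any
  weak derivative that has been exhibited.\<close>

lemma has_weak_partial_unique:
  assumes "has_weak_partial \<Omega> i f g" "has_weak_partial \<Omega> i f g'"
  shows "AE x in lebesgue_on \<Omega>. g x = g' x"
proof -
  have loc: "locally_integrable \<Omega> g" "locally_integrable \<Omega> g'" using assms by (auto simp: has_weak_partial_def)
  have "AE x in lebesgue_on \<Omega>. g x - g' x = 0"
  proof (rule fundamental_lemma_calculus_of_variations[OF open_domain locally_integrable_diff[OF loc]])
    fix \<phi> assume \<phi>: "\<phi> \<in> test_functions \<Omega>"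
    have "(\<integral>x. (g x - g' x) * \<phi> x \<partial>lebesgue_on \<Omega>)
      = (\<integral>x. g x * \<phi> x \<partial>lebesgue_on \<Omega>) - (\<integral>x. g' x * \<phi> x \<partial>lebesgue_on \<Omega>)"
      unfolding left_diff_distrib
      by (intro Bochner_Integration.integral_diff locally_integrable_mult_test_function loc \<phi> domain_lebesgue)
    also have "\<dots> = 0"
    proof -
      have "(\<integral>x. f x * partial i \<phi> x \<partial>lebesgue_on \<Omega>) = - (\<integral>x. g x * \<phi> x \<partial>lebesgue_on \<Omega>)"
        "(\<integral>x. f x * partial i \<phi> x \<partial>lebesgue_on \<Omega>) = - (\<integral>x. g' x * \<phi> x \<partial>lebesgue_on \<Omega>)"
        using assms \<phi> unfolding has_weak_partial_def by blast+
      then show ?thesis by simp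
    qed
    finally show "(\<integral>x. (g x - g' x) * \<phi> x \<partial>lebesgue_on \<Omega>) = 0" .
  qed
  then show ?thesis by auto
qed

lemma has_weak_partial_weak_partial:
  "has_weak_partial \<Omega> i f g \<Longrightarrow> has_weak_partial \<Omega> i f (weak_partial \<Omega> i f)"
  unfolding weak_partial_def by (rule someI[of "has_weak_partial \<Omega> i f"])

lemma weak_partial_AE:
  assumes "has_weak_partial \<Omega> i f g"
  shows "AE x in lebesgue_on \<Omega>. weak_partial \<Omega> i f x = g x"
  by (rule has_weak_partial_unique[OF has_weak_partial_weak_partial[OF assms] assms])

lemma has_weak_partial_diff:
  assumes f: "has_weak_partial \<Omega> i f f'" and g: "has_weak_partial \<Omega> i g g'"
  shows "has_weak_partial \<Omega> i (\<lambda>x. f x - g x) (\<lambda>x. f' x - g' x)"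
proof -
  have loc: "locally_integrable \<Omega> f" "locally_integrable \<Omega> g" "locally_integrable \<Omega> f'" "locally_integrable \<Omega> g'"
    using assms by (auto simp: has_weak_partial_def)
  show ?thesis
    unfolding has_weak_partial_def
  proof (intro conjI ballI locally_integrable_diff loc)
    fix \<phi> assume \<phi>: "\<phi> \<in> test_functions \<Omega>"
    note * = locally_integrable_mult_test_function[OF _ \<phi> domain_lebesgue]
      locally_integrable_mult_test_function[OF _ test_functions_partial[OF \<phi>] domain_lebesgue]
    have "(\<integral>x. f x * partial i \<phi> x \<partial>lebesgue_on \<Omega>) = - (\<integral>x. f' x * \<phi> x \<partial>lebesgue_on \<Omega>)"
      "(\<integral>x. g x * partial i \<phi> x \<partial>lebesgue_on \<Omega>) = - (\<integral>x. g' x * \<phi> x \<partial>lebesgue_on \<Omega>)"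
      using assms \<phi> unfolding has_weak_partial_def by blast+
    then show "(\<integral>x. (f x - g x) * partial i \<phi> x \<partial>lebesgue_on \<Omega>) = - (\<integral>x. (f' x - g' x) * \<phi> x \<partial>lebesgue_on \<Omega>)"
      unfolding left_diff_distrib
      by (simp add: Bochner_Integration.integral_diff * loc)
  qed
qed

text \<open>The product of two test functions is a test function, so the integral of its partial
  derivative is zero; by the product rule this is integration by parts.\<close>

lemma test_function_has_weak_partial:
  assumes \<phi>: "\<phi> \<in> test_functions \<Omega>"
  shows "has_weak_partial \<Omega> i \<phi> (partial i \<phi>)"
  unfolding has_weak_partial_def
proof (intro conjI ballI L2_locally_integrable test_functions_L2 test_functions_partial \<phi> domain_lebesgue)
  fix \<psi> assume \<psi>: "\<psi> \<in> test_functions \<Omega>"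
  have eq: "partial i (\<lambda>x. \<phi> x * \<psi> x) = (\<lambda>x. \<phi> x * partial i \<psi> x + partial i \<phi> x * \<psi> x)"
    by (rule ext, rule partial_mult) (intro test_functions_differentiable[OF \<phi>] test_functions_differentiable[OF \<psi>])+
  have "0 = (\<integral>x. partial i (\<lambda>x. \<phi> x * \<psi> x) x \<partial>lebesgue_on \<Omega>)"
    by (intro integral_partial_test_function[symmetric, OF _ domain_lebesgue] test_functions_mult \<psi> test_functions_C_k[OF \<phi>])
  also have "\<dots> = (\<integral>x. \<phi> x * partial i \<psi> x \<partial>lebesgue_on \<Omega>) + (\<integral>x. partial i \<phi> x * \<psi> x \<partial>lebesgue_on \<Omega>)"
    unfolding eq
    by (intro Bochner_Integration.integral_add test_functions_integrable[OF _ domain_lebesgue]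
        test_functions_mult \<psi> test_functions_partial test_functions_C_k[OF \<phi>] test_functions_C_k[OF test_functions_partial[OF \<phi>]])
  finally show "(\<integral>x. \<phi> x * partial i \<psi> x \<partial>lebesgue_on \<Omega>) = - (\<integral>x. partial i \<phi> x * \<psi> x \<partial>lebesgue_on \<Omega>)" by simp
qed

lemma H1_weak_partial:
  assumes "f \<in> H1_space \<Omega>"
  shows "has_weak_partial \<Omega> i f (weak_partial \<Omega> i f)" "weak_partial \<Omega> i f \<in> L2_space \<Omega>"
proof -
  obtain g where g: "g \<in> L2_space \<Omega>" "has_weak_partial \<Omega> i f g"
    using assms by (auto simp: H1_space_def)
  show "has_weak_partial \<Omega> i f (weak_partial \<Omega> i f)" by (rule has_weak_partial_weak_partial[OF g(2)])
  show "weak_partial \<Omega> i f \<in> L2_space \<Omega>"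
    by (rule L2_space_cong_AE[OF g(1)]) (use weak_partial_AE[OF g(2)] in \<open>auto elim!: eventually_mono\<close>)
qed

lemma H1_space_diff:
  assumes f: "f \<in> H1_space \<Omega>" and g: "g \<in> H1_space \<Omega>"
  shows "(\<lambda>x. f x - g x) \<in> H1_space \<Omega>"
proof -
  have "\<exists>h\<in>L2_space \<Omega>. has_weak_partial \<Omega> i (\<lambda>x. f x - g x) h" for i
    by (rule bexI[where x="\<lambda>x. weak_partial \<Omega> i f x - weak_partial \<Omega> i g x"])
      (intro has_weak_partial_diff L2_space_diff H1_weak_partial f g)+
  then show ?thesis using f g by (auto simp: H1_space_def intro!: L2_space_diff)
qed

lemma weak_partial_diff_AE:
  assumes f: "f \<in> H1_space \<Omega>" and g: "g \<in> H1_space \<Omega>"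
  shows "AE x in lebesgue_on \<Omega>. weak_partial \<Omega> i (\<lambda>x. f x - g x) x = weak_partial \<Omega> i f x - weak_partial \<Omega> i g x"
  by (rule weak_partial_AE[OF has_weak_partial_diff[OF H1_weak_partial(1)[OF f] H1_weak_partial(1)[OF g]]])

lemma test_functions_H1:
  assumes "\<phi> \<in> test_functions \<Omega>"
  shows "\<phi> \<in> H1_space \<Omega>"
  using test_function_has_weak_partial[OF assms] test_functions_L2[OF test_functions_partial[OF assms] domain_lebesgue]
    test_functions_L2[OF assms domain_lebesgue] by (auto simp: H1_space_def)

lemma H1_norm_bounds:
  "L2_norm \<Omega> f \<le> H1_norm \<Omega> f" "L2_norm \<Omega> (weak_partial \<Omega> i f) \<le> H1_norm \<Omega> f"
proof -
  have nn: "0 \<le> (\<Sum>i\<in>UNIV. (L2_norm \<Omega> (weak_partial \<Omega> i f))\<^sup>2)" by (intro sum_nonneg) auto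
  then show "L2_norm \<Omega> f \<le> H1_norm \<Omega> f"
    unfolding H1_norm_def by (intro real_le_rsqrt) auto
  have "(L2_norm \<Omega> (weak_partial \<Omega> i f))\<^sup>2 \<le> (\<Sum>i\<in>UNIV. (L2_norm \<Omega> (weak_partial \<Omega> i f))\<^sup>2)"
    by (rule member_le_sum) auto
  then show "L2_norm \<Omega> (weak_partial \<Omega> i f) \<le> H1_norm \<Omega> f"
    unfolding H1_norm_def by (intro real_le_rsqrt) (simp add: add_increasing)
qed

lemma H1_norm_le_sum: "H1_norm \<Omega> f \<le> L2_norm \<Omega> f + (\<Sum>i\<in>UNIV. L2_norm \<Omega> (weak_partial \<Omega> i f))"
proof -
  \<comment> \<open>The extra element of the option type carries the norm of \<open>f\<close>
    itself. The norm thus becomes a Euclidean norm over one index set, bounded by the sum of its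
    entries.\<close>
  have "H1_norm \<Omega> f = L2_set (\<lambda>j. case j of None \<Rightarrow> L2_norm \<Omega> f | Some i \<Rightarrow> L2_norm \<Omega> (weak_partial \<Omega> i f)) UNIV"
    unfolding H1_norm_def L2_set_def UNIV_option_conv by (simp add: sum.reindex)
  also have "\<dots> \<le> L2_norm \<Omega> f + (\<Sum>i\<in>UNIV. L2_norm \<Omega> (weak_partial \<Omega> i f))"
    by (rule order_trans[OF L2_set_le_sum]) (auto simp: UNIV_option_conv sum.reindex split: option.split)
  finally show ?thesis .
qed

lemma L2_norm_weak_partial_test_diff:
  assumes \<phi>: "\<phi> \<in> test_functions \<Omega>" and f: "f \<in> H1_space \<Omega>"
  shows "L2_norm \<Omega> (weak_partial \<Omega> i (\<lambda>x. \<phi> x - f x)) = L2_norm \<Omega> (\<lambda>x. partial i \<phi> x - weak_partial \<Omega> i f x)"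
proof (rule L2_norm_cong_AE)
  note \<phi>1 = test_functions_H1[OF \<phi>]
  show "weak_partial \<Omega> i (\<lambda>x. \<phi> x - f x) \<in> L2_space \<Omega>"
    by (intro H1_weak_partial H1_space_diff f \<phi>1)
  show "(\<lambda>x. partial i \<phi> x - weak_partial \<Omega> i f x) \<in> L2_space \<Omega>"
    by (intro L2_space_diff H1_weak_partial f test_functions_L2 test_functions_partial \<phi> domain_lebesgue)
  show "AE x in lebesgue_on \<Omega>. weak_partial \<Omega> i (\<lambda>x. \<phi> x - f x) x = partial i \<phi> x - weak_partial \<Omega> i f x"
    using weak_partial_diff_AE[OF \<phi>1 f, of i] weak_partial_AE[OF test_function_has_weak_partial[OF \<phi>, of i]] by auto
qed

text \<open>Splits the convergence in \<open>H1_norm\<close> into convergence of the functions and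
  of each classical partial derivative, the form in which limits are taken below.\<close>

lemma H10E:
  assumes "f \<in> H10_space \<Omega>"
  obtains \<phi> where "\<And>n::nat. \<phi> n \<in> test_functions \<Omega>"
    "(\<lambda>n. L2_norm \<Omega> (\<lambda>x. \<phi> n x - f x)) \<longlonglongrightarrow> 0"
    "\<And>i. (\<lambda>n. L2_norm \<Omega> (\<lambda>x. partial i (\<phi> n) x - weak_partial \<Omega> i f x)) \<longlonglongrightarrow> 0"
proof -
  obtain \<phi> where \<phi>: "\<And>n. \<phi> n \<in> test_functions \<Omega>" and lim: "(\<lambda>n::nat. H1_norm \<Omega> (\<lambda>x. \<phi> n x - f x)) \<longlonglongrightarrow> 0"
    and f: "f \<in> H1_space \<Omega>"
    using assms by (auto simp: H10_space_def)
  show ?thesis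
  proof (rule that[OF \<phi>])
    show "(\<lambda>n. L2_norm \<Omega> (\<lambda>x. \<phi> n x - f x)) \<longlonglongrightarrow> 0"
      by (rule tendsto_sandwich[OF _ _ tendsto_const lim]) (auto simp: H1_norm_bounds)
    show "(\<lambda>n. L2_norm \<Omega> (\<lambda>x. partial i (\<phi> n) x - weak_partial \<Omega> i f x)) \<longlonglongrightarrow> 0" for i
      unfolding L2_norm_weak_partial_test_diff[OF \<phi> f, symmetric]
      by (rule tendsto_sandwich[OF _ _ tendsto_const lim]) (auto simp: H1_norm_bounds)
  qed
qed

lemma H10_H1: "f \<in> H10_space \<Omega> \<Longrightarrow> f \<in> H1_space \<Omega>"
  by (simp add: H10_space_def)

lemma H10_L2: "f \<in> H10_space \<Omega> \<Longrightarrow> f \<in> L2_space \<Omega>"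
  by (simp add: H10_space_def H1_space_def)

lemma H10_space_diff:
  assumes f: "f \<in> H10_space \<Omega>" and g: "g \<in> H10_space \<Omega>"
  shows "(\<lambda>x. f x - g x) \<in> H10_space \<Omega>"
proof -
  obtain \<phi> where \<phi>: "\<And>n. \<phi> n \<in> test_functions \<Omega>" and lim\<phi>: "(\<lambda>n::nat. H1_norm \<Omega> (\<lambda>x. \<phi> n x - f x)) \<longlonglongrightarrow> 0"
    using f by (auto simp: H10_space_def)
  obtain \<psi> where \<psi>: "\<And>n. \<psi> n \<in> test_functions \<Omega>" and lim\<psi>: "(\<lambda>n::nat. H1_norm \<Omega> (\<lambda>x. \<psi> n x - g x)) \<longlonglongrightarrow> 0"
    using g by (auto simp: H10_space_def)
  note f1 = H10_H1[OF f] and g1 = H10_H1[OF g]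
  let ?u = "\<lambda>n x. \<phi> n x - f x" and ?v = "\<lambda>n x. \<psi> n x - g x"
  have u: "?u n \<in> H1_space \<Omega>" and v: "?v n \<in> H1_space \<Omega>" for n
    by (intro H1_space_diff test_functions_H1 \<phi> \<psi> f1 g1)+
  \<comment> \<open>The crude factor (dimension plus one) stands in for the triangle inequality of
    \<open>H1_norm\<close>. Any fixed factor serves, because the right-hand side tends to 0.\<close>
  have le: "H1_norm \<Omega> (\<lambda>x. ?u n x - ?v n x) \<le> real (CARD('n) + 1) * (H1_norm \<Omega> (?u n) + H1_norm \<Omega> (?v n))" for n
  proof -
    have tri: "L2_norm \<Omega> (\<lambda>x. p x - q x) \<le> L2_norm \<Omega> p + L2_norm \<Omega> q"
      if "p \<in> L2_space \<Omega>" "q \<in> L2_space \<Omega>" for p q :: "real^'n \<Rightarrow> real"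
      using L2_norm_triangle[OF that(1) L2_space_scaleR[OF that(2), of "-1"]] L2_norm_scaleR[of \<Omega> "-1" q] by simp
    have a: "L2_norm \<Omega> (\<lambda>x. ?u n x - ?v n x) \<le> H1_norm \<Omega> (?u n) + H1_norm \<Omega> (?v n)"
      using tri[of "?u n" "?v n"] u[of n] v[of n] H1_norm_bounds(1)[of "?u n"] H1_norm_bounds(1)[of "?v n"]
      by (simp add: H1_space_def)
    have b: "L2_norm \<Omega> (weak_partial \<Omega> i (\<lambda>x. ?u n x - ?v n x)) \<le> H1_norm \<Omega> (?u n) + H1_norm \<Omega> (?v n)" for i
    proof -
      have "L2_norm \<Omega> (weak_partial \<Omega> i (\<lambda>x. ?u n x - ?v n x))
          = L2_norm \<Omega> (\<lambda>x. weak_partial \<Omega> i (?u n) x - weak_partial \<Omega> i (?v n) x)"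
        by (rule L2_norm_cong_AE[OF _ _ weak_partial_diff_AE[OF u v]])
          (intro L2_space_diff H1_weak_partial H1_space_diff u v)+
      also have "\<dots> \<le> L2_norm \<Omega> (weak_partial \<Omega> i (?u n)) + L2_norm \<Omega> (weak_partial \<Omega> i (?v n))"
        by (intro tri H1_weak_partial u v)
      finally show ?thesis using H1_norm_bounds(2)[of i "?u n"] H1_norm_bounds(2)[of i "?v n"] by simp
    qed
    have "(\<Sum>i\<in>UNIV. L2_norm \<Omega> (weak_partial \<Omega> i (\<lambda>x. ?u n x - ?v n x)))
        \<le> (\<Sum>i\<in>(UNIV::'n set). H1_norm \<Omega> (?u n) + H1_norm \<Omega> (?v n))"
      by (rule sum_mono[OF b])
    then show ?thesis
      using H1_norm_le_sum[of "\<lambda>x. ?u n x - ?v n x"] a by (simp add: algebra_simps)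
  qed
  have "(\<lambda>n. H1_norm \<Omega> (\<lambda>x. ?u n x - ?v n x)) \<longlonglongrightarrow> 0"
  proof (rule tendsto_sandwich[OF _ _ tendsto_const])
    have "(\<lambda>n. real (CARD('n) + 1) * (H1_norm \<Omega> (?u n) + H1_norm \<Omega> (?v n))) \<longlonglongrightarrow> real (CARD('n) + 1) * (0 + 0)"
      by (intro tendsto_intros lim\<phi> lim\<psi>)
    then show "(\<lambda>n. real (CARD('n) + 1) * (H1_norm \<Omega> (?u n) + H1_norm \<Omega> (?v n))) \<longlonglongrightarrow> 0" by simp
  qed (use le order_trans[OF L2_norm_nonneg H1_norm_bounds(1)] in auto)
  moreover have "(\<lambda>x. ?u n x - ?v n x) = (\<lambda>x. (\<phi> n x - \<psi> n x) - (f x - g x))" for n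
    by (simp add: fun_eq_iff)
  ultimately show ?thesis
    unfolding H10_space_def
    using H1_space_diff[OF f1 g1] test_functions_diff[OF \<phi> \<psi>]
    by (intro CollectI conjI exI[of _ "\<lambda>n x. \<phi> n x - \<psi> n x"]) auto
qed

text \<open>The integral of \<open>partial i\<close> applied to
  \<open>x $ i * \<phi>\<^sup>2\<close> is zero. Hence the square of the norm of \<phi> equals minus
  twice the integral of \<open>x $ i * partial i \<phi> * \<phi>\<close>; Cauchy-Schwarz and one
  division by the norm give the factor \<open>2 * R\<close>.\<close>

lemma poincare_test_function:
  assumes \<phi>: "\<phi> \<in> test_functions \<Omega>" and R: "\<And>x. x \<in> \<Omega> \<Longrightarrow> \<bar>x $ i\<bar> \<le> R" "R \<ge> 0"
  shows "L2_norm \<Omega> \<phi> \<le> 2 * R * L2_norm \<Omega> (partial i \<phi>)"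
proof -
  let ?p = "partial i \<phi>"
  note p = test_functions_partial[OF \<phi>, of i]
  have x: "(\<lambda>x::real^'n. x $ i) \<in> borel_measurable (lebesgue_on \<Omega>)"
    by (intro measurable_restrict_space1 measurable_completion) simp
  have bound: "AE x in lebesgue_on \<Omega>. \<bar>x $ i\<bar> \<le> R"
    using R by (intro AE_I2) auto
  note xp = L2_mult_bounded[OF x bound R(2) test_functions_L2[OF p domain_lebesgue]]
  have pi: "partial i (\<lambda>x. x $ i * (\<phi> x * \<phi> x)) = (\<lambda>x. \<phi> x * \<phi> x + 2 * (x $ i * ?p x * \<phi> x))"
  proof
    fix x
    have d: "((\<lambda>x::real^'n. x $ i) has_derivative (\<lambda>x. x $ i)) (at x)"
      by (auto intro!: bounded_linear_imp_has_derivative bounded_linear_vec_nth)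
    then have d1: "(\<lambda>x::real^'n. x $ i) differentiable (at x)" by (auto simp: differentiable_def)
    note d2 = test_functions_differentiable[OF \<phi>, of x]
    show "partial i (\<lambda>x. x $ i * (\<phi> x * \<phi> x)) x = \<phi> x * \<phi> x + 2 * (x $ i * ?p x * \<phi> x)"
      using partial_mult[OF d1 differentiable_mult[OF d2 d2], of i] partial_mult[OF d2 d2, of i] partial_eqI[OF d, of i]
      by (simp add: algebra_simps)
  qed
  have test: "(\<lambda>x. x $ i * (\<phi> x * \<phi> x)) \<in> test_functions \<Omega>"
    by (intro test_functions_mult \<phi> C_k_coordinate test_functions_C_k[OF \<phi>])
  have "0 = (\<integral>x. \<phi> x * \<phi> x + 2 * (x $ i * ?p x * \<phi> x) \<partial>lebesgue_on \<Omega>)"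
    using integral_partial_test_function[OF test domain_lebesgue, of i] by (simp only: pi)
  also have "\<dots> = (\<integral>x. \<phi> x * \<phi> x \<partial>lebesgue_on \<Omega>) + 2 * (\<integral>x. x $ i * ?p x * \<phi> x \<partial>lebesgue_on \<Omega>)"
    using L2_inner_integrable[OF xp(1) test_functions_L2[OF \<phi> domain_lebesgue]]
      L2_inner_integrable[OF test_functions_L2[OF \<phi> domain_lebesgue] test_functions_L2[OF \<phi> domain_lebesgue]]
    by simp
  finally have "(L2_norm \<Omega> \<phi>)\<^sup>2 = - 2 * L2_inner \<Omega> (\<lambda>x. x $ i * ?p x) \<phi>"
    by (simp add: L2_norm_square L2_inner_def)
  also have "\<dots> \<le> 2 * (L2_norm \<Omega> (\<lambda>x. x $ i * ?p x) * L2_norm \<Omega> \<phi>)"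
    using L2_Cauchy_Schwarz[OF xp(1) test_functions_L2[OF \<phi> domain_lebesgue]] by linarith
  also have "\<dots> \<le> 2 * (R * L2_norm \<Omega> ?p * L2_norm \<Omega> \<phi>)"
    using xp(2) by (intro mult_left_mono mult_right_mono) auto
  finally have "L2_norm \<Omega> \<phi> * L2_norm \<Omega> \<phi> \<le> (2 * R * L2_norm \<Omega> ?p) * L2_norm \<Omega> \<phi>"
    by (simp add: power2_eq_square algebra_simps)
  then show ?thesis
    using R(2) by (cases "L2_norm \<Omega> \<phi> = 0") (auto simp: mult_le_cancel_right less_le)
qed

text \<open>The constant for test functions depends only on a bound for the coordinates. A bound for
  the norm on \<Omega> serves every coordinate, and both sides pass to the limit along an
  approximating sequence.\<close>

lemma poincare:
  obtains R where "R > 0" "\<And>f i. f \<in> H10_space \<Omega> \<Longrightarrow> L2_norm \<Omega> f \<le> R * L2_norm \<Omega> (weak_partial \<Omega> i f)"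
proof -
  obtain B where B: "B > 0" "\<And>x. x \<in> \<Omega> \<Longrightarrow> norm x \<le> B" using bounded_domain bounded_pos by blast
  have "L2_norm \<Omega> f \<le> 2 * B * L2_norm \<Omega> (weak_partial \<Omega> i f)" if f: "f \<in> H10_space \<Omega>" for f i
  proof -
    obtain \<phi> where \<phi>: "\<And>n::nat. \<phi> n \<in> test_functions \<Omega>"
      and lim: "(\<lambda>n. L2_norm \<Omega> (\<lambda>x. \<phi> n x - f x)) \<longlonglongrightarrow> 0"
        "\<And>i. (\<lambda>n. L2_norm \<Omega> (\<lambda>x. partial i (\<phi> n) x - weak_partial \<Omega> i f x)) \<longlonglongrightarrow> 0"
      by (rule H10E[OF f]) blast
    have B': "\<bar>x $ i\<bar> \<le> B" if "x \<in> \<Omega>" for x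
      using component_le_norm_cart[of x i] B(2)[OF that] by simp
    show ?thesis
    proof (rule LIMSEQ_le)
      show "(\<lambda>n. L2_norm \<Omega> (\<phi> n)) \<longlonglongrightarrow> L2_norm \<Omega> f"
        by (rule L2_norm_tendsto[OF test_functions_L2[OF \<phi> domain_lebesgue] H10_L2[OF f] lim(1)])
      show "(\<lambda>n. 2 * B * L2_norm \<Omega> (partial i (\<phi> n))) \<longlonglongrightarrow> 2 * B * L2_norm \<Omega> (weak_partial \<Omega> i f)"
        by (intro tendsto_intros L2_norm_tendsto[OF _ _ lim(2)] test_functions_L2 test_functions_partial \<phi> domain_lebesgue
            H1_weak_partial H10_H1 f)
      show "\<exists>N. \<forall>n\<ge>N. L2_norm \<Omega> (\<phi> n) \<le> 2 * B * L2_norm \<Omega> (partial i (\<phi> n))"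
        using poincare_test_function[OF \<phi> B'] B(1) by auto
    qed
  qed
  then show ?thesis using that[of "2 * B"] B(1) by auto
qed

end

section \<open>Vector fields and the bilinear forms\<close>

lemma borel_measurable_vec_iff:
  fixes f :: "'a \<Rightarrow> 'b::euclidean_space^'m"
  shows "f \<in> borel_measurable M \<longleftrightarrow> (\<forall>i. (\<lambda>x. f x $ i) \<in> borel_measurable M)"
proof
  assume "f \<in> borel_measurable M"
  then show "\<forall>i. (\<lambda>x. f x $ i) \<in> borel_measurable M"
    using measurable_compose[OF _ borel_measurable_continuous_onI[OF linear_continuous_on[OF bounded_linear_vec_nth]]]
    by blast
next
  assume *: "\<forall>i. (\<lambda>x. f x $ i) \<in> borel_measurable M"
  show "f \<in> borel_measurable M"
    by (subst borel_measurable_euclidean_space) (use * in \<open>auto simp: Basis_vec_def inner_axis intro!: borel_measurable_inner\<close>)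
qed

text \<open>The components may themselves be vectors, so that two applications lead from a matrix
  field, such as a gradient, to its entries.\<close>

lemma L2_space_vec_iff:
  fixes f :: "real^'n \<Rightarrow> 'b::euclidean_space^'m"
  shows "f \<in> L2_space S \<longleftrightarrow> (\<forall>i. (\<lambda>x. f x $ i) \<in> L2_space S)"
proof
  assume f: "f \<in> L2_space S"
  show "\<forall>i. (\<lambda>x. f x $ i) \<in> L2_space S"
  proof
    fix i
    show "(\<lambda>x. f x $ i) \<in> L2_space S"
    proof (rule L2_space_dominated[OF L2_spaceD(2)[OF f]])
      show "(\<lambda>x. f x $ i) \<in> borel_measurable (lebesgue_on S)"
        using L2_spaceD(1)[OF f] unfolding borel_measurable_vec_iff by blast
      show "AE x in lebesgue_on S. (norm (f x $ i))\<^sup>2 \<le> (norm (f x))\<^sup>2"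
        by (intro AE_I2 power_mono Finite_Cartesian_Product.norm_nth_le norm_ge_zero)
    qed
  qed
next
  assume f: "\<forall>i. (\<lambda>x. f x $ i) \<in> L2_space S"
  have "(norm (f x))\<^sup>2 = (\<Sum>i\<in>UNIV. (norm (f x $ i))\<^sup>2)" for x
    by (simp add: norm_vec_def L2_set_def sum_nonneg)
  then show "f \<in> L2_space S"
    using f unfolding L2_space_def by (simp only: borel_measurable_vec_iff mem_Collect_eq) simp
qed

lemma L2_inner_vec:
  fixes f g :: "real^'n \<Rightarrow> 'b::euclidean_space^'m"
  assumes "f \<in> L2_space S" "g \<in> L2_space S"
  shows "L2_inner S f g = (\<Sum>i\<in>UNIV. L2_inner S (\<lambda>x. f x $ i) (\<lambda>x. g x $ i))"
  unfolding L2_inner_def inner_vec_def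
  by (intro Bochner_Integration.integral_sum L2_inner_integrable) (use assms in \<open>auto simp: L2_space_vec_iff\<close>)

lemma L2_norm_vec_square:
  fixes f :: "real^'n \<Rightarrow> 'b::euclidean_space^'m"
  assumes "f \<in> L2_space S"
  shows "(L2_norm S f)\<^sup>2 = (\<Sum>i\<in>UNIV. (L2_norm S (\<lambda>x. f x $ i))\<^sup>2)"
  by (simp add: L2_norm_square L2_inner_vec[OF assms assms])

lemma L2_norm_component_le:
  fixes f :: "real^'n \<Rightarrow> 'b::euclidean_space^'m"
  assumes "f \<in> L2_space S"
  shows "L2_norm S (\<lambda>x. f x $ i) \<le> L2_norm S f"
  by (rule power2_le_imp_le[OF _ L2_norm_nonneg], subst L2_norm_vec_square[OF assms])
    (rule member_le_sum[of i UNIV "\<lambda>i. (L2_norm S (\<lambda>x. f x $ i))\<^sup>2"], auto)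

lemma L2_norm_vec_le_sum:
  fixes f :: "real^'n \<Rightarrow> 'b::euclidean_space^'m"
  assumes "f \<in> L2_space S"
  shows "L2_norm S f \<le> (\<Sum>i\<in>UNIV. L2_norm S (\<lambda>x. f x $ i))"
proof -
  have "L2_norm S f = L2_set (\<lambda>i. L2_norm S (\<lambda>x. f x $ i)) UNIV"
    unfolding L2_set_def by (subst L2_norm_vec_square[OF assms, symmetric]) simp
  also have "\<dots> \<le> (\<Sum>i\<in>UNIV. L2_norm S (\<lambda>x. f x $ i))"
    by (rule L2_set_le_sum) simp
  finally show ?thesis .
qed

lemma L2_sum:
  assumes "finite I" "\<And>i. i \<in> I \<Longrightarrow> f i \<in> L2_space S"
  shows "(\<lambda>x. \<Sum>i\<in>I. f i x) \<in> L2_space S \<and> L2_norm S (\<lambda>x. \<Sum>i\<in>I. f i x) \<le> (\<Sum>i\<in>I. L2_norm S (f i))"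
  using assms
proof (induction I rule: finite_induct)
  case (insert i I)
  then have "(\<lambda>x. \<Sum>i\<in>I. f i x) \<in> L2_space S" "f i \<in> L2_space S"
    "L2_norm S (\<lambda>x. \<Sum>i\<in>I. f i x) \<le> (\<Sum>i\<in>I. L2_norm S (f i))" by auto
  with insert(1,2) show ?case
    using L2_norm_triangle[of "f i" S "\<lambda>x. \<Sum>i\<in>I. f i x"] L2_space_add[of "f i" S "\<lambda>x. \<Sum>i\<in>I. f i x"] by auto
qed (simp add: L2_space_zero L2_norm_zero)

lemma L2_inner_sum_left:
  assumes "finite I" "\<And>i. i \<in> I \<Longrightarrow> f i \<in> L2_space S" "g \<in> L2_space S"
  shows "L2_inner S (\<lambda>x. \<Sum>i\<in>I. f i x) g = (\<Sum>i\<in>I. L2_inner S (f i) g)"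
  unfolding L2_inner_def inner_sum_left
  by (intro Bochner_Integration.integral_sum L2_inner_integrable assms)

context bounded_open begin

lemma H10_vec_component: "\<xi> \<in> H10_vec \<Omega> \<Longrightarrow> (\<lambda>x. \<xi> x $ i) \<in> H10_space \<Omega>"
  by (simp add: H10_vec_def)

lemma H10_vec_L2: "\<xi> \<in> H10_vec \<Omega> \<Longrightarrow> \<xi> \<in> L2_space \<Omega>"
  by (simp add: L2_space_vec_iff H10_vec_component H10_L2)

lemma H10_vec_diff: "\<xi> \<in> H10_vec \<Omega> \<Longrightarrow> \<zeta> \<in> H10_vec \<Omega> \<Longrightarrow> (\<lambda>x. \<xi> x - \<zeta> x) \<in> H10_vec \<Omega>"
  by (simp add: H10_vec_def H10_space_diff)

lemma H10_vec_weak_partial_L2: "\<xi> \<in> H10_vec \<Omega> \<Longrightarrow> weak_partial \<Omega> j (\<lambda>x. \<xi> x $ i) \<in> L2_space \<Omega>"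
  by (intro H1_weak_partial H10_H1 H10_vec_component)

lemma weak_grad_L2: "\<xi> \<in> H10_vec \<Omega> \<Longrightarrow> weak_grad \<Omega> \<xi> \<in> L2_space \<Omega>"
  by (simp add: L2_space_vec_iff weak_grad_def H10_vec_weak_partial_L2)

lemma weak_div_L2: "\<xi> \<in> H10_vec \<Omega> \<Longrightarrow> weak_div \<Omega> \<xi> \<in> L2_space \<Omega>"
  unfolding weak_div_def[abs_def]
  by (intro L2_sum[THEN conjunct1] H10_vec_weak_partial_L2 finite)

lemma
  assumes "\<xi> \<in> H10_vec \<Omega>" "\<zeta> \<in> H10_vec \<Omega>"
  shows weak_grad_diff_AE: "AE x in lebesgue_on \<Omega>. weak_grad \<Omega> (\<lambda>x. \<xi> x - \<zeta> x) x = weak_grad \<Omega> \<xi> x - weak_grad \<Omega> \<zeta> x"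
    and weak_div_diff_AE: "AE x in lebesgue_on \<Omega>. weak_div \<Omega> (\<lambda>x. \<xi> x - \<zeta> x) x = weak_div \<Omega> \<xi> x - weak_div \<Omega> \<zeta> x"
proof -
  have "AE x in lebesgue_on \<Omega>. \<forall>i j. weak_partial \<Omega> j (\<lambda>x. (\<xi> x - \<zeta> x) $ i) x
      = weak_partial \<Omega> j (\<lambda>x. \<xi> x $ i) x - weak_partial \<Omega> j (\<lambda>x. \<zeta> x $ i) x"
    using assms by (simp add: AE_all_countable weak_partial_diff_AE H10_H1 H10_vec_component)
  then show "AE x in lebesgue_on \<Omega>. weak_grad \<Omega> (\<lambda>x. \<xi> x - \<zeta> x) x = weak_grad \<Omega> \<xi> x - weak_grad \<Omega> \<zeta> x"
    "AE x in lebesgue_on \<Omega>. weak_div \<Omega> (\<lambda>x. \<xi> x - \<zeta> x) x = weak_div \<Omega> \<xi> x - weak_div \<Omega> \<zeta> x"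
    by (eventually_elim; simp add: weak_grad_def weak_div_def vec_eq_iff sum_subtractf)+
qed

lemma weak_partial_le_weak_grad:
  assumes "\<xi> \<in> H10_vec \<Omega>"
  shows "L2_norm \<Omega> (weak_partial \<Omega> j (\<lambda>x. \<xi> x $ i)) \<le> L2_norm \<Omega> (weak_grad \<Omega> \<xi>)"
proof -
  have g: "(\<lambda>x. weak_grad \<Omega> \<xi> x $ i) \<in> L2_space \<Omega>"
    using weak_grad_L2[OF assms] by (simp add: L2_space_vec_iff)
  have "L2_norm \<Omega> (weak_partial \<Omega> j (\<lambda>x. \<xi> x $ i)) = L2_norm \<Omega> (\<lambda>x. weak_grad \<Omega> \<xi> x $ i $ j)"
    by (simp add: weak_grad_def)
  then show ?thesis
    using L2_norm_component_le[OF g, of j] L2_norm_component_le[OF weak_grad_L2[OF assms], of i] by linarith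
qed

lemma poincare_vec:
  obtains R where "R > 0" "\<And>\<xi>. \<xi> \<in> H10_vec \<Omega> \<Longrightarrow> L2_norm \<Omega> \<xi> \<le> R * L2_norm \<Omega> (weak_grad \<Omega> \<xi>)"
proof -
  obtain R where R: "R > 0" "\<And>f i. f \<in> H10_space \<Omega> \<Longrightarrow> L2_norm \<Omega> f \<le> R * L2_norm \<Omega> (weak_partial \<Omega> i f)"
    by (rule poincare) blast
  have "L2_norm \<Omega> \<xi> \<le> (real CARD('n) * R) * L2_norm \<Omega> (weak_grad \<Omega> \<xi>)" if \<xi>: "\<xi> \<in> H10_vec \<Omega>" for \<xi>
  proof -
    have "L2_norm \<Omega> \<xi> \<le> (\<Sum>i\<in>UNIV. L2_norm \<Omega> (\<lambda>x. \<xi> x $ i))"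
      by (rule L2_norm_vec_le_sum[OF H10_vec_L2[OF \<xi>]])
    also have "\<dots> \<le> (\<Sum>i\<in>(UNIV::'n set). R * L2_norm \<Omega> (weak_grad \<Omega> \<xi>))"
      by (intro sum_mono order_trans[OF R(2)[OF H10_vec_component[OF \<xi>]] mult_left_mono]
          weak_partial_le_weak_grad \<xi>) (use R(1) in auto)
    finally show ?thesis by simp
  qed
  then show ?thesis using that[of "real CARD('n) * R"] R(1) by simp
qed

end

section \<open>Convection by a bounded solenoidal field\<close>

locale solenoidal_field = bounded_open \<Omega> for \<Omega> :: "(real^'n) set" +
  fixes c :: "real^'n \<Rightarrow> real^'n"
  assumes c_W1inf: "c \<in> W1inf_vec \<Omega>" and div_c: "AE x in lebesgue_on \<Omega>. weak_div \<Omega> c x = 0"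
begin

lemma c_measurable: "(\<lambda>x. c x $ i) \<in> borel_measurable (lebesgue_on \<Omega>)"
  using c_W1inf by (simp add: W1inf_vec_def Linf_space_def)

lemma c_bounded: obtains M where "M \<ge> 0" "\<And>i. AE x in lebesgue_on \<Omega>. \<bar>c x $ i\<bar> \<le> M"
proof -
  have "\<exists>M. AE x in lebesgue_on \<Omega>. \<bar>c x $ i\<bar> \<le> M" for i
    using c_W1inf by (simp add: W1inf_vec_def Linf_space_def)
  then obtain M where M: "\<And>i. AE x in lebesgue_on \<Omega>. \<bar>c x $ i\<bar> \<le> M i" by metis
  have "AE x in lebesgue_on \<Omega>. \<bar>c x $ i\<bar> \<le> (\<Sum>i\<in>UNIV. \<bar>M i\<bar>)" for i
    using M[of i] by eventually_elim (rule order_trans[OF _ member_le_sum[of i]], auto)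
  then show ?thesis by (rule that[rotated]) (simp add: sum_nonneg)
qed

lemma c_times_L2:
  assumes "f \<in> L2_space \<Omega>"
  shows "(\<lambda>x. c x $ j * f x) \<in> L2_space \<Omega>"
proof -
  obtain M where M: "M \<ge> 0" "\<And>i. AE x in lebesgue_on \<Omega>. \<bar>c x $ i\<bar> \<le> M" by (rule c_bounded) blast
  show ?thesis by (rule L2_mult_bounded(1)[OF c_measurable M(2,1) assms])
qed

lemma c_weak_partial: "has_weak_partial \<Omega> j (\<lambda>x. c x $ i) (weak_partial \<Omega> j (\<lambda>x. c x $ i))"
proof -
  obtain g where "has_weak_partial \<Omega> j (\<lambda>x. c x $ i) g" using c_W1inf by (auto simp: W1inf_vec_def)
  then show ?thesis by (rule has_weak_partial_weak_partial)
qed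

text \<open>The weak derivatives of \<open>c\<close> move the gradient from the test function to
  \<open>c\<close>, where the terms sum to the divergence, which is zero.\<close>

lemma integral_c_grad_test_function:
  assumes \<phi>: "\<phi> \<in> test_functions \<Omega>"
  shows "(\<Sum>j\<in>UNIV. \<integral>x. c x $ j * partial j \<phi> x \<partial>lebesgue_on \<Omega>) = 0"
proof -
  let ?d = "\<lambda>j. weak_partial \<Omega> j (\<lambda>x. c x $ j)"
  have "(\<Sum>j\<in>UNIV. \<integral>x. c x $ j * partial j \<phi> x \<partial>lebesgue_on \<Omega>)
      = (\<Sum>j\<in>UNIV. - (\<integral>x. ?d j x * \<phi> x \<partial>lebesgue_on \<Omega>))"
    using c_weak_partial \<phi> unfolding has_weak_partial_def by (intro sum.cong refl) blast
  also have "\<dots> = - (\<integral>x. (\<Sum>j\<in>UNIV. ?d j x * \<phi> x) \<partial>lebesgue_on \<Omega>)"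
    unfolding sum_negf
    by (subst Bochner_Integration.integral_sum)
      (use c_weak_partial in \<open>auto simp: has_weak_partial_def intro!: locally_integrable_mult_test_function \<phi>\<close>)
  also have "(\<integral>x. (\<Sum>j\<in>UNIV. ?d j x * \<phi> x) \<partial>lebesgue_on \<Omega>) = 0"
    by (rule integral_eq_zero_AE)
      (use div_c in \<open>auto simp: weak_div_def sum_distrib_right[symmetric] elim!: eventually_mono\<close>)
  finally show ?thesis by simp
qed

text \<open>For test functions the left-hand side is the integral of \<open>c\<close> against the
  gradient of their product, which is zero because the product is again a test function. Density
  extends the identity to \<open>H10_space\<close>, where the product need not lie in the
  space.\<close>

lemma convection_skew_scalar:
  assumes f: "f \<in> H10_space \<Omega>" and g: "g \<in> H10_space \<Omega>"
  shows "(\<Sum>j\<in>UNIV. L2_inner \<Omega> (\<lambda>x. c x $ j * weak_partial \<Omega> j f x) g)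
       + (\<Sum>j\<in>UNIV. L2_inner \<Omega> (\<lambda>x. c x $ j * weak_partial \<Omega> j g x) f) = 0"
proof -
  obtain \<phi> where \<phi>: "\<And>n::nat. \<phi> n \<in> test_functions \<Omega>"
    and lim\<phi>: "(\<lambda>n. L2_norm \<Omega> (\<lambda>x. \<phi> n x - f x)) \<longlonglongrightarrow> 0"
      "\<And>i. (\<lambda>n. L2_norm \<Omega> (\<lambda>x. partial i (\<phi> n) x - weak_partial \<Omega> i f x)) \<longlonglongrightarrow> 0"
    by (rule H10E[OF f]) blast
  obtain \<psi> where \<psi>: "\<And>n::nat. \<psi> n \<in> test_functions \<Omega>"
    and lim\<psi>: "(\<lambda>n. L2_norm \<Omega> (\<lambda>x. \<psi> n x - g x)) \<longlonglongrightarrow> 0"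
      "\<And>i. (\<lambda>n. L2_norm \<Omega> (\<lambda>x. partial i (\<psi> n) x - weak_partial \<Omega> i g x)) \<longlonglongrightarrow> 0"
    by (rule H10E[OF g]) blast
  obtain M where M: "M \<ge> 0" "\<And>i. AE x in lebesgue_on \<Omega>. \<bar>c x $ i\<bar> \<le> M" by (rule c_bounded) blast
  \<comment> \<open>Boundedness of \<open>c\<close> makes multiplication by a component continuous
    in the L2 norm, so each summand converges.\<close>
  have lim: "(\<lambda>n. L2_inner \<Omega> (\<lambda>x. c x $ j * u n x) (v n)) \<longlonglongrightarrow> L2_inner \<Omega> (\<lambda>x. c x $ j * u' x) v'"
    if "\<And>n. u n \<in> L2_space \<Omega>" "u' \<in> L2_space \<Omega>" "\<And>n. v n \<in> L2_space \<Omega>" "v' \<in> L2_space \<Omega>"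
      and lu: "(\<lambda>n::nat. L2_norm \<Omega> (\<lambda>x. u n x - u' x)) \<longlonglongrightarrow> 0"
      and lv: "(\<lambda>n. L2_norm \<Omega> (\<lambda>x. v n x - v' x)) \<longlonglongrightarrow> 0" for j u u' v v'
  proof (rule L2_inner_tendsto[OF c_times_L2 c_times_L2 _ _ _ lv])
    show "(\<lambda>n. L2_norm \<Omega> (\<lambda>x. c x $ j * u n x - c x $ j * u' x)) \<longlonglongrightarrow> 0"
    proof (rule tendsto_sandwich[OF _ _ tendsto_const])
      show "(\<lambda>n. M * L2_norm \<Omega> (\<lambda>x. u n x - u' x)) \<longlonglongrightarrow> 0"
        using tendsto_mult[OF tendsto_const lu, of M] by simp
      have "L2_norm \<Omega> (\<lambda>x. c x $ j * (u n x - u' x)) \<le> M * L2_norm \<Omega> (\<lambda>x. u n x - u' x)" for n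
        by (rule L2_mult_bounded(2)[OF c_measurable M(2,1) L2_space_diff]) (use that in auto)
      then show "\<forall>\<^sub>F n in sequentially. L2_norm \<Omega> (\<lambda>x. c x $ j * u n x - c x $ j * u' x) \<le> M * L2_norm \<Omega> (\<lambda>x. u n x - u' x)"
        by (simp add: right_diff_distrib)
    qed auto
  qed (use that in auto)
  note L2s = test_functions_L2[OF \<phi> domain_lebesgue] test_functions_L2[OF \<psi> domain_lebesgue]
    test_functions_L2[OF test_functions_partial[OF \<phi>] domain_lebesgue]
    test_functions_L2[OF test_functions_partial[OF \<psi>] domain_lebesgue]
    H10_L2[OF f] H10_L2[OF g] H1_weak_partial(2)[OF H10_H1[OF f]] H1_weak_partial(2)[OF H10_H1[OF g]]
  let ?s = "\<lambda>n. (\<Sum>j\<in>UNIV. L2_inner \<Omega> (\<lambda>x. c x $ j * partial j (\<phi> n) x) (\<psi> n))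
       + (\<Sum>j\<in>UNIV. L2_inner \<Omega> (\<lambda>x. c x $ j * partial j (\<psi> n) x) (\<phi> n))"
  have "?s n = 0" for n
  proof -
    have eq: "partial j (\<lambda>x. \<phi> n x * \<psi> n x) x = \<phi> n x * partial j (\<psi> n) x + partial j (\<phi> n) x * \<psi> n x" for j x
      by (rule partial_mult) (intro test_functions_differentiable[OF \<phi>] test_functions_differentiable[OF \<psi>])+
    have "?s n = (\<Sum>j\<in>UNIV. \<integral>x. c x $ j * partial j (\<lambda>x. \<phi> n x * \<psi> n x) x \<partial>lebesgue_on \<Omega>)"
      unfolding sum.distrib[symmetric]
    proof (rule sum.cong[OF refl])
      fix j
      have "L2_inner \<Omega> (\<lambda>x. c x $ j * partial j (\<phi> n) x) (\<psi> n) + L2_inner \<Omega> (\<lambda>x. c x $ j * partial j (\<psi> n) x) (\<phi> n)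
        = (\<integral>x. (c x $ j * partial j (\<phi> n) x) \<bullet> \<psi> n x + (c x $ j * partial j (\<psi> n) x) \<bullet> \<phi> n x \<partial>lebesgue_on \<Omega>)"
        unfolding L2_inner_def
        by (intro Bochner_Integration.integral_add[symmetric] L2_inner_integrable c_times_L2 L2s)
      then show "L2_inner \<Omega> (\<lambda>x. c x $ j * partial j (\<phi> n) x) (\<psi> n) + L2_inner \<Omega> (\<lambda>x. c x $ j * partial j (\<psi> n) x) (\<phi> n)
        = (\<integral>x. c x $ j * partial j (\<lambda>x. \<phi> n x * \<psi> n x) x \<partial>lebesgue_on \<Omega>)"
        by (simp add: eq algebra_simps)
    qed
    also have "\<dots> = 0"
      by (intro integral_c_grad_test_function test_functions_mult \<psi> test_functions_C_k[OF \<phi>])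
    finally show ?thesis .
  qed
  moreover have "?s \<longlonglongrightarrow> (\<Sum>j\<in>UNIV. L2_inner \<Omega> (\<lambda>x. c x $ j * weak_partial \<Omega> j f x) g)
       + (\<Sum>j\<in>UNIV. L2_inner \<Omega> (\<lambda>x. c x $ j * weak_partial \<Omega> j g x) f)"
    by (intro tendsto_add tendsto_sum lim L2s lim\<phi> lim\<psi>)
  ultimately show ?thesis by (simp add: LIMSEQ_const_iff)
qed

lemma convect_component: "convect \<Omega> c \<xi> x $ i = (\<Sum>j\<in>UNIV. c x $ j * weak_partial \<Omega> j (\<lambda>z. \<xi> z $ i) x)"
  by (simp add: convect_def weak_grad_def matrix_vector_mult_def mult.commute)

lemma convect_L2:
  assumes "\<xi> \<in> H10_vec \<Omega>"
  shows "convect \<Omega> c \<xi> \<in> L2_space \<Omega>"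
  unfolding L2_space_vec_iff convect_component
  by (intro allI L2_sum[THEN conjunct1] c_times_L2 H10_vec_weak_partial_L2 assms finite)

lemma L2_inner_convect:
  assumes "\<xi> \<in> H10_vec \<Omega>" "\<zeta> \<in> L2_space \<Omega>"
  shows "L2_inner \<Omega> (convect \<Omega> c \<xi>) \<zeta>
    = (\<Sum>i\<in>UNIV. \<Sum>j\<in>UNIV. L2_inner \<Omega> (\<lambda>x. c x $ j * weak_partial \<Omega> j (\<lambda>z. \<xi> z $ i) x) (\<lambda>x. \<zeta> x $ i))"
  unfolding L2_inner_vec[OF convect_L2[OF assms(1)] assms(2)] convect_component
  by (intro sum.cong refl L2_inner_sum_left c_times_L2 H10_vec_weak_partial_L2 finite assms(1)
      assms(2)[unfolded L2_space_vec_iff, rule_format])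

lemma convection_skew:
  assumes "\<xi> \<in> H10_vec \<Omega>" "\<zeta> \<in> H10_vec \<Omega>"
  shows "L2_inner \<Omega> (convect \<Omega> c \<xi>) \<zeta> = - L2_inner \<Omega> (convect \<Omega> c \<zeta>) \<xi>"
proof -
  have "L2_inner \<Omega> (convect \<Omega> c \<xi>) \<zeta> + L2_inner \<Omega> (convect \<Omega> c \<zeta>) \<xi> = 0"
    unfolding L2_inner_convect[OF assms(1) H10_vec_L2[OF assms(2)]] L2_inner_convect[OF assms(2) H10_vec_L2[OF assms(1)]]
      sum.distrib[symmetric]
    by (rule sum.neutral) (use convection_skew_scalar[OF H10_vec_component[OF assms(1)] H10_vec_component[OF assms(2)]]
        in \<open>simp add: sum.distrib\<close>)
  then show ?thesis by linarith
qed

lemma convect_bounded: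
  obtains M where "M \<ge> 0" "\<And>\<xi>. \<xi> \<in> H10_vec \<Omega> \<Longrightarrow> L2_norm \<Omega> (convect \<Omega> c \<xi>) \<le> M * L2_norm \<Omega> (weak_grad \<Omega> \<xi>)"
proof -
  obtain M where M: "M \<ge> 0" "\<And>i. AE x in lebesgue_on \<Omega>. \<bar>c x $ i\<bar> \<le> M" by (rule c_bounded) blast
  \<comment> \<open>A crude constant: each entry of the gradient is bounded by the whole gradient,
    once for every pair of indices.\<close>
  have "L2_norm \<Omega> (convect \<Omega> c \<xi>) \<le> (real CARD('n) * (real CARD('n) * M)) * L2_norm \<Omega> (weak_grad \<Omega> \<xi>)"
    if \<xi>: "\<xi> \<in> H10_vec \<Omega>" for \<xi>
  proof -
    have "L2_norm \<Omega> (convect \<Omega> c \<xi>) \<le> (\<Sum>i\<in>UNIV. L2_norm \<Omega> (\<lambda>x. convect \<Omega> c \<xi> x $ i))"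
      by (rule L2_norm_vec_le_sum[OF convect_L2[OF \<xi>]])
    also have "\<dots> \<le> (\<Sum>i\<in>(UNIV::'n set). \<Sum>j\<in>(UNIV::'n set). M * L2_norm \<Omega> (weak_grad \<Omega> \<xi>))"
      unfolding convect_component
    proof (rule sum_mono)
      fix i
      let ?f = "\<lambda>j x. c x $ j * weak_partial \<Omega> j (\<lambda>z. \<xi> z $ i) x"
      have "L2_norm \<Omega> (\<lambda>x. \<Sum>j\<in>UNIV. ?f j x) \<le> (\<Sum>j\<in>UNIV. L2_norm \<Omega> (?f j))"
        using L2_sum[of UNIV ?f \<Omega>] c_times_L2 H10_vec_weak_partial_L2[OF \<xi>] by simp
      also have "\<dots> \<le> (\<Sum>j\<in>(UNIV::'n set). M * L2_norm \<Omega> (weak_grad \<Omega> \<xi>))"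
        by (intro sum_mono order_trans[OF L2_mult_bounded(2)[OF c_measurable M(2,1) H10_vec_weak_partial_L2[OF \<xi>]]]
            mult_left_mono weak_partial_le_weak_grad \<xi> M(1))
      finally show "L2_norm \<Omega> (\<lambda>x. \<Sum>j\<in>UNIV. ?f j x) \<le> (\<Sum>j\<in>(UNIV::'n set). M * L2_norm \<Omega> (weak_grad \<Omega> \<xi>))" .
    qed
    finally show ?thesis by (simp add: mult.assoc)
  qed
  then show ?thesis using that[of "real CARD('n) * (real CARD('n) * M)"] M(1) by simp
qed

section \<open>The bilinear forms: transposition, coercivity and boundedness\<close>

lemma form_A_expand:
  assumes "\<xi> \<in> H10_vec \<Omega>" "\<zeta> \<in> H10_vec \<Omega>"
  shows "form_A \<Omega> \<epsilon> \<kappa> c \<xi> \<zeta> = \<epsilon> * L2_inner \<Omega> (weak_grad \<Omega> \<xi>) (weak_grad \<Omega> \<zeta>)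
    + \<kappa> * L2_inner \<Omega> \<xi> \<zeta> + L2_inner \<Omega> (convect \<Omega> c \<xi>) \<zeta>"
  unfolding form_A_def
  by (simp add: L2_inner_add_left L2_space_scaleR H10_vec_L2 convect_L2 assms L2_inner_scaleR_left)

lemma form_C_expand:
  assumes "\<xi> \<in> H10_vec \<Omega>" "\<zeta> \<in> H10_vec \<Omega>"
  shows "form_C \<Omega> \<epsilon> \<kappa> c \<xi> \<zeta> = \<epsilon> * L2_inner \<Omega> (weak_grad \<Omega> \<xi>) (weak_grad \<Omega> \<zeta>)
    + \<kappa> * L2_inner \<Omega> \<xi> \<zeta> - L2_inner \<Omega> (convect \<Omega> c \<xi>) \<zeta>"
  unfolding form_C_def
  by (simp add: L2_inner_diff_left L2_space_scaleR H10_vec_L2 convect_L2 assms L2_inner_scaleR_left)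

lemma form_C_eq_form_A:
  assumes "\<xi> \<in> H10_vec \<Omega>" "\<zeta> \<in> H10_vec \<Omega>"
  shows "form_C \<Omega> \<epsilon> \<kappa> c \<xi> \<zeta> = form_A \<Omega> \<epsilon> \<kappa> c \<zeta> \<xi>"
  using assms convection_skew[OF assms]
  by (simp add: form_A_expand form_C_expand L2_inner_commute[of \<Omega> \<xi> \<zeta>]
      L2_inner_commute[of \<Omega> "weak_grad \<Omega> \<xi>" "weak_grad \<Omega> \<zeta>"])

lemma form_A_coercive:
  assumes "\<xi> \<in> H10_vec \<Omega>"
  shows "form_A \<Omega> \<epsilon> \<kappa> c \<xi> \<xi> = \<epsilon> * (L2_norm \<Omega> (weak_grad \<Omega> \<xi>))\<^sup>2 + \<kappa> * (L2_norm \<Omega> \<xi>)\<^sup>2"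
proof -
  have "L2_inner \<Omega> (convect \<Omega> c \<xi>) \<xi> = 0" using convection_skew[OF assms assms] by linarith
  then show ?thesis by (simp add: form_A_expand assms L2_norm_square)
qed

text \<open>The gradients are chosen representatives, and that of a difference agrees with the
  difference of the gradients only almost everywhere. The integrals have to be compared, as the
  integrands cannot be rewritten.\<close>

lemma form_A_diff_left:
  assumes "\<xi> \<in> H10_vec \<Omega>" "\<xi>' \<in> H10_vec \<Omega>" "\<zeta> \<in> H10_vec \<Omega>"
  shows "form_A \<Omega> \<epsilon> \<kappa> c (\<lambda>x. \<xi> x - \<xi>' x) \<zeta> = form_A \<Omega> \<epsilon> \<kappa> c \<xi> \<zeta> - form_A \<Omega> \<epsilon> \<kappa> c \<xi>' \<zeta>"
proof -
  note d = H10_vec_diff[OF assms(1,2)]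
  have 1: "L2_inner \<Omega> (weak_grad \<Omega> (\<lambda>x. \<xi> x - \<xi>' x)) (weak_grad \<Omega> \<zeta>)
      = L2_inner \<Omega> (\<lambda>x. weak_grad \<Omega> \<xi> x - weak_grad \<Omega> \<xi>' x) (weak_grad \<Omega> \<zeta>)"
    by (rule L2_inner_cong_AE) (auto intro: weak_grad_L2 d assms L2_space_diff weak_grad_diff_AE)
  have 2: "L2_inner \<Omega> (convect \<Omega> c (\<lambda>x. \<xi> x - \<xi>' x)) \<zeta>
      = L2_inner \<Omega> (\<lambda>x. convect \<Omega> c \<xi> x - convect \<Omega> c \<xi>' x) \<zeta>"
  proof (rule L2_inner_cong_AE)
    show "AE x in lebesgue_on \<Omega>. convect \<Omega> c (\<lambda>x. \<xi> x - \<xi>' x) x = convect \<Omega> c \<xi> x - convect \<Omega> c \<xi>' x"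
      using weak_grad_diff_AE[OF assms(1,2)]
      by eventually_elim (simp add: convect_def matrix_vector_mult_diff_rdistrib)
  qed (auto intro: convect_L2 d assms L2_space_diff H10_vec_L2)
  show ?thesis
    by (simp add: form_A_expand assms d 1 2 L2_inner_diff_left weak_grad_L2 convect_L2 H10_vec_L2 algebra_simps)
qed

lemma form_A_bounded:
  assumes "\<epsilon> \<ge> 0" "\<kappa> \<ge> 0"
  obtains K where "K \<ge> 0" "\<And>\<xi> \<zeta>. \<xi> \<in> H10_vec \<Omega> \<Longrightarrow> \<zeta> \<in> H10_vec \<Omega> \<Longrightarrow>
    \<bar>form_A \<Omega> \<epsilon> \<kappa> c \<xi> \<zeta>\<bar> \<le> K * L2_norm \<Omega> (weak_grad \<Omega> \<xi>) * L2_norm \<Omega> (weak_grad \<Omega> \<zeta>)"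
proof -
  obtain M where M: "M \<ge> 0" "\<And>\<xi>. \<xi> \<in> H10_vec \<Omega> \<Longrightarrow> L2_norm \<Omega> (convect \<Omega> c \<xi>) \<le> M * L2_norm \<Omega> (weak_grad \<Omega> \<xi>)"
    by (rule convect_bounded) blast
  obtain R where R: "R > 0" "\<And>\<xi>. \<xi> \<in> H10_vec \<Omega> \<Longrightarrow> L2_norm \<Omega> \<xi> \<le> R * L2_norm \<Omega> (weak_grad \<Omega> \<xi>)"
    by (rule poincare_vec) blast
  \<comment> \<open>The three contributions stem from diffusion, reaction and convection; each
    factor without a gradient costs one Poincare constant \<open>R\<close>.\<close>
  have "\<bar>form_A \<Omega> \<epsilon> \<kappa> c \<xi> \<zeta>\<bar> \<le> (\<epsilon> + \<kappa> * R * R + M * R) * L2_norm \<Omega> (weak_grad \<Omega> \<xi>) * L2_norm \<Omega> (weak_grad \<Omega> \<zeta>)"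
    if \<xi>: "\<xi> \<in> H10_vec \<Omega>" and \<zeta>: "\<zeta> \<in> H10_vec \<Omega>" for \<xi> \<zeta>
  proof -
    let ?X = "L2_norm \<Omega> (weak_grad \<Omega> \<xi>)" and ?Z = "L2_norm \<Omega> (weak_grad \<Omega> \<zeta>)"
    have 1: "\<bar>L2_inner \<Omega> (weak_grad \<Omega> \<xi>) (weak_grad \<Omega> \<zeta>)\<bar> \<le> ?X * ?Z"
      by (rule L2_Cauchy_Schwarz[OF weak_grad_L2[OF \<xi>] weak_grad_L2[OF \<zeta>]])
    have 2: "\<bar>L2_inner \<Omega> \<xi> \<zeta>\<bar> \<le> (R * ?X) * (R * ?Z)"
      by (rule order_trans[OF L2_Cauchy_Schwarz[OF H10_vec_L2[OF \<xi>] H10_vec_L2[OF \<zeta>]]])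
        (intro mult_mono R(2) \<xi> \<zeta> mult_nonneg_nonneg L2_norm_nonneg less_imp_le[OF R(1)])
    have 3: "\<bar>L2_inner \<Omega> (convect \<Omega> c \<xi>) \<zeta>\<bar> \<le> (M * ?X) * (R * ?Z)"
      by (rule order_trans[OF L2_Cauchy_Schwarz[OF convect_L2[OF \<xi>] H10_vec_L2[OF \<zeta>]]])
        (intro mult_mono R(2) M \<xi> \<zeta> mult_nonneg_nonneg L2_norm_nonneg)
    have "\<bar>form_A \<Omega> \<epsilon> \<kappa> c \<xi> \<zeta>\<bar> \<le> \<epsilon> * \<bar>L2_inner \<Omega> (weak_grad \<Omega> \<xi>) (weak_grad \<Omega> \<zeta>)\<bar>
        + \<kappa> * \<bar>L2_inner \<Omega> \<xi> \<zeta>\<bar> + \<bar>L2_inner \<Omega> (convect \<Omega> c \<xi>) \<zeta>\<bar>"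
      unfolding form_A_expand[OF \<xi> \<zeta>] using assms
      by (intro order_trans[OF abs_triangle_ineq] add_mono) (auto simp: abs_mult)
    also have "\<dots> \<le> \<epsilon> * (?X * ?Z) + \<kappa> * ((R * ?X) * (R * ?Z)) + (M * ?X) * (R * ?Z)"
      by (intro add_mono mult_left_mono 1 2 3 assms)
    finally show ?thesis by (simp add: algebra_simps)
  qed
  then show ?thesis using that[of "\<epsilon> + \<kappa> * R * R + M * R"] R(1) M(1) assms by auto
qed

end

section \<open>Additivity over the mesh\<close>

text \<open>Excludes slits, that is, frontier points interior to the closure: below the Lipschitz
  graph there are exterior points arbitrarily close to any frontier point. The mesh sees only the
  closure of \<Omega>, so this inclusion lets it control the frontier of \<Omega> itself.\<close>

lemma lipschitz_boundary_frontier_subset: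
  assumes op: "open \<Omega>" and lip: "has_lipschitz_boundary \<Omega>"
  shows "frontier \<Omega> \<subseteq> frontier (closure \<Omega>)"
proof
  fix x assume x: "x \<in> frontier \<Omega>"
  then have xc: "x \<in> closure \<Omega>" and xn: "x \<notin> \<Omega>"
    using op by (auto simp: frontier_def interior_open)
  obtain r \<nu> \<gamma> L where r: "r > 0" and \<nu>: "norm \<nu> = 1"
    and \<gamma>: "L-lipschitz_on {z. z \<bullet> \<nu> = 0} (\<gamma> :: _ \<Rightarrow> real)"
    and epi: "\<Omega> \<inter> ball x r = {y \<in> ball x r. \<gamma> (y - (y \<bullet> \<nu>) *\<^sub>R \<nu>) < y \<bullet> \<nu>}"
    using lip x unfolding has_lipschitz_boundary_def by blast
  have \<nu>1: "\<nu> \<bullet> \<nu> = 1" using \<nu> by (simp add: dot_square_norm)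
  \<comment> \<open>The signed depth below the graph: negative in \<Omega> near \<open>x\<close>,
    positive strictly below the graph.\<close>
  let ?g = "\<lambda>z. \<gamma> (z - (z \<bullet> \<nu>) *\<^sub>R \<nu>) - z \<bullet> \<nu>"
  have cont: "continuous_on UNIV ?g"
    by (intro continuous_on_diff continuous_on_compose2[OF lipschitz_on_continuous_on[OF \<gamma>]] continuous_intros)
      (auto simp: inner_diff_left \<nu>1)
  have opn: "open (ball x r \<inter> {z. ?g z > 0})"
    by (intro open_Int open_ball open_Collect_less cont continuous_on_const)
  have "(ball x r \<inter> {z. ?g z > 0}) \<inter> \<Omega> = {}"
  proof (rule equals0I)
    fix z assume z: "z \<in> (ball x r \<inter> {z. ?g z > 0}) \<inter> \<Omega>"
    then have "z \<in> \<Omega> \<inter> ball x r" by blast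
    then show False unfolding epi using z by simp
  qed
  then have disj: "(ball x r \<inter> {z. ?g z > 0}) \<inter> closure \<Omega> = {}"
    by (simp only: open_Int_closure_eq_empty[OF opn])
  have gx: "?g x \<ge> 0" using epi xn r by force
  have "x \<notin> interior (closure \<Omega>)"
  proof
    assume "x \<in> interior (closure \<Omega>)"
    then obtain s where s: "s > 0" "ball x s \<subseteq> closure \<Omega>" by (auto simp: mem_interior)
    \<comment> \<open>Moving from \<open>x\<close> by \<open>t\<close> against \<nu> keeps the foot
      point on the hyperplane and increases the depth by \<open>t\<close>, while staying in both
      balls.\<close>
    define t where "t = min r s / 2"
    have t: "t > 0" "t < r" "t < s" using r s by (auto simp: t_def)
    let ?y = "x - t *\<^sub>R \<nu>"
    have "?y \<in> ball x r" "?y \<in> ball x s" using t \<nu> by (auto simp: dist_norm)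
    moreover have eq: "?y - (?y \<bullet> \<nu>) *\<^sub>R \<nu> = x - (x \<bullet> \<nu>) *\<^sub>R \<nu>"
      by (simp add: inner_diff_left \<nu>1 algebra_simps)
    have "?y \<bullet> \<nu> = x \<bullet> \<nu> - t" by (simp add: inner_diff_left \<nu>1)
    then have "?g ?y > 0" unfolding eq using gx t by linarith
    ultimately show False using disj s(2) by blast
  qed
  then show "x \<in> frontier (closure \<Omega>)" using xc by (simp add: frontier_def)
qed

text \<open>The frontier of the closure is covered by the frontiers of the finitely many elements,
  and the frontier of a convex set is negligible.\<close>

lemma conforming_mesh_negligible_frontier:
  assumes "open \<Omega>" "has_lipschitz_boundary \<Omega>" and mesh: "conforming_mesh \<Omega> \<T>"
  shows "negligible (frontier \<Omega>)"
proof (rule negligible_subset)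
  have fin: "finite \<T>" using mesh by (simp add: conforming_mesh_def triangulation_def)
  show "frontier \<Omega> \<subseteq> (\<Union>K\<in>\<T>. frontier K)"
    using lipschitz_boundary_frontier_subset[OF assms(1,2)] frontier_Union_subset[OF fin] mesh
    by (auto simp: conforming_mesh_def)
  show "negligible (\<Union>K\<in>\<T>. frontier K)"
    using mesh fin by (auto simp: conforming_mesh_def intro!: negligible_Union negligible_convex_frontier convex_simplex)
qed

text \<open>The intersection is a face of both simplices. With interior points it would have full
  dimension and coincide with either simplex, so the two would be equal; a convex set without
  interior is negligible.\<close>

lemma conforming_mesh_negligible_Int:
  fixes \<T> :: "(real^'n) set set"
  assumes mesh: "conforming_mesh \<Omega> \<T>" and K: "K \<in> \<T>" "K' \<in> \<T>" "K \<noteq> K'"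
  shows "negligible (K \<inter> K')"
proof -
  have S: "int CARD('n) simplex K" "int CARD('n) simplex K'" and face: "K \<inter> K' face_of K" "K' \<inter> K face_of K'"
    using mesh K unfolding conforming_mesh_def triangulation_def by blast+
  have "interior (K \<inter> K') = {}"
  proof (rule ccontr)
    assume "interior (K \<inter> K') \<noteq> {}"
    then have "aff_dim (K \<inter> K') = int CARD('n)"
      using aff_dim_nonempty_interior by fastforce
    then have "K \<inter> K' = K" "K' \<inter> K = K'"
      using face_of_aff_dim_lt[OF convex_simplex[OF S(1)] face(1)] face_of_aff_dim_lt[OF convex_simplex[OF S(2)] face(2)]
        aff_dim_simplex[OF S(1)] aff_dim_simplex[OF S(2)] by (auto simp: Int_commute)
    with K(3) show False by blast
  qed
  then show ?thesis
    using negligible_convex_interior[of "K \<inter> K'"] convex_Int convex_simplex S by blast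
qed

lemma conforming_mesh_sum_integral:
  fixes h :: "real^'n \<Rightarrow> real"
  assumes op: "open \<Omega>" and lip: "has_lipschitz_boundary \<Omega>" and mesh: "conforming_mesh \<Omega> \<T>"
    and h: "integrable (lebesgue_on \<Omega>) h"
  shows "(\<Sum>K\<in>\<T>. \<integral>x. h x \<partial>lebesgue_on K) = (\<integral>x. h x \<partial>lebesgue_on \<Omega>)"
proof -
  have fin: "finite \<T>" using mesh by (simp add: conforming_mesh_def triangulation_def)
  have cov: "\<Union>\<T> = closure \<Omega>" using mesh by (simp add: conforming_mesh_def)
  have msO: "\<Omega> \<in> sets lebesgue" using op by (simp add: borel_open)
  have ms: "K \<in> sets lebesgue" if "K \<in> \<T>" for K
    using mesh that compact_simplex by (auto simp: conforming_mesh_def intro: compact_lebesgue)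
  \<comment> \<open>Off \<open>N\<close> a point of \<Omega> lies in exactly one element, and a
    point outside \<Omega> in none; there the indicators of the elements add up to that of
    \<Omega>.\<close>
  define N where "N = frontier \<Omega> \<union> (\<Union>(K, K')\<in>{(K, K'). K \<in> \<T> \<and> K' \<in> \<T> \<and> K \<noteq> K'}. K \<inter> K')"
  have finP: "finite {(K, K'). K \<in> \<T> \<and> K' \<in> \<T> \<and> K \<noteq> K'}"
    by (rule finite_subset[of _ "\<T> \<times> \<T>"]) (use fin in auto)
  have "negligible N"
    unfolding N_def
    by (intro negligible_Un conforming_mesh_negligible_frontier[OF op lip mesh] negligible_Union finite_imageI finP)
      (auto intro: conforming_mesh_negligible_Int[OF mesh])
  then have aeN: "AE x in lebesgue. x \<notin> N"
    by (simp add: negligible_iff_null_sets AE_not_in)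
  have hO: "set_integrable lebesgue \<Omega> h"
    using h msO by (simp add: set_integrable_def integrable_restrict_space)
  have int: "integrable lebesgue (\<lambda>x. indicator K x * h x)" if K: "K \<in> \<T>" for K
  proof -
    have i: "integrable lebesgue (\<lambda>x. indicator (K \<inter> \<Omega>) x * h x)"
      using set_integrable_subset[OF hO, of "K \<inter> \<Omega>"] ms[OF K] msO by (simp add: set_integrable_def sets.Int)
    \<comment> \<open>\<open>h\<close> is controlled only on \<Omega>, whereas a closed element may
      meet the frontier. Dropping that null part yields integrability on the whole element, again by
      completeness.\<close>
    have ae: "AE x in lebesgue. indicator (K \<inter> \<Omega>) x * h x = indicator K x * h x"
      using aeN
    proof eventually_elim
      case (elim x)
      then show ?case
        using K cov op by (auto simp: N_def indicator_def frontier_def interior_open)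
    qed
    show ?thesis
      by (rule integrable_cong_AE_imp[OF i borel_measurable_AE[OF borel_measurable_integrable[OF i] ae]])
        (use ae in \<open>auto elim!: eventually_mono\<close>)
  qed
  have "(\<Sum>K\<in>\<T>. \<integral>x. h x \<partial>lebesgue_on K) = (\<Sum>K\<in>\<T>. \<integral>x. indicator K x * h x \<partial>lebesgue)"
    by (intro sum.cong refl) (simp add: integral_restrict_space ms)
  also have "\<dots> = (\<integral>x. (\<Sum>K\<in>\<T>. indicator K x * h x) \<partial>lebesgue)"
    by (rule Bochner_Integration.integral_sum[symmetric]) (rule int)
  also have "\<dots> = (\<integral>x. indicator \<Omega> x * h x \<partial>lebesgue)"
  proof (rule integral_cong_AE)
    show "(\<lambda>x. \<Sum>K\<in>\<T>. indicator K x * h x) \<in> borel_measurable lebesgue"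
      by (intro borel_measurable_sum borel_measurable_integrable int)
    show "(\<lambda>x. indicator \<Omega> x * h x) \<in> borel_measurable lebesgue"
      using borel_measurable_integrable[OF hO[unfolded set_integrable_def]] by simp
    show "AE x in lebesgue. (\<Sum>K\<in>\<T>. indicator K x * h x) = indicator \<Omega> x * h x"
      using aeN
    proof eventually_elim
      case (elim x)
      show ?case
      proof (cases "x \<in> \<Omega>")
        case True
        then obtain K where K: "K \<in> \<T>" "x \<in> K" using cov closure_subset[of \<Omega>] by blast
        have "indicator K' x * h x = (if K' = K then h x else 0)" if "K' \<in> \<T>" for K'
          using elim K that by (auto simp: N_def indicator_def)
        then have "(\<Sum>K\<in>\<T>. indicator K x * h x) = (\<Sum>K'\<in>\<T>. if K' = K then h x else 0)"
          by (intro sum.cong) auto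
        with True K fin show ?thesis by simp
      next
        case False
        then have "x \<notin> closure \<Omega>" using elim op by (auto simp: N_def frontier_def interior_open)
        then have "x \<notin> K" if "K \<in> \<T>" for K using that cov by blast
        with False show ?thesis by (simp add: sum.neutral)
      qed
    qed
  qed
  also have "\<dots> = (\<integral>x. h x \<partial>lebesgue_on \<Omega>)"
    by (simp add: integral_restrict_space msO)
  finally show ?thesis .
qed

lemma conforming_mesh_sum_L2_norm:
  fixes f :: "real^'n \<Rightarrow> 'b::euclidean_space"
  assumes "open \<Omega>" "has_lipschitz_boundary \<Omega>" "conforming_mesh \<Omega> \<T>" and f: "f \<in> L2_space \<Omega>"
  shows "(\<Sum>K\<in>\<T>. (L2_norm K f)\<^sup>2) = (L2_norm \<Omega> f)\<^sup>2"
  using conforming_mesh_sum_integral[OF assms(1-3) L2_spaceD(2)[OF f]] by (simp add: L2_norm_def)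

section \<open>Stability of the state and adjoint equations\<close>

lemma L2_zero_mean_diff:
  assumes "\<phi> \<in> L2_zero_mean \<Omega>" "\<psi> \<in> L2_zero_mean \<Omega>" "bounded \<Omega>" "open \<Omega>"
  shows "(\<lambda>x. \<phi> x - \<psi> x) \<in> L2_zero_mean \<Omega>"
proof -
  interpret bounded_open \<Omega> using assms by unfold_locales
  have int: "integrable (lebesgue_on \<Omega>) f" if "f \<in> L2_space \<Omega>" for f :: "real^'a \<Rightarrow> real"
    using L2_inner_integrable[OF that AE_bounded_L2[of "\<lambda>x. 1" 1]] by simp
  show ?thesis
    using assms(1,2) by (auto simp: L2_zero_mean_def int L2_space_diff)
qed

section \<open>Projection onto the box constraints\<close>

lemma box_projection_in_U_ad:
  assumes "bounded \<Omega>" "open \<Omega>" and ab: "\<forall>i. a $ i < b $ i" and \<zeta>: "\<zeta> \<in> borel_measurable (lebesgue_on \<Omega>)"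
  shows "box_projection a b \<zeta> \<in> U_ad \<Omega> a b"
proof -
  interpret bounded_open \<Omega> using assms by unfold_locales
  have \<zeta>i: "(\<lambda>x. \<zeta> x $ i) \<in> borel_measurable (lebesgue_on \<Omega>)" for i
    using \<zeta> by (simp add: borel_measurable_vec_iff)
  have bd: "\<bar>box_projection a b \<zeta> x $ i\<bar> \<le> \<bar>a $ i\<bar> + \<bar>b $ i\<bar>" for x i
    using ab[rule_format, of i] by (auto simp: box_projection_def min_def max_def)
  have "(\<lambda>x. box_projection a b \<zeta> x $ i) \<in> L2_space \<Omega>" for i
    by (rule AE_bounded_L2[of _ "\<bar>a $ i\<bar> + \<bar>b $ i\<bar>"])
      (use bd[of _ i] \<zeta>i[of i] in \<open>auto simp: box_projection_def\<close>)
  then show ?thesis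
    using ab by (auto simp: U_ad_def L2_space_vec_iff box_projection_def less_eq_vec_def min_le_iff_disj less_imp_le)
qed

text \<open>Pointwise, \<open>min b (max a (- s / \<theta>))\<close> minimises \<open>s v + \<theta> v\<^sup>2 / 2\<close> over \<open>[a, b]\<close>.\<close>

lemma box_projection_variational:
  assumes ab: "\<forall>i. a $ i < b $ i" and \<theta>: "\<theta> > 0"
    and v: "AE x in lebesgue_on \<Omega>. a \<le> v x \<and> v x \<le> b"
  shows "L2_inner \<Omega> (\<lambda>x. w x + \<theta> *\<^sub>R box_projection a b (\<lambda>z. - (1 / \<theta>) *\<^sub>R w z) x)
           (\<lambda>x. v x - box_projection a b (\<lambda>z. - (1 / \<theta>) *\<^sub>R w z) x) \<ge> 0"
  unfolding L2_inner_def
proof (rule integral_nonneg_AE)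
  have scalar: "0 \<le> (s + \<theta> * min \<beta> (max \<alpha> (- (1 / \<theta>) * s))) * (t - min \<beta> (max \<alpha> (- (1 / \<theta>) * s)))"
    if "\<alpha> < \<beta>" "\<alpha> \<le> t" "t \<le> \<beta>" for s t \<alpha> \<beta> :: real
  proof -
    \<comment> \<open>\<open>m\<close> is the unconstrained minimiser. In terms of it the product
      reads \<open>\<theta> * (P - m) * (t - P)\<close>, where \<open>P\<close> is the projection of
      \<open>m\<close>; its two factors never have opposite signs.\<close>
    define m where "m = - (1 / \<theta>) * s"
    have s: "s = - (\<theta> * m)" using \<theta> by (simp add: m_def)
    consider "m < \<alpha>" | "\<alpha> \<le> m" "m \<le> \<beta>" | "m > \<beta>" by linarith
    then have "0 \<le> (\<theta> * (min \<beta> (max \<alpha> m) - m)) * (t - min \<beta> (max \<alpha> m))"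
    proof cases
      case 1
      with that have "min \<beta> (max \<alpha> m) = \<alpha>" by auto
      with 1 that \<theta> show ?thesis by simp
    next
      case 2
      then have "min \<beta> (max \<alpha> m) = m" by auto
      then show ?thesis by simp
    next
      case 3
      with that have "min \<beta> (max \<alpha> m) = \<beta>" by auto
      with 3 that \<theta> show ?thesis by (simp add: mult_nonpos_nonpos mult_nonneg_nonpos)
    qed
    then show ?thesis unfolding m_def[symmetric] by (simp add: s algebra_simps)
  qed
  show "AE x in lebesgue_on \<Omega>. 0 \<le> (w x + \<theta> *\<^sub>R box_projection a b (\<lambda>z. - (1 / \<theta>) *\<^sub>R w z) x)
           \<bullet> (v x - box_projection a b (\<lambda>z. - (1 / \<theta>) *\<^sub>R w z) x)"
    using v
  proof eventually_elim
    case (elim x)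
    show ?case
      unfolding inner_vec_def
    proof (rule sum_nonneg)
      fix i
      show "0 \<le> (w x + \<theta> *\<^sub>R box_projection a b (\<lambda>z. - (1 / \<theta>) *\<^sub>R w z) x) $ i
           \<bullet> (v x - box_projection a b (\<lambda>z. - (1 / \<theta>) *\<^sub>R w z) x) $ i"
        using scalar[of "a $ i" "b $ i" "v x $ i" "w x $ i"] ab elim
        by (simp add: box_projection_def less_eq_vec_def)
    qed
  qed
qed

section \<open>A priori estimates for velocity and pressure\<close>

locale oseen = solenoidal_field \<Omega> c for \<Omega> :: "(real^'n) set" and c +
  fixes \<epsilon> \<kappa> \<beta> :: real
  assumes \<epsilon>: "\<epsilon> > 0" and \<kappa>: "\<kappa> \<ge> 0" and \<beta>: "\<beta> > 0" and inf_sup: "inf_sup_condition \<Omega> \<beta>"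
begin

lemma form_B_diff_left:
  assumes "\<xi> \<in> H10_vec \<Omega>" "\<zeta> \<in> H10_vec \<Omega>" "\<phi> \<in> L2_space \<Omega>"
  shows "form_B \<Omega> (\<lambda>x. \<xi> x - \<zeta> x) \<phi> = form_B \<Omega> \<xi> \<phi> - form_B \<Omega> \<zeta> \<phi>"
proof -
  have "form_B \<Omega> (\<lambda>x. \<xi> x - \<zeta> x) \<phi> = L2_inner \<Omega> \<phi> (\<lambda>x. weak_div \<Omega> \<xi> x - weak_div \<Omega> \<zeta> x)"
    unfolding form_B_def
    by (rule L2_inner_cong_AE) (auto intro: assms weak_div_L2 H10_vec_diff L2_space_diff weak_div_diff_AE)
  then show ?thesis
    by (simp add: form_B_def L2_inner_diff_right weak_div_L2 assms)
qed

lemma form_B_diff_right: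
  assumes "\<xi> \<in> H10_vec \<Omega>" "\<phi> \<in> L2_space \<Omega>" "\<psi> \<in> L2_space \<Omega>"
  shows "form_B \<Omega> \<xi> (\<lambda>x. \<phi> x - \<psi> x) = form_B \<Omega> \<xi> \<phi> - form_B \<Omega> \<xi> \<psi>"
  by (simp add: form_B_def L2_inner_diff_left weak_div_L2 assms)

lemma zero_mean_L2: "\<phi> \<in> L2_zero_mean \<Omega> \<Longrightarrow> \<phi> \<in> L2_space \<Omega>"
  by (simp add: L2_zero_mean_def)

lemma state_solution_diff:
  assumes 1: "state_solution \<Omega> \<epsilon> \<kappa> c g y p" and 2: "state_solution \<Omega> \<epsilon> \<kappa> c g' y' p'"
    and g: "g \<in> L2_space \<Omega>" "g' \<in> L2_space \<Omega>"
  shows "state_solution \<Omega> \<epsilon> \<kappa> c (\<lambda>x. g x - g' x) (\<lambda>x. y x - y' x) (\<lambda>x. p x - p' x)"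
proof -
  have mem: "y \<in> H10_vec \<Omega>" "y' \<in> H10_vec \<Omega>" "p \<in> L2_zero_mean \<Omega>" "p' \<in> L2_zero_mean \<Omega>"
    and div: "\<And>\<phi>. \<phi> \<in> L2_zero_mean \<Omega> \<Longrightarrow> form_B \<Omega> y \<phi> = 0 \<and> form_B \<Omega> y' \<phi> = 0"
    using 1 2 by (auto simp: state_solution_def)
  have "form_A \<Omega> \<epsilon> \<kappa> c (\<lambda>x. y x - y' x) \<xi> - form_B \<Omega> \<xi> (\<lambda>x. p x - p' x) = L2_inner \<Omega> (\<lambda>x. g x - g' x) \<xi>"
    if \<xi>: "\<xi> \<in> H10_vec \<Omega>" for \<xi>
  proof -
    have "form_A \<Omega> \<epsilon> \<kappa> c y \<xi> - form_B \<Omega> \<xi> p = L2_inner \<Omega> g \<xi>"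
      "form_A \<Omega> \<epsilon> \<kappa> c y' \<xi> - form_B \<Omega> \<xi> p' = L2_inner \<Omega> g' \<xi>"
      using 1 2 \<xi> by (auto simp: state_solution_def)
    then show ?thesis
      using mem \<xi> g by (simp add: form_A_diff_left form_B_diff_right zero_mean_L2 L2_inner_diff_left H10_vec_L2)
  qed
  then show ?thesis
    using mem div unfolding state_solution_def
    by (auto simp: form_B_diff_left zero_mean_L2 intro: H10_vec_diff L2_zero_mean_diff bounded_domain open_domain)
qed

lemma form_C_diff_left:
  assumes "\<xi> \<in> H10_vec \<Omega>" "\<xi>' \<in> H10_vec \<Omega>" "\<zeta> \<in> H10_vec \<Omega>"
  shows "form_C \<Omega> \<epsilon> \<kappa> c (\<lambda>x. \<xi> x - \<xi>' x) \<zeta> = form_C \<Omega> \<epsilon> \<kappa> c \<xi> \<zeta> - form_C \<Omega> \<epsilon> \<kappa> c \<xi>' \<zeta>"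
proof -
  \<comment> \<open>The forms differ only in the sign of convection. Writing \<open>form_C\<close>
    as twice the symmetric part minus \<open>form_A\<close> lets it inherit linearity.\<close>
  have eq: "form_C \<Omega> \<epsilon> \<kappa> c \<eta> \<zeta> = 2 * (\<epsilon> * L2_inner \<Omega> (weak_grad \<Omega> \<eta>) (weak_grad \<Omega> \<zeta>) + \<kappa> * L2_inner \<Omega> \<eta> \<zeta>)
      - form_A \<Omega> \<epsilon> \<kappa> c \<eta> \<zeta>" if "\<eta> \<in> H10_vec \<Omega>" for \<eta>
    using that assms(3) by (simp add: form_A_expand form_C_expand)
  have g: "L2_inner \<Omega> (weak_grad \<Omega> (\<lambda>x. \<xi> x - \<xi>' x)) (weak_grad \<Omega> \<zeta>)
      = L2_inner \<Omega> (\<lambda>x. weak_grad \<Omega> \<xi> x - weak_grad \<Omega> \<xi>' x) (weak_grad \<Omega> \<zeta>)"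
    by (rule L2_inner_cong_AE) (auto intro: weak_grad_L2 H10_vec_diff assms L2_space_diff weak_grad_diff_AE)
  show ?thesis
    by (simp add: eq assms H10_vec_diff form_A_diff_left g L2_inner_diff_left weak_grad_L2 H10_vec_L2 algebra_simps)
qed

lemma adjoint_solution_diff:
  assumes 1: "adjoint_solution \<Omega> \<epsilon> \<kappa> c g y p" and 2: "adjoint_solution \<Omega> \<epsilon> \<kappa> c g' y' p'"
    and g: "g \<in> L2_space \<Omega>" "g' \<in> L2_space \<Omega>"
  shows "adjoint_solution \<Omega> \<epsilon> \<kappa> c (\<lambda>x. g x - g' x) (\<lambda>x. y x - y' x) (\<lambda>x. p x - p' x)"
proof -
  have mem: "y \<in> H10_vec \<Omega>" "y' \<in> H10_vec \<Omega>" "p \<in> L2_zero_mean \<Omega>" "p' \<in> L2_zero_mean \<Omega>"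
    and div: "\<And>\<phi>. \<phi> \<in> L2_zero_mean \<Omega> \<Longrightarrow> form_B \<Omega> y \<phi> = 0 \<and> form_B \<Omega> y' \<phi> = 0"
    using 1 2 by (auto simp: adjoint_solution_def)
  have "form_C \<Omega> \<epsilon> \<kappa> c (\<lambda>x. y x - y' x) \<xi> + form_B \<Omega> \<xi> (\<lambda>x. p x - p' x) = L2_inner \<Omega> (\<lambda>x. g x - g' x) \<xi>"
    if \<xi>: "\<xi> \<in> H10_vec \<Omega>" for \<xi>
  proof -
    have "form_C \<Omega> \<epsilon> \<kappa> c y \<xi> + form_B \<Omega> \<xi> p = L2_inner \<Omega> g \<xi>"
      "form_C \<Omega> \<epsilon> \<kappa> c y' \<xi> + form_B \<Omega> \<xi> p' = L2_inner \<Omega> g' \<xi>"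
      using 1 2 \<xi> by (auto simp: adjoint_solution_def)
    then show ?thesis
      using mem \<xi> g by (simp add: form_C_diff_left form_B_diff_right zero_mean_L2 L2_inner_diff_left H10_vec_L2)
  qed
  then show ?thesis
    using mem div unfolding adjoint_solution_def
    by (auto simp: form_B_diff_left zero_mean_L2 intro: H10_vec_diff L2_zero_mean_diff bounded_domain open_domain)
qed

text \<open>Turns the inf-sup condition into the form in which it is applied: a bound for the
  functional induced by \<phi> is a bound for every quotient, hence for their supremum.\<close>

lemma pressure_bound:
  assumes \<phi>: "\<phi> \<in> L2_zero_mean \<Omega>" and X: "X \<ge> 0"
    and bound: "\<And>\<xi>. \<xi> \<in> H10_vec \<Omega> \<Longrightarrow> \<bar>form_B \<Omega> \<xi> \<phi>\<bar> \<le> X * L2_norm \<Omega> (weak_grad \<Omega> \<xi>)"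
  shows "\<beta> * L2_norm \<Omega> \<phi> \<le> X"
proof -
  have "ereal (\<beta> * L2_norm \<Omega> \<phi>) \<le> (SUP \<xi>\<in>{\<xi> \<in> H10_vec \<Omega>. \<not> (AE x in lebesgue_on \<Omega>. \<xi> x = 0)}.
           ereal (form_B \<Omega> \<xi> \<phi> / L2_norm \<Omega> (weak_grad \<Omega> \<xi>)))"
    using inf_sup \<phi> by (simp add: inf_sup_condition_def)
  also have "\<dots> \<le> ereal X"
  proof (rule SUP_least)
    fix \<xi> assume "\<xi> \<in> {\<xi> \<in> H10_vec \<Omega>. \<not> (AE x in lebesgue_on \<Omega>. \<xi> x = 0)}"
    then have \<xi>: "\<xi> \<in> H10_vec \<Omega>" by simp
    show "ereal (form_B \<Omega> \<xi> \<phi> / L2_norm \<Omega> (weak_grad \<Omega> \<xi>)) \<le> ereal X"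
    \<comment> \<open>If the gradient is zero, the quotient is 0 by the convention for division, and
      \<open>X \<ge> 0\<close> suffices.\<close>
    proof (cases "L2_norm \<Omega> (weak_grad \<Omega> \<xi>) = 0")
      case False
      then have "L2_norm \<Omega> (weak_grad \<Omega> \<xi>) > 0" by (simp add: less_le)
      with bound[OF \<xi>] show ?thesis by (simp add: divide_le_eq)
    qed (use X in simp)
  qed
  finally show ?thesis by simp
qed

text \<open>Testing with the velocity \<open>d\<close> removes the pressure, since \<open>d\<close>
  is divergence-free and \<open>e\<close> is an admissible multiplier; coercivity then bounds the
  gradient. The equation, solved for \<open>form_B \<Omega> \<xi> e\<close>, bounds the pressure.
  Both equations share these estimates because their forms are transposes of each other.\<close>

lemma stability:
  obtains C where "C > 0"
    "\<And>h d e. h \<in> L2_space \<Omega> \<Longrightarrow> state_solution \<Omega> \<epsilon> \<kappa> c h d e \<or> adjoint_solution \<Omega> \<epsilon> \<kappa> c h d e \<Longrightarrow>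
       L2_norm \<Omega> (weak_grad \<Omega> d) \<le> C * L2_norm \<Omega> h \<and> L2_norm \<Omega> d \<le> C * L2_norm \<Omega> h \<and> L2_norm \<Omega> e \<le> C * L2_norm \<Omega> h"
proof -
  obtain R where R: "R > 0" "\<And>\<xi>. \<xi> \<in> H10_vec \<Omega> \<Longrightarrow> L2_norm \<Omega> \<xi> \<le> R * L2_norm \<Omega> (weak_grad \<Omega> \<xi>)"
    by (rule poincare_vec) blast
  obtain K where K: "K \<ge> 0" "\<And>\<xi> \<zeta>. \<xi> \<in> H10_vec \<Omega> \<Longrightarrow> \<zeta> \<in> H10_vec \<Omega> \<Longrightarrow>
    \<bar>form_A \<Omega> \<epsilon> \<kappa> c \<xi> \<zeta>\<bar> \<le> K * L2_norm \<Omega> (weak_grad \<Omega> \<xi>) * L2_norm \<Omega> (weak_grad \<Omega> \<zeta>)"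
    by (rule form_A_bounded[OF less_imp_le[OF \<epsilon>] \<kappa>]) blast
  \<comment> \<open>\<open>C1\<close> bounds the gradient: coercivity provides \<epsilon> and
    Poincare on the right-hand side provides \<open>R\<close>. In \<open>C2\<close> the bound
    \<open>K\<close> of the form multiplies \<open>C1\<close>, the load adds \<open>R\<close>, and
    the inf-sup condition divides by \<beta>.\<close>
  define C1 where "C1 = R / \<epsilon>"
  define C2 where "C2 = (K * C1 + R) / \<beta>"
  have pos: "C1 > 0" "C2 > 0" using R(1) K(1) \<epsilon> \<beta> by (auto simp: C1_def C2_def intro!: divide_pos_pos add_nonneg_pos)
  have main: "L2_norm \<Omega> (weak_grad \<Omega> d) \<le> C1 * L2_norm \<Omega> h \<and> L2_norm \<Omega> d \<le> R * C1 * L2_norm \<Omega> h \<and> L2_norm \<Omega> e \<le> C2 * L2_norm \<Omega> h"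
    if h: "h \<in> L2_space \<Omega>" and sol: "state_solution \<Omega> \<epsilon> \<kappa> c h d e \<or> adjoint_solution \<Omega> \<epsilon> \<kappa> c h d e" for h d e
  proof -
    let ?N = "\<lambda>\<xi>. L2_norm \<Omega> (weak_grad \<Omega> \<xi>)" and ?h = "L2_norm \<Omega> h"
    have d: "d \<in> H10_vec \<Omega>" and e: "e \<in> L2_zero_mean \<Omega>" and div: "form_B \<Omega> d e = 0"
      using sol by (auto simp: state_solution_def adjoint_solution_def)
    have eqd: "form_A \<Omega> \<epsilon> \<kappa> c d d = L2_inner \<Omega> h d"
      using sol d div by (auto simp: state_solution_def adjoint_solution_def form_C_eq_form_A)
    have hd: "\<bar>L2_inner \<Omega> h \<xi>\<bar> \<le> R * ?h * ?N \<xi>" if \<xi>: "\<xi> \<in> H10_vec \<Omega>" for \<xi>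
    proof -
      have "\<bar>L2_inner \<Omega> h \<xi>\<bar> \<le> ?h * L2_norm \<Omega> \<xi>" by (rule L2_Cauchy_Schwarz[OF h H10_vec_L2[OF \<xi>]])
      also have "\<dots> \<le> ?h * (R * ?N \<xi>)" by (rule mult_left_mono[OF R(2)[OF \<xi>]]) simp
      finally show ?thesis by (simp add: algebra_simps)
    qed
    have "\<epsilon> * (?N d)\<^sup>2 \<le> \<epsilon> * (?N d)\<^sup>2 + \<kappa> * (L2_norm \<Omega> d)\<^sup>2" using \<kappa> by simp
    also have "\<dots> \<le> R * ?h * ?N d"
      using eqd hd[OF d] by (simp add: form_A_coercive[OF d])
    finally have "(\<epsilon> * ?N d) * ?N d \<le> (R * ?h) * ?N d" by (simp add: power2_eq_square algebra_simps)
    then have "\<epsilon> * ?N d \<le> R * ?h"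
      using R(1) by (cases "?N d = 0") (auto simp: mult_le_cancel_right less_le)
    then have N: "?N d \<le> C1 * ?h" using \<epsilon> by (simp add: C1_def field_simps)
    have "L2_norm \<Omega> d \<le> R * (C1 * ?h)"
      by (rule order_trans[OF R(2)[OF d] mult_left_mono[OF N]]) (use R in simp)
    moreover have "\<beta> * L2_norm \<Omega> e \<le> (K * C1 + R) * ?h"
    proof (rule pressure_bound[OF e])
      show "(K * C1 + R) * ?h \<ge> 0" using K(1) R(1) pos by simp
      fix \<xi> assume \<xi>: "\<xi> \<in> H10_vec \<Omega>"
      have "\<bar>form_B \<Omega> \<xi> e\<bar> \<le> (K * ?N d * ?N \<xi>) + R * ?h * ?N \<xi>"
        using sol
      proof
        assume "state_solution \<Omega> \<epsilon> \<kappa> c h d e"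
        then have "form_A \<Omega> \<epsilon> \<kappa> c d \<xi> - form_B \<Omega> \<xi> e = L2_inner \<Omega> h \<xi>" using \<xi> by (simp add: state_solution_def)
        then show ?thesis using K(2)[OF d \<xi>] hd[OF \<xi>] by linarith
      next
        assume "adjoint_solution \<Omega> \<epsilon> \<kappa> c h d e"
        then have "form_C \<Omega> \<epsilon> \<kappa> c d \<xi> + form_B \<Omega> \<xi> e = L2_inner \<Omega> h \<xi>"
          using \<xi> by (simp add: adjoint_solution_def)
        then have "form_A \<Omega> \<epsilon> \<kappa> c \<xi> d + form_B \<Omega> \<xi> e = L2_inner \<Omega> h \<xi>"
          by (simp only: form_C_eq_form_A[OF d \<xi>])
        moreover have "K * ?N \<xi> * ?N d = K * ?N d * ?N \<xi>" by simp
        ultimately show ?thesis using K(2)[OF \<xi> d] hd[OF \<xi>] by linarith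
      qed
      also have "\<dots> \<le> (K * (C1 * ?h) * ?N \<xi>) + R * ?h * ?N \<xi>"
        using N K(1) by (intro add_right_mono mult_right_mono mult_left_mono) auto
      finally show "\<bar>form_B \<Omega> \<xi> e\<bar> \<le> (K * C1 + R) * ?h * ?N \<xi>" by (simp add: algebra_simps)
    qed
    then have "L2_norm \<Omega> e \<le> C2 * ?h" using \<beta> by (simp add: C2_def field_simps)
    ultimately show ?thesis using N by (simp add: mult.assoc)
  qed
  define C where "C = C1 + R * C1 + C2"
  have "C > 0" using pos R(1) by (simp add: C_def add_pos_pos)
  moreover have le: "C1 \<le> C" "R * C1 \<le> C" "C2 \<le> C"
    using pos R(1) by (auto simp: C_def add_nonneg_nonneg)
  have "L2_norm \<Omega> (weak_grad \<Omega> d) \<le> C * L2_norm \<Omega> h \<and> L2_norm \<Omega> d \<le> C * L2_norm \<Omega> h \<and> L2_norm \<Omega> e \<le> C * L2_norm \<Omega> h"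
    if "h \<in> L2_space \<Omega>" "state_solution \<Omega> \<epsilon> \<kappa> c h d e \<or> adjoint_solution \<Omega> \<epsilon> \<kappa> c h d e" for h d e
    using main[OF that] le[THEN mult_right_mono, OF L2_norm_nonneg, of \<Omega> h] by linarith
  ultimately show ?thesis by (rule that)
qed

end

section \<open>Reliability of the estimator\<close>

text \<open>The role of \<open>D\<close> is that of \<open>\<parallel>y - yh\<parallel>\<close>, and \<open>g\<close>, \<open>r\<close> and \<open>h\<close> are controlled by the sum \<open>S\<close> of the
  estimators.\<close>

lemma absorb_quadratic:
  fixes \<theta> t D g r h S k1 k2 k3 :: real
  assumes \<theta>: "\<theta> > 0" and le: "\<theta> * t\<^sup>2 \<le> - D\<^sup>2 + g * D + r + h * t"
    and g: "0 \<le> g" "g \<le> k1 * S" and r: "r \<le> k2 * S\<^sup>2" and h: "h \<le> k3 * S"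
    and k: "k1 \<ge> 0" "k2 \<ge> 0" "k3 \<ge> 0" and S: "S \<ge> 0" and t: "t \<ge> 0"
  shows "t \<le> (1 + (k1\<^sup>2 + k2 + k3) / \<theta>) * S"
proof (cases "t \<le> S")
  case True
  have "0 \<le> (k1\<^sup>2 + k2 + k3) / \<theta> * S" using \<theta> k S by simp
  with True show ?thesis by (simp add: distrib_right)
next
  \<comment> \<open>Now \<open>S < t\<close>, so \<open>S\<^sup>2\<close> may be replaced by
    \<open>S * t\<close> and the inequality divided by \<open>t\<close>. The opposite case is the
    reason for the summand 1 in the constant.\<close>
  case False
  \<comment> \<open>Completing the square removes \<open>D\<close>: what is left of
    \<open>- D\<^sup>2 + g * D\<close> is at most \<open>g\<^sup>2 / 4\<close>.\<close>
  have "0 \<le> (D - g / 2)\<^sup>2" by simp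
  also have "\<dots> = D\<^sup>2 - g * D + g\<^sup>2 / 4" by (simp add: power2_diff power_divide)
  finally have "- D\<^sup>2 + g * D \<le> g\<^sup>2" using zero_le_power2[of g] by linarith
  also have "\<dots> \<le> (k1 * S)\<^sup>2" by (rule power_mono[OF g(2,1)])
  finally have "\<theta> * t\<^sup>2 \<le> k1\<^sup>2 * S\<^sup>2 + k2 * S\<^sup>2 + k3 * S * t"
    using le r mult_right_mono[OF h t] by (simp add: power_mult_distrib)
  moreover have "S\<^sup>2 \<le> S * t" using False S by (simp add: power2_eq_square mult_left_mono)
  then have "k1\<^sup>2 * S\<^sup>2 \<le> k1\<^sup>2 * (S * t)" "k2 * S\<^sup>2 \<le> k2 * (S * t)" using k by (auto intro: mult_left_mono)
  ultimately have "(\<theta> * t) * t \<le> ((k1\<^sup>2 + k2 + k3) * S) * t"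
    by (simp add: power2_eq_square algebra_simps)
  then have "\<theta> * t \<le> (k1\<^sup>2 + k2 + k3) * S"
    using False S by (simp add: mult_le_cancel_right)
  then have "t \<le> (k1\<^sup>2 + k2 + k3) / \<theta> * S"
    using \<theta> by (simp add: field_simps)
  with S show ?thesis by (simp add: distrib_right)
qed

context oseen begin

lemma weak_grad_triangle:
  assumes "\<xi> \<in> H10_vec \<Omega>" "\<eta> \<in> H10_vec \<Omega>" "\<zeta> \<in> H10_vec \<Omega>"
  shows "L2_norm \<Omega> (weak_grad \<Omega> (\<lambda>x. \<xi> x - \<zeta> x))
    \<le> L2_norm \<Omega> (weak_grad \<Omega> (\<lambda>x. \<xi> x - \<eta> x)) + L2_norm \<Omega> (weak_grad \<Omega> (\<lambda>x. \<eta> x - \<zeta> x))"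
proof -
  have eq: "L2_norm \<Omega> (weak_grad \<Omega> (\<lambda>x. u x - v x)) = L2_norm \<Omega> (\<lambda>x. weak_grad \<Omega> u x - weak_grad \<Omega> v x)"
    if "u \<in> H10_vec \<Omega>" "v \<in> H10_vec \<Omega>" for u v
    by (rule L2_norm_cong_AE[OF _ _ weak_grad_diff_AE[OF that]])
      (intro weak_grad_L2 H10_vec_diff L2_space_diff that)+
  show ?thesis
    unfolding eq[OF assms(1,3)] eq[OF assms(1,2)] eq[OF assms(2,3)]
    by (intro L2_norm_triangle_diff weak_grad_L2 assms)
qed

text \<open>The constant is obtained before the data, the controls and the approximations, which
  makes it uniform in them. \<open>S\<close> measures velocities by gradients instead of V norms:
  \<kappa> may be zero, and the L2 parts follow from Poincare.\<close>

lemma reliability: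
  assumes \<theta>: "\<theta> > 0"
  obtains A where "A > 0"
    "\<And>f y\<^sub>\<Omega> a b y p w q u y\<^sub>T p\<^sub>T w\<^sub>T q\<^sub>T u\<^sub>T yh ph wh qh S.
      f \<in> L2_space \<Omega> \<Longrightarrow> y\<^sub>\<Omega> \<in> L2_space \<Omega> \<Longrightarrow> \<forall>i. a $ i < b $ i \<Longrightarrow>
      optimality_system \<Omega> \<epsilon> \<kappa> c \<theta> f y\<^sub>\<Omega> a b y p w q u \<Longrightarrow>
      y\<^sub>T \<in> H10_vec \<Omega> \<Longrightarrow> p\<^sub>T \<in> L2_zero_mean \<Omega> \<Longrightarrow> w\<^sub>T \<in> H10_vec \<Omega> \<Longrightarrow> q\<^sub>T \<in> L2_zero_mean \<Omega> \<Longrightarrow>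
      u\<^sub>T \<in> U_ad \<Omega> a b \<Longrightarrow>
      state_solution \<Omega> \<epsilon> \<kappa> c (\<lambda>x. f x + u\<^sub>T x) yh ph \<Longrightarrow>
      adjoint_solution \<Omega> \<epsilon> \<kappa> c (\<lambda>x. y\<^sub>T x - y\<^sub>\<Omega> x) wh qh \<Longrightarrow>
      S = L2_norm \<Omega> (weak_grad \<Omega> (\<lambda>x. yh x - y\<^sub>T x)) + L2_norm \<Omega> (\<lambda>x. ph x - p\<^sub>T x)
        + L2_norm \<Omega> (weak_grad \<Omega> (\<lambda>x. wh x - w\<^sub>T x)) + L2_norm \<Omega> (\<lambda>x. qh x - q\<^sub>T x)
        + control_indicator \<theta> a b w\<^sub>T u\<^sub>T \<Omega> \<Longrightarrow>
      L2_norm \<Omega> (weak_grad \<Omega> (\<lambda>x. y x - y\<^sub>T x)) \<le> A * S \<and> L2_norm \<Omega> (\<lambda>x. y x - y\<^sub>T x) \<le> A * S \<and>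
      L2_norm \<Omega> (\<lambda>x. p x - p\<^sub>T x) \<le> A * S \<and>
      L2_norm \<Omega> (weak_grad \<Omega> (\<lambda>x. w x - w\<^sub>T x)) \<le> A * S \<and> L2_norm \<Omega> (\<lambda>x. w x - w\<^sub>T x) \<le> A * S \<and>
      L2_norm \<Omega> (\<lambda>x. q x - q\<^sub>T x) \<le> A * S \<and> L2_norm \<Omega> (\<lambda>x. u x - u\<^sub>T x) \<le> A * S"
proof -
  obtain R where R: "R > 0" "\<And>\<xi>. \<xi> \<in> H10_vec \<Omega> \<Longrightarrow> L2_norm \<Omega> \<xi> \<le> R * L2_norm \<Omega> (weak_grad \<Omega> \<xi>)"
    by (rule poincare_vec) blast
  obtain C where C: "C > 0"
    "\<And>h d e. h \<in> L2_space \<Omega> \<Longrightarrow> state_solution \<Omega> \<epsilon> \<kappa> c h d e \<or> adjoint_solution \<Omega> \<epsilon> \<kappa> c h d e \<Longrightarrow>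
       L2_norm \<Omega> (weak_grad \<Omega> d) \<le> C * L2_norm \<Omega> h \<and> L2_norm \<Omega> d \<le> C * L2_norm \<Omega> h \<and> L2_norm \<Omega> e \<le> C * L2_norm \<Omega> h"
    by (rule stability) blast
  \<comment> \<open>\<open>m\<close> is the constant of \<open>absorb_quadratic\<close> with
    \<open>k1 = R + C\<close>, \<open>k2 = C * R\<close>, \<open>k3 = R\<close>. The control error
    is then at most \<open>(m + 1) * S\<close>; stability and one estimator give \<open>n1\<close>
    for the state and \<open>n2\<close> for the adjoint, whose load is bounded by
    \<open>R * n1 * S\<close>. \<open>A\<close> majorises all of these.\<close>
  define m where "m = 1 + ((R + C)\<^sup>2 + C * R + R) / \<theta>"
  define n1 where "n1 = C * (m + 1) + 1"
  define n2 where "n2 = C * (R * n1) + 1"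
  define A where "A = (m + 1) + n1 + R * n1 + n2 + R * n2"
  have m: "m > 0" using R(1) C(1) \<theta> by (auto simp: m_def intro!: add_pos_nonneg divide_nonneg_pos)
  have n1: "n1 > 0" using C(1) m by (simp add: n1_def add_pos_pos)
  have n2: "n2 > 0" using C(1) R(1) n1 by (simp add: n2_def add_pos_pos)
  have A: "A > 0" using m n1 n2 R(1) by (simp add: A_def add_pos_pos)
  have A_ge: "m + 1 \<le> A" "n1 \<le> A" "R * n1 \<le> A" "n2 \<le> A" "R * n2 \<le> A"
    using m n1 n2 mult_pos_pos[OF R(1) n1] mult_pos_pos[OF R(1) n2] unfolding A_def by linarith+
  show ?thesis
  proof (rule that[OF A])
    fix f y\<^sub>\<Omega> a b y p w q u y\<^sub>T p\<^sub>T w\<^sub>T q\<^sub>T u\<^sub>T yh ph wh qh and S :: real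
    assume f: "f \<in> L2_space \<Omega>" and yO: "y\<^sub>\<Omega> \<in> L2_space \<Omega>" and ab: "\<forall>i. a $ i < b $ i"
      and opt: "optimality_system \<Omega> \<epsilon> \<kappa> c \<theta> f y\<^sub>\<Omega> a b y p w q u"
      and yT: "y\<^sub>T \<in> H10_vec \<Omega>" and pT: "p\<^sub>T \<in> L2_zero_mean \<Omega>" and wT: "w\<^sub>T \<in> H10_vec \<Omega>" and qT: "q\<^sub>T \<in> L2_zero_mean \<Omega>"
      and uT: "u\<^sub>T \<in> U_ad \<Omega> a b"
      and hat: "state_solution \<Omega> \<epsilon> \<kappa> c (\<lambda>x. f x + u\<^sub>T x) yh ph"
        "adjoint_solution \<Omega> \<epsilon> \<kappa> c (\<lambda>x. y\<^sub>T x - y\<^sub>\<Omega> x) wh qh"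
      and S_def: "S = L2_norm \<Omega> (weak_grad \<Omega> (\<lambda>x. yh x - y\<^sub>T x)) + L2_norm \<Omega> (\<lambda>x. ph x - p\<^sub>T x)
        + L2_norm \<Omega> (weak_grad \<Omega> (\<lambda>x. wh x - w\<^sub>T x)) + L2_norm \<Omega> (\<lambda>x. qh x - q\<^sub>T x)
        + control_indicator \<theta> a b w\<^sub>T u\<^sub>T \<Omega>"
    define v where "v = box_projection a b (\<lambda>z. - (1 / \<theta>) *\<^sub>R w\<^sub>T z)"
    have sol: "state_solution \<Omega> \<epsilon> \<kappa> c (\<lambda>x. f x + u x) y p" "adjoint_solution \<Omega> \<epsilon> \<kappa> c (\<lambda>x. y x - y\<^sub>\<Omega> x) w q"
      and u: "u \<in> U_ad \<Omega> a b"
      and u_opt: "\<And>v. v \<in> U_ad \<Omega> a b \<Longrightarrow> L2_inner \<Omega> (\<lambda>x. w x + \<theta> *\<^sub>R u x) (\<lambda>x. v x - u x) \<ge> 0"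
      using opt by (auto simp: optimality_system_def)
    have y: "y \<in> H10_vec \<Omega>" and w: "w \<in> H10_vec \<Omega>" and p: "p \<in> L2_zero_mean \<Omega>" and q: "q \<in> L2_zero_mean \<Omega>"
      and yh: "yh \<in> H10_vec \<Omega>" and wh: "wh \<in> H10_vec \<Omega>" and ph: "ph \<in> L2_zero_mean \<Omega>" and qh: "qh \<in> L2_zero_mean \<Omega>"
      using sol hat by (auto simp: state_solution_def adjoint_solution_def)
    have "(\<lambda>z. - (1 / \<theta>) *\<^sub>R w\<^sub>T z) \<in> borel_measurable (lebesgue_on \<Omega>)"
      using L2_spaceD(1)[OF L2_space_scaleR[OF H10_vec_L2[OF wT]]] .
    then have v: "v \<in> U_ad \<Omega> a b"
      unfolding v_def by (rule box_projection_in_U_ad[OF bounded_domain open_domain ab])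
    have L2: "u \<in> L2_space \<Omega>" "u\<^sub>T \<in> L2_space \<Omega>" "v \<in> L2_space \<Omega>"
      "y \<in> L2_space \<Omega>" "w \<in> L2_space \<Omega>" "yh \<in> L2_space \<Omega>" "wh \<in> L2_space \<Omega>" "y\<^sub>T \<in> L2_space \<Omega>" "w\<^sub>T \<in> L2_space \<Omega>"
      using u uT v y w yh wh yT wT by (auto simp: U_ad_def H10_vec_L2)
    have v_opt: "L2_inner \<Omega> (\<lambda>x. w\<^sub>T x + \<theta> *\<^sub>R v x) (\<lambda>x. u x - v x) \<ge> 0"
      unfolding v_def by (rule box_projection_variational[OF ab \<theta>]) (use u in \<open>auto simp: U_ad_def\<close>)

    let ?dy = "\<lambda>x. y x - yh x" and ?dw = "\<lambda>x. w x - wh x"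
    have "(\<lambda>x. (f x + u x) - (f x + u\<^sub>T x)) = (\<lambda>x. u x - u\<^sub>T x)" "(\<lambda>x. (y x - y\<^sub>\<Omega> x) - (y\<^sub>T x - y\<^sub>\<Omega> x)) = (\<lambda>x. y x - y\<^sub>T x)"
      by auto
    then have dy_sol: "state_solution \<Omega> \<epsilon> \<kappa> c (\<lambda>x. u x - u\<^sub>T x) ?dy (\<lambda>x. p x - ph x)"
      and dw_sol: "adjoint_solution \<Omega> \<epsilon> \<kappa> c (\<lambda>x. y x - y\<^sub>T x) ?dw (\<lambda>x. q x - qh x)"
      using state_solution_diff[OF sol(1) hat(1) L2_space_add[OF f L2(1)] L2_space_add[OF f L2(2)]]
        adjoint_solution_diff[OF sol(2) hat(2) L2_space_diff[OF L2(4) yO] L2_space_diff[OF L2(8) yO]]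
      by simp_all
    have dy: "?dy \<in> H10_vec \<Omega>" and dw: "?dw \<in> H10_vec \<Omega>" by (intro H10_vec_diff y yh w wh)+

    define t D G H e where "t = L2_norm \<Omega> (\<lambda>x. v x - u x)" and "D = L2_norm \<Omega> ?dy"
      and "G = L2_norm \<Omega> (\<lambda>x. yh x - y\<^sub>T x)" and "H = L2_norm \<Omega> (\<lambda>x. wh x - w\<^sub>T x)"
      and "e = L2_norm \<Omega> (\<lambda>x. v x - u\<^sub>T x)"
    have nn: "t \<ge> 0" "D \<ge> 0" "G \<ge> 0" "H \<ge> 0" "e \<ge> 0" by (simp_all add: t_def D_def G_def H_def e_def)
    have S_parts: "L2_norm \<Omega> (weak_grad \<Omega> (\<lambda>x. yh x - y\<^sub>T x)) \<le> S" "L2_norm \<Omega> (\<lambda>x. ph x - p\<^sub>T x) \<le> S"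
      "L2_norm \<Omega> (weak_grad \<Omega> (\<lambda>x. wh x - w\<^sub>T x)) \<le> S" "L2_norm \<Omega> (\<lambda>x. qh x - q\<^sub>T x) \<le> S" "e \<le> S"
      and S: "S \<ge> 0"
      unfolding S_def control_indicator_def v_def[symmetric] e_def by (simp_all add: add_nonneg_nonneg)
    have GS: "G \<le> R * S" unfolding G_def
      by (rule order_trans[OF R(2)[OF H10_vec_diff[OF yh yT]] mult_left_mono[OF S_parts(1)]]) (use R(1) in simp)
    have HS: "H \<le> R * S" unfolding H_def
      by (rule order_trans[OF R(2)[OF H10_vec_diff[OF wh wT]] mult_left_mono[OF S_parts(3)]]) (use R(1) in simp)

    have "\<theta> * t\<^sup>2 \<le> L2_inner \<Omega> (\<lambda>x. w x - w\<^sub>T x) (\<lambda>x. v x - u x)"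
    proof -
      have "0 \<le> L2_inner \<Omega> (\<lambda>x. w x + \<theta> *\<^sub>R u x) (\<lambda>x. v x - u x) + L2_inner \<Omega> (\<lambda>x. w\<^sub>T x + \<theta> *\<^sub>R v x) (\<lambda>x. u x - v x)"
        using u_opt[OF v] v_opt by simp
      also have "\<dots> = L2_inner \<Omega> (\<lambda>x. w x - w\<^sub>T x) (\<lambda>x. v x - u x) - \<theta> * L2_inner \<Omega> (\<lambda>x. v x - u x) (\<lambda>x. v x - u x)"
        using L2 by (simp add: L2_inner_add_left L2_inner_diff_left L2_inner_diff_right L2_space_scaleR L2_space_diff
            L2_inner_scaleR_left algebra_simps L2_inner_commute[of \<Omega> u v])
      finally show ?thesis by (simp add: t_def L2_norm_square)
    qed
    also have "\<dots> = L2_inner \<Omega> ?dw (\<lambda>x. v x - u\<^sub>T x) - L2_inner \<Omega> (\<lambda>x. u x - u\<^sub>T x) ?dw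
        + L2_inner \<Omega> (\<lambda>x. wh x - w\<^sub>T x) (\<lambda>x. v x - u x)"
      unfolding L2_inner_commute[of \<Omega> "\<lambda>x. u x - u\<^sub>T x" ?dw]
      using L2 by (simp add: L2_inner_diff_left L2_inner_diff_right L2_space_diff)
    \<comment> \<open>The equation for \<open>?dy\<close> is tested with \<open>?dw\<close> and vice
      versa. Both fields are divergence-free, so the pressures vanish and the two loads are compared
      through the same form.\<close>
    also have "L2_inner \<Omega> (\<lambda>x. u x - u\<^sub>T x) ?dw = L2_inner \<Omega> (\<lambda>x. y x - y\<^sub>T x) ?dy"
    proof -
      have "form_A \<Omega> \<epsilon> \<kappa> c ?dy ?dw = L2_inner \<Omega> (\<lambda>x. u x - u\<^sub>T x) ?dw"
        using dy_sol dw_sol dw by (auto simp: state_solution_def adjoint_solution_def)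
      moreover have "form_C \<Omega> \<epsilon> \<kappa> c ?dw ?dy = L2_inner \<Omega> (\<lambda>x. y x - y\<^sub>T x) ?dy"
        using dy_sol dw_sol dy by (auto simp: state_solution_def adjoint_solution_def)
      ultimately show ?thesis using form_C_eq_form_A[OF dw dy, of \<epsilon> \<kappa>] by simp
    qed
    \<comment> \<open>Writing \<open>y - y\<^sub>T\<close> as \<open>?dy + (yh - y\<^sub>T)\<close>
      isolates the good term.\<close>
    also have "\<dots> = D\<^sup>2 + L2_inner \<Omega> (\<lambda>x. yh x - y\<^sub>T x) ?dy"
      using L2 by (simp add: D_def L2_norm_square L2_inner_diff_left L2_space_diff)
    finally have "\<theta> * t\<^sup>2 \<le> L2_inner \<Omega> ?dw (\<lambda>x. v x - u\<^sub>T x) - (D\<^sup>2 + L2_inner \<Omega> (\<lambda>x. yh x - y\<^sub>T x) ?dy)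
        + L2_inner \<Omega> (\<lambda>x. wh x - w\<^sub>T x) (\<lambda>x. v x - u x)" .
    \<comment> \<open>\<open>?dw\<close> solves the adjoint equation with load
      \<open>y - y\<^sub>T\<close>, so \<open>D\<close> appears only to the first power, multiplied
      by the control indicator \<open>e\<close>.\<close>
    moreover have "L2_inner \<Omega> ?dw (\<lambda>x. v x - u\<^sub>T x) \<le> C * (D + G) * e"
    proof -
      have "L2_norm \<Omega> (\<lambda>x. y x - y\<^sub>T x) \<le> D + G"
        unfolding D_def G_def by (rule L2_norm_triangle_diff[OF L2(4,6,8)])
      then have "L2_norm \<Omega> ?dw \<le> C * (D + G)"
        using C(2)[OF L2_space_diff[OF L2(4,8)], of ?dw "\<lambda>x. q x - qh x"] dw_sol C(1)
        by (meson mult_left_mono less_imp_le order_trans)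
      then have "L2_norm \<Omega> ?dw * e \<le> C * (D + G) * e" by (rule mult_right_mono[OF _ nn(5)])
      then show ?thesis
        using L2_Cauchy_Schwarz[OF L2_space_diff[OF L2(5,7)] L2_space_diff[OF L2(3,2)]] unfolding e_def by linarith
    qed
    moreover have "\<bar>L2_inner \<Omega> (\<lambda>x. yh x - y\<^sub>T x) ?dy\<bar> \<le> G * D"
      unfolding G_def D_def by (intro L2_Cauchy_Schwarz L2_space_diff L2)
    moreover have "\<bar>L2_inner \<Omega> (\<lambda>x. wh x - w\<^sub>T x) (\<lambda>x. v x - u x)\<bar> \<le> H * t"
      unfolding H_def t_def by (intro L2_Cauchy_Schwarz L2_space_diff L2)
    \<comment> \<open>\<open>G\<close>, \<open>H\<close> and \<open>e\<close> are bounded by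
      multiples of \<open>S\<close>, whereas \<open>D\<close> is not yet known to be; it has to be
      absorbed by its negative square.\<close>
    ultimately have quad: "\<theta> * t\<^sup>2 \<le> - D\<^sup>2 + (G + C * e) * D + C * G * e + H * t"
      by (simp add: algebra_simps abs_le_iff)
    have tS: "t \<le> m * S"
      unfolding m_def
    proof (rule absorb_quadratic[OF \<theta> quad])
      show "0 \<le> G + C * e" using nn C(1) by simp
      show "G + C * e \<le> (R + C) * S"
        unfolding distrib_right by (rule add_mono[OF GS mult_left_mono[OF S_parts(5)]]) (use C(1) in simp)
      show "C * G * e \<le> C * R * S\<^sup>2"
      proof -
        have "G * e \<le> (R * S) * S" by (rule mult_mono[OF GS S_parts(5)]) (use nn R(1) S in auto)
        then show ?thesis using C(1) by (simp add: power2_eq_square mult.assoc)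
      qed
    qed (use HS R(1) C(1) S nn in auto)

    \<comment> \<open>From here the errors follow one another: the control drives the state, and the
      state drives the adjoint. Before the second passage Poincare converts the gradient bound into
      one for the L2 norm, which measures the load.\<close>
    have uS: "L2_norm \<Omega> (\<lambda>x. u x - u\<^sub>T x) \<le> (m + 1) * S"
      using L2_norm_triangle_diff[OF L2(1,3,2)] L2_norm_minus_commute[of \<Omega> u v] tS S_parts(5)
      unfolding t_def e_def by (simp add: distrib_right)
    have "C * L2_norm \<Omega> (\<lambda>x. u x - u\<^sub>T x) \<le> C * ((m + 1) * S)"
      by (rule mult_left_mono[OF uS]) (use C(1) in simp)
    then have dyS: "L2_norm \<Omega> (weak_grad \<Omega> ?dy) \<le> C * (m + 1) * S" "L2_norm \<Omega> (\<lambda>x. p x - ph x) \<le> C * (m + 1) * S"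
      using C(2)[OF L2_space_diff[OF L2(1,2)], of ?dy "\<lambda>x. p x - ph x"] dy_sol by (auto simp: mult.assoc)
    have yS: "L2_norm \<Omega> (weak_grad \<Omega> (\<lambda>x. y x - y\<^sub>T x)) \<le> n1 * S"
      using weak_grad_triangle[OF y yh yT] dyS(1) S_parts(1) by (simp add: n1_def distrib_right)
    have pS: "L2_norm \<Omega> (\<lambda>x. p x - p\<^sub>T x) \<le> n1 * S"
      using L2_norm_triangle_diff[OF zero_mean_L2[OF p] zero_mean_L2[OF ph] zero_mean_L2[OF pT]] dyS(2) S_parts(2)
      by (simp add: n1_def distrib_right)
    have yS': "L2_norm \<Omega> (\<lambda>x. y x - y\<^sub>T x) \<le> R * n1 * S"
      using order_trans[OF R(2)[OF H10_vec_diff[OF y yT]] mult_left_mono[OF yS]] R(1) by (simp add: mult.assoc)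
    have "C * L2_norm \<Omega> (\<lambda>x. y x - y\<^sub>T x) \<le> C * (R * n1 * S)"
      by (rule mult_left_mono[OF yS']) (use C(1) in simp)
    then have dwS: "L2_norm \<Omega> (weak_grad \<Omega> ?dw) \<le> C * (R * n1) * S" "L2_norm \<Omega> (\<lambda>x. q x - qh x) \<le> C * (R * n1) * S"
      using C(2)[OF L2_space_diff[OF L2(4,8)], of ?dw "\<lambda>x. q x - qh x"] dw_sol by (auto simp: mult.assoc)
    have wS: "L2_norm \<Omega> (weak_grad \<Omega> (\<lambda>x. w x - w\<^sub>T x)) \<le> n2 * S"
      using weak_grad_triangle[OF w wh wT] dwS(1) S_parts(3) by (simp add: n2_def distrib_right)
    have qS: "L2_norm \<Omega> (\<lambda>x. q x - q\<^sub>T x) \<le> n2 * S"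
      using L2_norm_triangle_diff[OF zero_mean_L2[OF q] zero_mean_L2[OF qh] zero_mean_L2[OF qT]] dwS(2) S_parts(4)
      by (simp add: n2_def distrib_right)
    have wS': "L2_norm \<Omega> (\<lambda>x. w x - w\<^sub>T x) \<le> R * n2 * S"
      using order_trans[OF R(2)[OF H10_vec_diff[OF w wT]] mult_left_mono[OF wS]] R(1) by (simp add: mult.assoc)
    show "L2_norm \<Omega> (weak_grad \<Omega> (\<lambda>x. y x - y\<^sub>T x)) \<le> A * S \<and> L2_norm \<Omega> (\<lambda>x. y x - y\<^sub>T x) \<le> A * S \<and>
      L2_norm \<Omega> (\<lambda>x. p x - p\<^sub>T x) \<le> A * S \<and>
      L2_norm \<Omega> (weak_grad \<Omega> (\<lambda>x. w x - w\<^sub>T x)) \<le> A * S \<and> L2_norm \<Omega> (\<lambda>x. w x - w\<^sub>T x) \<le> A * S \<and>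
      L2_norm \<Omega> (\<lambda>x. q x - q\<^sub>T x) \<le> A * S \<and> L2_norm \<Omega> (\<lambda>x. u x - u\<^sub>T x) \<le> A * S"
      using uS yS yS' pS wS wS' qS A_ge[THEN mult_right_mono, OF S] by (intro conjI; linarith)
  qed
qed

end

text \<open>The hidden constants of the assumed relations are the fixed numbers
  \<open>C\<^sub>y\<close>, \<open>C\<^sub>p\<close>, \<open>C\<^sub>w\<close>,
  \<open>C\<^sub>q\<close>, and the existential constant precedes the mesh family and all discrete
  objects. The global estimate has to be translated to sums over elements; as squared norms are
  exactly additive, the number of elements leaves no trace.\<close>

theorem corollary5p3:
  fixes \<Omega> :: "(real^'n) set"
    and c :: "real^'n \<Rightarrow> real^'n"
    and \<epsilon> \<kappa> \<theta> \<rho> \<beta> \<sigma> C\<^sub>y C\<^sub>p C\<^sub>w C\<^sub>q :: real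
  assumes "CARD('n) \<in> {2, 3}"
    and "polytopal_lipschitz_domain \<Omega>"
    and "\<epsilon> > 0" and "\<kappa> \<ge> 0" and "\<theta> > 0" and "\<rho> \<ge> 0"
    and "c \<in> W1inf_vec \<Omega>" and "AE x in lebesgue_on \<Omega>. weak_div \<Omega> c x = 0"
    and "\<beta> > 0" and "inf_sup_condition \<Omega> \<beta>"
    and "\<sigma> > 0"
    and "C\<^sub>y > 0" and "C\<^sub>p > 0" and "C\<^sub>w > 0" and "C\<^sub>q > 0"
  shows "\<exists>C>0. \<forall>\<F> \<T> f y\<^sub>\<Omega> a b y p w q u V\<^sub>T Q\<^sub>T U\<^sub>T \<S> \<H> \<Q> \<K> y\<^sub>T p\<^sub>T w\<^sub>T q\<^sub>T u\<^sub>T yh ph wh qh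
            \<eta>\<^sub>y \<eta>\<^sub>p \<eta>\<^sub>w \<eta>\<^sub>q \<eta>t\<^sub>y \<eta>t\<^sub>p \<eta>t\<^sub>w \<eta>t\<^sub>q.
      shape_regular_family \<Omega> \<sigma> \<F> \<and> \<T> \<in> \<F> \<and>
      f \<in> L2_space \<Omega> \<and> y\<^sub>\<Omega> \<in> L2_space \<Omega> \<and> (\<forall>i. a $ i < b $ i) \<and>
      optimality_system \<Omega> \<epsilon> \<kappa> c \<theta> f y\<^sub>\<Omega> a b y p w q u \<and>
      V\<^sub>T \<subseteq> H10_vec \<Omega> \<and> function_subspace V\<^sub>T \<and>
      Q\<^sub>T \<subseteq> L2_zero_mean \<Omega> \<and> function_subspace Q\<^sub>T \<and>
      U\<^sub>T \<subseteq> U_ad \<Omega> a b \<and>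
      discrete_optimality_system \<Omega> \<epsilon> \<kappa> c \<theta> f y\<^sub>\<Omega> V\<^sub>T Q\<^sub>T U\<^sub>T \<S> \<H> \<Q> \<K> y\<^sub>T p\<^sub>T w\<^sub>T q\<^sub>T u\<^sub>T \<and>
      state_solution \<Omega> \<epsilon> \<kappa> c (\<lambda>x. f x + u\<^sub>T x) yh ph \<and>
      adjoint_solution \<Omega> \<epsilon> \<kappa> c (\<lambda>x. y\<^sub>T x - y\<^sub>\<Omega> x) wh qh \<and>
      (\<forall>K\<in>\<T>. 0 \<le> \<eta>\<^sub>y K \<and> 0 \<le> \<eta>\<^sub>p K \<and> 0 \<le> \<eta>\<^sub>w K \<and> 0 \<le> \<eta>\<^sub>q K) \<and>
      (V_norm_mesh \<Omega> \<epsilon> \<kappa> \<T> (\<lambda>x. yh x - y\<^sub>T x))\<^sup>2 \<le> (\<Sum>K\<in>\<T>. (\<eta>\<^sub>y K)\<^sup>2) \<and>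
      (Q_norm_mesh \<T> (\<lambda>x. ph x - p\<^sub>T x))\<^sup>2 \<le> (\<Sum>K\<in>\<T>. (\<eta>\<^sub>p K)\<^sup>2) \<and>
      (V_norm_mesh \<Omega> \<epsilon> \<kappa> \<T> (\<lambda>x. wh x - w\<^sub>T x))\<^sup>2 \<le> (\<Sum>K\<in>\<T>. (\<eta>\<^sub>w K)\<^sup>2) \<and>
      (Q_norm_mesh \<T> (\<lambda>x. qh x - q\<^sub>T x))\<^sup>2 \<le> (\<Sum>K\<in>\<T>. (\<eta>\<^sub>q K)\<^sup>2) \<and>
      (\<forall>K\<in>\<T>. \<eta>\<^sub>y K \<le> C\<^sub>y * \<eta>t\<^sub>y K \<and> \<eta>\<^sub>p K \<le> C\<^sub>p * \<eta>t\<^sub>p K \<and>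
              \<eta>\<^sub>w K \<le> C\<^sub>w * \<eta>t\<^sub>w K \<and> \<eta>\<^sub>q K \<le> C\<^sub>q * \<eta>t\<^sub>q K)
      \<longrightarrow> (total_error \<Omega> \<epsilon> \<kappa> \<rho> (\<lambda>x. y x - y\<^sub>T x) (\<lambda>x. p x - p\<^sub>T x)
             (\<lambda>x. w x - w\<^sub>T x) (\<lambda>x. q x - q\<^sub>T x) (\<lambda>x. u x - u\<^sub>T x) \<T>)\<^sup>2
          \<le> C * (\<Sum>K\<in>\<T>. (\<eta>t\<^sub>y K)\<^sup>2 + (\<eta>t\<^sub>p K)\<^sup>2 + (\<eta>t\<^sub>w K)\<^sup>2 + (\<eta>t\<^sub>q K)\<^sup>2
                         + (control_indicator \<theta> a b w\<^sub>T u\<^sub>T K)\<^sup>2)"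
proof -
  have dom: "open \<Omega>" "bounded \<Omega>" and lip: "has_lipschitz_boundary \<Omega>"
    using assms(2) by (auto simp: polytopal_lipschitz_domain_def)
  interpret oseen \<Omega> c \<epsilon> \<kappa> \<beta>
    using assms dom by unfold_locales auto
  obtain A where A: "A > 0" and bound: "\<And>f y\<^sub>\<Omega> a b y p w q u y\<^sub>T p\<^sub>T w\<^sub>T q\<^sub>T u\<^sub>T yh ph wh qh S.
      f \<in> L2_space \<Omega> \<Longrightarrow> y\<^sub>\<Omega> \<in> L2_space \<Omega> \<Longrightarrow> \<forall>i. a $ i < b $ i \<Longrightarrow>
      optimality_system \<Omega> \<epsilon> \<kappa> c \<theta> f y\<^sub>\<Omega> a b y p w q u \<Longrightarrow>
      y\<^sub>T \<in> H10_vec \<Omega> \<Longrightarrow> p\<^sub>T \<in> L2_zero_mean \<Omega> \<Longrightarrow> w\<^sub>T \<in> H10_vec \<Omega> \<Longrightarrow> q\<^sub>T \<in> L2_zero_mean \<Omega> \<Longrightarrow>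
      u\<^sub>T \<in> U_ad \<Omega> a b \<Longrightarrow>
      state_solution \<Omega> \<epsilon> \<kappa> c (\<lambda>x. f x + u\<^sub>T x) yh ph \<Longrightarrow>
      adjoint_solution \<Omega> \<epsilon> \<kappa> c (\<lambda>x. y\<^sub>T x - y\<^sub>\<Omega> x) wh qh \<Longrightarrow>
      S = L2_norm \<Omega> (weak_grad \<Omega> (\<lambda>x. yh x - y\<^sub>T x)) + L2_norm \<Omega> (\<lambda>x. ph x - p\<^sub>T x)
        + L2_norm \<Omega> (weak_grad \<Omega> (\<lambda>x. wh x - w\<^sub>T x)) + L2_norm \<Omega> (\<lambda>x. qh x - q\<^sub>T x)
        + control_indicator \<theta> a b w\<^sub>T u\<^sub>T \<Omega> \<Longrightarrow>
      L2_norm \<Omega> (weak_grad \<Omega> (\<lambda>x. y x - y\<^sub>T x)) \<le> A * S \<and> L2_norm \<Omega> (\<lambda>x. y x - y\<^sub>T x) \<le> A * S \<and>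
      L2_norm \<Omega> (\<lambda>x. p x - p\<^sub>T x) \<le> A * S \<and>
      L2_norm \<Omega> (weak_grad \<Omega> (\<lambda>x. w x - w\<^sub>T x)) \<le> A * S \<and> L2_norm \<Omega> (\<lambda>x. w x - w\<^sub>T x) \<le> A * S \<and>
      L2_norm \<Omega> (\<lambda>x. q x - q\<^sub>T x) \<le> A * S \<and> L2_norm \<Omega> (\<lambda>x. u x - u\<^sub>T x) \<le> A * S"
    by (rule reliability[OF assms(5)]) blast
  \<comment> \<open>\<open>k\<close> adds up the weights with which the seven bounds
    \<open>A * S\<close> enter the total error. \<open>M\<close> majorises each factor that converts
    a squared estimator on \<Omega> into computable quantities; its 1 belongs to the control
    indicator.\<close>
  define k where "k = 2 * \<epsilon> + 2 * \<kappa> + 2 * \<rho> + 1"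
  define M where "M = C\<^sub>y\<^sup>2 / \<epsilon> + C\<^sub>p\<^sup>2 + C\<^sub>w\<^sup>2 / \<epsilon> + C\<^sub>q\<^sup>2 + 1"
  have kpos: "k > 0" using assms by (simp add: k_def)
  have Mparts: "C\<^sub>y\<^sup>2 / \<epsilon> \<le> M" "C\<^sub>p\<^sup>2 \<le> M" "C\<^sub>w\<^sup>2 / \<epsilon> \<le> M" "C\<^sub>q\<^sup>2 \<le> M" "1 \<le> M"
    using assms(3) by (simp_all add: M_def add_nonneg_nonneg)
  have Mpos: "M > 0" using Mparts(5) by linarith
  show ?thesis
  proof (rule exI[of _ "k * A\<^sup>2 * (5 * M)"], intro conjI allI impI, goal_cases)
    case 1
    show ?case using kpos A Mpos by simp
  next
    case prems: (2 \<F> \<T> f y\<^sub>\<Omega> a b y p w q u V\<^sub>T Q\<^sub>T U\<^sub>T \<S> \<H> \<Q> \<K> y\<^sub>T p\<^sub>T w\<^sub>T q\<^sub>T u\<^sub>T yh ph wh qh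
            \<eta>\<^sub>y \<eta>\<^sub>p \<eta>\<^sub>w \<eta>\<^sub>q \<eta>t\<^sub>y \<eta>t\<^sub>p \<eta>t\<^sub>w \<eta>t\<^sub>q)
    have mesh: "conforming_mesh \<Omega> \<T>" using prems by (auto simp: shape_regular_family_def)
    have data: "f \<in> L2_space \<Omega>" "y\<^sub>\<Omega> \<in> L2_space \<Omega>" "\<forall>i. a $ i < b $ i"
      "optimality_system \<Omega> \<epsilon> \<kappa> c \<theta> f y\<^sub>\<Omega> a b y p w q u"
      and hat: "state_solution \<Omega> \<epsilon> \<kappa> c (\<lambda>x. f x + u\<^sub>T x) yh ph" "adjoint_solution \<Omega> \<epsilon> \<kappa> c (\<lambda>x. y\<^sub>T x - y\<^sub>\<Omega> x) wh qh"
      using prems by blast+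
    \<comment> \<open>Conformity places the discrete solution in the continuous spaces, as
      \<open>bound\<close> requires.\<close>
    have discrete: "y\<^sub>T \<in> H10_vec \<Omega>" "p\<^sub>T \<in> L2_zero_mean \<Omega>" "w\<^sub>T \<in> H10_vec \<Omega>" "q\<^sub>T \<in> L2_zero_mean \<Omega>" "u\<^sub>T \<in> U_ad \<Omega> a b"
      using prems unfolding discrete_optimality_system_def by blast+
    have mem: "y \<in> H10_vec \<Omega>" "w \<in> H10_vec \<Omega>" "p \<in> L2_zero_mean \<Omega>" "q \<in> L2_zero_mean \<Omega>" "u \<in> U_ad \<Omega> a b"
      "yh \<in> H10_vec \<Omega>" "wh \<in> H10_vec \<Omega>" "ph \<in> L2_zero_mean \<Omega>" "qh \<in> L2_zero_mean \<Omega>"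
      using data(4) hat by (auto simp: optimality_system_def state_solution_def adjoint_solution_def)
    note sumL2 = conforming_mesh_sum_L2_norm[OF dom(1) lip mesh]
    have V_sum: "(\<Sum>K\<in>\<T>. (V_norm \<Omega> \<epsilon> \<kappa> K \<xi>)\<^sup>2) = \<epsilon> * (L2_norm \<Omega> (weak_grad \<Omega> \<xi>))\<^sup>2 + \<kappa> * (L2_norm \<Omega> \<xi>)\<^sup>2"
      if "\<xi> \<in> H10_vec \<Omega>" for \<xi>
      using assms(3,4) by (simp add: V_norm_def sum.distrib sum_distrib_left[symmetric] sumL2 weak_grad_L2 H10_vec_L2 that)
    have Q_L2: "(\<lambda>x. \<phi> x - \<psi> x) \<in> L2_space \<Omega>" if "\<phi> \<in> L2_zero_mean \<Omega>" "\<psi> \<in> L2_zero_mean \<Omega>" for \<phi> \<psi>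
      by (intro L2_space_diff zero_mean_L2 that)
    have U_L2: "(\<lambda>x. v x - v' x) \<in> L2_space \<Omega>" if "v \<in> U_ad \<Omega> a b" "v' \<in> U_ad \<Omega> a b" for v v'
      using that by (auto simp: U_ad_def intro: L2_space_diff)
    have proj: "box_projection a b (\<lambda>z. - (1 / \<theta>) *\<^sub>R w\<^sub>T z) \<in> U_ad \<Omega> a b"
      by (rule box_projection_in_U_ad[OF dom(2,1) data(3) L2_spaceD(1)[OF L2_space_scaleR[OF H10_vec_L2[OF discrete(3)]]]])

    define n1 n2 n3 n4 n5 where "n1 = L2_norm \<Omega> (weak_grad \<Omega> (\<lambda>x. yh x - y\<^sub>T x))" and "n2 = L2_norm \<Omega> (\<lambda>x. ph x - p\<^sub>T x)"
      and "n3 = L2_norm \<Omega> (weak_grad \<Omega> (\<lambda>x. wh x - w\<^sub>T x))" and "n4 = L2_norm \<Omega> (\<lambda>x. qh x - q\<^sub>T x)"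
      and "n5 = control_indicator \<theta> a b w\<^sub>T u\<^sub>T \<Omega>"
    define S where "S = n1 + n2 + n3 + n4 + n5"
    note errs = bound[OF data discrete hat S_def[unfolded n1_def n2_def n3_def n4_def n5_def]]

    have "(total_error \<Omega> \<epsilon> \<kappa> \<rho> (\<lambda>x. y x - y\<^sub>T x) (\<lambda>x. p x - p\<^sub>T x)
             (\<lambda>x. w x - w\<^sub>T x) (\<lambda>x. q x - q\<^sub>T x) (\<lambda>x. u x - u\<^sub>T x) \<T>)\<^sup>2
        = (\<epsilon> * (L2_norm \<Omega> (weak_grad \<Omega> (\<lambda>x. y x - y\<^sub>T x)))\<^sup>2 + \<kappa> * (L2_norm \<Omega> (\<lambda>x. y x - y\<^sub>T x))\<^sup>2)
          + \<rho> * (L2_norm \<Omega> (\<lambda>x. p x - p\<^sub>T x))\<^sup>2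
          + (\<epsilon> * (L2_norm \<Omega> (weak_grad \<Omega> (\<lambda>x. w x - w\<^sub>T x)))\<^sup>2 + \<kappa> * (L2_norm \<Omega> (\<lambda>x. w x - w\<^sub>T x))\<^sup>2)
          + \<rho> * (L2_norm \<Omega> (\<lambda>x. q x - q\<^sub>T x))\<^sup>2 + (L2_norm \<Omega> (\<lambda>x. u x - u\<^sub>T x))\<^sup>2"
      using assms(3,4,6)
      by (simp add: total_error_def local_error_def sum_nonneg add_nonneg_nonneg sum.distrib
          sum_distrib_left[symmetric] V_sum sumL2 H10_vec_diff Q_L2 U_L2 mem discrete)
    also have "\<dots> \<le> (\<epsilon> * (A * S)\<^sup>2 + \<kappa> * (A * S)\<^sup>2) + \<rho> * (A * S)\<^sup>2
        + (\<epsilon> * (A * S)\<^sup>2 + \<kappa> * (A * S)\<^sup>2) + \<rho> * (A * S)\<^sup>2 + (A * S)\<^sup>2"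
      using errs assms(3,4,6) by (intro add_mono mult_left_mono power_mono L2_norm_nonneg) auto
    also have "\<dots> = k * A\<^sup>2 * S\<^sup>2" by (simp add: k_def power_mult_distrib algebra_simps)
    also have "S\<^sup>2 \<le> 5 * (n1\<^sup>2 + n2\<^sup>2 + n3\<^sup>2 + n4\<^sup>2 + n5\<^sup>2)"
    proof -
      \<comment> \<open>The ten squared differences sum to \<open>5 * (n1\<^sup>2 + n2\<^sup>2 +
        n3\<^sup>2 + n4\<^sup>2 + n5\<^sup>2)\<close> minus the square of the sum.\<close>
      have "0 \<le> (n1 - n2)\<^sup>2 + (n1 - n3)\<^sup>2 + (n1 - n4)\<^sup>2 + (n1 - n5)\<^sup>2 + (n2 - n3)\<^sup>2
          + (n2 - n4)\<^sup>2 + (n2 - n5)\<^sup>2 + (n3 - n4)\<^sup>2 + (n3 - n5)\<^sup>2 + (n4 - n5)\<^sup>2" by simp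
      then show ?thesis unfolding S_def by (simp add: power2_eq_square algebra_simps)
    qed
    also have "n1\<^sup>2 + n2\<^sup>2 + n3\<^sup>2 + n4\<^sup>2 + n5\<^sup>2 \<le> M * (\<Sum>K\<in>\<T>. (\<eta>t\<^sub>y K)\<^sup>2 + (\<eta>t\<^sub>p K)\<^sup>2 + (\<eta>t\<^sub>w K)\<^sup>2 + (\<eta>t\<^sub>q K)\<^sup>2
                         + (control_indicator \<theta> a b w\<^sub>T u\<^sub>T K)\<^sup>2)"
    proof -
      \<comment> \<open>Nonnegativity of the smaller quantity makes squaring monotone, whatever sign
        the computable numbers are given in advance.\<close>
      have scale: "(\<Sum>K\<in>\<T>. (\<eta> K)\<^sup>2) \<le> D\<^sup>2 * (\<Sum>K\<in>\<T>. (\<eta>' K)\<^sup>2)"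
        if "\<And>K. K \<in> \<T> \<Longrightarrow> 0 \<le> \<eta> K" "\<And>K. K \<in> \<T> \<Longrightarrow> \<eta> K \<le> D * \<eta>' K" for \<eta> \<eta>' :: "(real^'n) set \<Rightarrow> real" and D
        unfolding sum_distrib_left power_mult_distrib[symmetric] by (intro sum_mono power_mono that)
      \<comment> \<open>The squared V norm dominates \<epsilon> times the squared gradient norm, as
        \<kappa> is nonnegative; dividing by \<epsilon> explains the quotients in
        \<open>M\<close>.\<close>
      have grad: "(L2_norm \<Omega> (weak_grad \<Omega> \<xi>))\<^sup>2 \<le> D\<^sup>2 / \<epsilon> * T"
        if "\<xi> \<in> H10_vec \<Omega>" "(V_norm_mesh \<Omega> \<epsilon> \<kappa> \<T> \<xi>)\<^sup>2 \<le> N" "N \<le> D\<^sup>2 * T" for \<xi> N D T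
      proof -
        have "\<epsilon> * (L2_norm \<Omega> (weak_grad \<Omega> \<xi>))\<^sup>2 \<le> \<epsilon> * (L2_norm \<Omega> (weak_grad \<Omega> \<xi>))\<^sup>2 + \<kappa> * (L2_norm \<Omega> \<xi>)\<^sup>2"
          using assms(4) by simp
        also have "\<dots> = (V_norm_mesh \<Omega> \<epsilon> \<kappa> \<T> \<xi>)\<^sup>2"
          using assms(3,4) by (simp add: V_norm_mesh_def sum_nonneg V_sum that)
        finally have "\<epsilon> * (L2_norm \<Omega> (weak_grad \<Omega> \<xi>))\<^sup>2 \<le> D\<^sup>2 * T" using that by linarith
        then show ?thesis using assms(3) by (simp add: field_simps)
      qed
      have Q_mesh: "(Q_norm_mesh \<T> \<phi>)\<^sup>2 = (L2_norm \<Omega> \<phi>)\<^sup>2" if "\<phi> \<in> L2_space \<Omega>" for \<phi>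
        by (simp add: Q_norm_mesh_def sum_nonneg sumL2 that)
      have \<eta>: "0 \<le> \<eta>\<^sub>y K" "0 \<le> \<eta>\<^sub>p K" "0 \<le> \<eta>\<^sub>w K" "0 \<le> \<eta>\<^sub>q K"
        "\<eta>\<^sub>y K \<le> C\<^sub>y * \<eta>t\<^sub>y K" "\<eta>\<^sub>p K \<le> C\<^sub>p * \<eta>t\<^sub>p K" "\<eta>\<^sub>w K \<le> C\<^sub>w * \<eta>t\<^sub>w K" "\<eta>\<^sub>q K \<le> C\<^sub>q * \<eta>t\<^sub>q K"
        if "K \<in> \<T>" for K
        using prems that by blast+
      have est: "(V_norm_mesh \<Omega> \<epsilon> \<kappa> \<T> (\<lambda>x. yh x - y\<^sub>T x))\<^sup>2 \<le> (\<Sum>K\<in>\<T>. (\<eta>\<^sub>y K)\<^sup>2)"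
        "(Q_norm_mesh \<T> (\<lambda>x. ph x - p\<^sub>T x))\<^sup>2 \<le> (\<Sum>K\<in>\<T>. (\<eta>\<^sub>p K)\<^sup>2)"
        "(V_norm_mesh \<Omega> \<epsilon> \<kappa> \<T> (\<lambda>x. wh x - w\<^sub>T x))\<^sup>2 \<le> (\<Sum>K\<in>\<T>. (\<eta>\<^sub>w K)\<^sup>2)"
        "(Q_norm_mesh \<T> (\<lambda>x. qh x - q\<^sub>T x))\<^sup>2 \<le> (\<Sum>K\<in>\<T>. (\<eta>\<^sub>q K)\<^sup>2)"
        using prems by blast+
      have nn: "0 \<le> (\<Sum>K\<in>\<T>. (\<eta> K)\<^sup>2)" for \<eta> :: "(real^'n) set \<Rightarrow> real" by (simp add: sum_nonneg)
      have "n1\<^sup>2 \<le> C\<^sub>y\<^sup>2 / \<epsilon> * (\<Sum>K\<in>\<T>. (\<eta>t\<^sub>y K)\<^sup>2)" unfolding n1_def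
        by (rule grad[OF H10_vec_diff[OF mem(6) discrete(1)] est(1) scale[OF \<eta>(1,5)]])
      also have "\<dots> \<le> M * (\<Sum>K\<in>\<T>. (\<eta>t\<^sub>y K)\<^sup>2)" by (rule mult_right_mono[OF Mparts(1) nn])
      finally have 1: "n1\<^sup>2 \<le> M * (\<Sum>K\<in>\<T>. (\<eta>t\<^sub>y K)\<^sup>2)" .
      have "n2\<^sup>2 \<le> C\<^sub>p\<^sup>2 * (\<Sum>K\<in>\<T>. (\<eta>t\<^sub>p K)\<^sup>2)" unfolding n2_def
        unfolding Q_mesh[OF Q_L2[OF mem(8) discrete(2)], symmetric]
        by (rule order_trans[OF est(2) scale[OF \<eta>(2,6)]])
      also have "\<dots> \<le> M * (\<Sum>K\<in>\<T>. (\<eta>t\<^sub>p K)\<^sup>2)" by (rule mult_right_mono[OF Mparts(2) nn])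
      finally have 2: "n2\<^sup>2 \<le> M * (\<Sum>K\<in>\<T>. (\<eta>t\<^sub>p K)\<^sup>2)" .
      have "n3\<^sup>2 \<le> C\<^sub>w\<^sup>2 / \<epsilon> * (\<Sum>K\<in>\<T>. (\<eta>t\<^sub>w K)\<^sup>2)" unfolding n3_def
        by (rule grad[OF H10_vec_diff[OF mem(7) discrete(3)] est(3) scale[OF \<eta>(3,7)]])
      also have "\<dots> \<le> M * (\<Sum>K\<in>\<T>. (\<eta>t\<^sub>w K)\<^sup>2)" by (rule mult_right_mono[OF Mparts(3) nn])
      finally have 3: "n3\<^sup>2 \<le> M * (\<Sum>K\<in>\<T>. (\<eta>t\<^sub>w K)\<^sup>2)" .
      have "n4\<^sup>2 \<le> C\<^sub>q\<^sup>2 * (\<Sum>K\<in>\<T>. (\<eta>t\<^sub>q K)\<^sup>2)" unfolding n4_def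
        unfolding Q_mesh[OF Q_L2[OF mem(9) discrete(4)], symmetric]
        by (rule order_trans[OF est(4) scale[OF \<eta>(4,8)]])
      also have "\<dots> \<le> M * (\<Sum>K\<in>\<T>. (\<eta>t\<^sub>q K)\<^sup>2)" by (rule mult_right_mono[OF Mparts(4) nn])
      finally have 4: "n4\<^sup>2 \<le> M * (\<Sum>K\<in>\<T>. (\<eta>t\<^sub>q K)\<^sup>2)" .
      have "n5\<^sup>2 = (\<Sum>K\<in>\<T>. (control_indicator \<theta> a b w\<^sub>T u\<^sub>T K)\<^sup>2)"
        unfolding n5_def control_indicator_def by (rule sumL2[OF U_L2[OF proj discrete(5)], symmetric])
      then have 5: "n5\<^sup>2 \<le> M * (\<Sum>K\<in>\<T>. (control_indicator \<theta> a b w\<^sub>T u\<^sub>T K)\<^sup>2)"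
        using mult_right_mono[OF Mparts(5) nn] by simp
      show ?thesis using 1 2 3 4 5 by (simp add: sum.distrib distrib_left)
    qed
    finally show ?case using kpos by (simp add: mult.assoc mult_left_mono)
  qed
qed

end
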